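(* Let a significance level $\alpha\in(0,1)$ and an acceptance probability $\beta\in(0,1)$ be given. Then there exist positive real numbers $c_1$ and $c_2$ (not depending on $m$) such that for every positive integer $m$ the following hold for the test called Test (2) (defined in the context) run with parameters $m$ and $c_1$. (i) If the state is the ideal state $(|0,+\rangle+|1,-\rangle)/\sqrt2$ and the measurements are the ideal ones (no error), then Test (2) is passed with probability at least $\beta$. (ii) Once Test (2) is passed, it is guaranteed with significance level $\alpha$ that there exists an isometry $U:\mathcal H_1'\to\mathcal H_1$ such that $$\|UX_1'U^\dagger-X_1\|\le\delta,\quad \|UZ_1'U^\dagger-Z_1\|\le\delta,\quad \|UA(0)_1'U^\dagger-A(0)_1\|\le\delta,\quad \|UA(1)_1'U^\dagger-A(1)_1\|\le\delta,$$ where $\delta:=c_2\,m^{-1/4}$ and $\|\cdot\|$ is the operator norm.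
   Context: Ideal (trusted) objects: $\mathcal H_1=\mathcal H_2=\mathbb C^2$, $X=|1\rangle\langle0|+|0\rangle\langle1|$, $Z=|0\rangle\langle0|-|1\rangle\langle1|$, $A(0)=(X+Z)/\sqrt2$, $A(1)=(X-Z)/\sqrt2$, $|\pm\rangle=(|0\rangle\pm|1\rangle)/\sqrt2$; a subscript $1$ or $2$ indicates the system on which the operator acts. The ideal state is $(|0,+\rangle+|1,-\rangle)/\sqrt2\in\mathcal H_1\otimes\mathcal H_2$. Real (untrusted) objects, written with primes: Hilbert spaces $\mathcal H_1',\mathcal H_2'$ (not assumed to be $\mathbb C^2$), a unit vector $|\Phi'\rangle\in\mathcal H_1'\otimes\mathcal H_2'$, and $\pm1$-valued observables (self-adjoint operators with square the identity, measured projectively) $X_1',Z_1',A(0)_1',A(1)_1'$ on $\mathcal H_1'$ and $X_2',Z_2'$ on $\mathcal H_2'$. "No error" means that the real objects equal the ideal ones. Test (2) with parameters $m,c_1$: prepare $8m$ copies of $|\Phi'\rangle$ and divide them randomly into 8 groups of $m$ copies. In groups $1,\dots,8$ measure, on $\mathcal H_1'$, respectively $X_1',Z_1',A(0)_1',A(0)_1',A(1)_1',A(1)_1',X_1',Z_1'$, and on $\mathcal H_2'$, respectively $Z_2',X_2',Z_2',X_2',Z_2',X_2',X_2',Z_2'$. Let $Av$ denote the empirical average over a group of the product of the two outcomes, extended linearly to sums/differences using the relevant groups (e.g. $Av[A(0)_1'(Z_2'+X_2')]$ is the group-3 average plus the group-4 average). The test is passed iff $Av[X_1'Z_2']=1$;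 $Av[Z_1'X_2']=1$ (groups 1, 2); $Av[A(0)_1'(Z_2'+X_2')]\ge\sqrt2-c_1/\sqrt m$ (groups 3, 4); $Av[A(1)_1'(Z_2'-X_2')]\ge\sqrt2-c_1/\sqrt m$ (groups 5, 6); $|Av[X_1'X_2'+Z_1'Z_2']|\le c_1/\sqrt m$ (groups 7, 8). "Once the test is passed, property $S$ is guaranteed with significance level $\alpha$", for a property $S$ of the real state and devices, means: whenever the real state and devices do not satisfy $S$, the probability of passing the test is at most $\alpha$.
   Formalization: "Isometry U" is read as U or U† norm-preserving (UU†=1 when dim H1'>2), since literally no isometry H1'→C² exists then and ideal devices with an ancilla refute the claim; the Hilbert spaces range over closed subspaces of arbitrary fixed ambient spaces. *)

theory Defs
  imports "HOL-Probability.Probability"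
begin

section \<open>Complex Hilbert spaces\<close>

text \<open>The inner product is linear in its second argument.\<close>

class complex_hilbert = banach +
  fixes scaleC :: "complex \<Rightarrow> 'a \<Rightarrow> 'a" (infixr "*\<^sub>C" 75)
    and cinner :: "'a \<Rightarrow> 'a \<Rightarrow> complex"
  assumes scaleC_add_right: "a *\<^sub>C (x + y) = a *\<^sub>C x + a *\<^sub>C y"
    and scaleC_add_left: "(a + b) *\<^sub>C x = a *\<^sub>C x + b *\<^sub>C x"
    and scaleC_scaleC: "a *\<^sub>C b *\<^sub>C x = (a * b) *\<^sub>C x"
    and scaleR_scaleC: "r *\<^sub>R x = complex_of_real r *\<^sub>C x"
    and cinner_commute: "cinner x y = cnj (cinner y x)"
    and cinner_add_right: "cinner x (y + z) = cinner x y + cinner x z"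
    and cinner_scaleC_right: "cinner x (a *\<^sub>C y) = a * cinner x y"
    and norm_eq_sqrt_cinner: "norm x = sqrt (Re (cinner x x))"

global_interpretation complex_space:
  vector_space "scaleC :: complex \<Rightarrow> 'a \<Rightarrow> 'a::complex_hilbert"
  defines csubspace = complex_space.subspace
    and cspan = complex_space.span
proof
  fix x :: 'a
  show "1 *\<^sub>C x = x"
    using scaleR_scaleC[of 1 x] by simp
qed (simp_all add: scaleC_add_right scaleC_add_left scaleC_scaleC)

instantiation complex :: complex_hilbert
begin
definition scaleC_complex :: "complex \<Rightarrow> complex \<Rightarrow> complex" where
  "scaleC_complex a x = a * x"
definition cinner_complex :: "complex \<Rightarrow> complex \<Rightarrow> complex" where
  "cinner_complex x y = cnj x * y"
instance
  by standard
    (simp_all add: scaleC_complex_def cinner_complex_def algebra_simps scaleR_conv_of_real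
      cmod_def power2_eq_square)
end

instantiation vec :: (complex_hilbert, finite) complex_hilbert
begin
definition scaleC_vec :: "complex \<Rightarrow> 'a ^ 'b \<Rightarrow> 'a ^ 'b" where
  "scaleC_vec a x = (\<chi> i. a *\<^sub>C (x $ i))"
definition cinner_vec :: "'a ^ 'b \<Rightarrow> 'a ^ 'b \<Rightarrow> complex" where
  "cinner_vec x y = (\<Sum>i\<in>UNIV. cinner (x $ i) (y $ i))"
instance
proof
  fix x y z :: "'a ^ 'b" and a b :: complex and r :: real
  show "cinner x y = cnj (cinner y x)"
    unfolding cinner_vec_def cnj_sum by (intro sum.cong refl cinner_commute)
  have "(norm (u :: 'a))\<^sup>2 = Re (cinner u u)" for u
    by (metis norm_eq_sqrt_cinner norm_ge_zero real_sqrt_ge_0_iff real_sqrt_pow2)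
  then show "norm x = sqrt (Re (cinner x x))"
    by (simp add: norm_vec_def L2_set_def cinner_vec_def)
qed (simp_all add: vec_eq_iff scaleC_vec_def cinner_vec_def scaleC_add_right scaleC_add_left
      scaleC_scaleC scaleR_scaleC cinner_add_right cinner_scaleC_right sum.distrib
      sum_distrib_left)
end

text \<open>
  A Hilbert space is represented by a closed complex subspace of an ambient type of class
  \<open>complex_hilbert\<close> (possibly \<open>UNIV\<close>). Constants can thereby be chosen before, and uniformly
  in, the Hilbert spaces, whereas a bare type variable could not be quantified under an
  existential quantifier. Operators are functions, of which only the values on the relevant
  subspace matter.
\<close>

definition clinear_on :: "'h::complex_hilbert set \<Rightarrow> ('h \<Rightarrow> 'k::complex_hilbert) \<Rightarrow> bool" where
  "clinear_on S f \<longleftrightarrow>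
     (\<forall>x\<in>S. \<forall>y\<in>S. f (x + y) = f x + f y) \<and> (\<forall>a. \<forall>x\<in>S. f (a *\<^sub>C x) = a *\<^sub>C f x)"

definition bounded_clinear_on ::
    "'h::complex_hilbert set \<Rightarrow> ('h \<Rightarrow> 'k::complex_hilbert) \<Rightarrow> bool" where
  "bounded_clinear_on S f \<longleftrightarrow> clinear_on S f \<and> (\<exists>K. \<forall>x\<in>S. norm (f x) \<le> K * norm x)"

definition hilbert_space_on :: "'h::complex_hilbert set \<Rightarrow> bool" where
  "hilbert_space_on S \<longleftrightarrow> csubspace S \<and> closed S"

text \<open>Observables with values \<open>1\<close> and \<open>-1\<close>; boundedness follows from the conditions.\<close>

definition pm1_observable :: "'h::complex_hilbert set \<Rightarrow> ('h \<Rightarrow> 'h) \<Rightarrow> bool" where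
  "pm1_observable S A \<longleftrightarrow>
     A ` S \<subseteq> S \<and> clinear_on S A \<and>
     (\<forall>x\<in>S. \<forall>y\<in>S. cinner (A x) y = cinner x (A y)) \<and> (\<forall>x\<in>S. A (A x) = x)"

text \<open>The spectral projection of such an observable for the value \<open>a\<close>, where \<open>a\<close> is \<open>1\<close> or \<open>-1\<close>.\<close>

definition spectral_proj :: "real \<Rightarrow> ('h::complex_hilbert \<Rightarrow> 'h) \<Rightarrow> 'h \<Rightarrow> 'h" where
  "spectral_proj a A x = (1 / 2) *\<^sub>R (x + a *\<^sub>R A x)"

text \<open>The adjoint of \<open>U : S \<rightarrow> 'k\<close>, as a map from \<open>'k\<close> to \<open>S\<close>.\<close>

definition adj_on ::
    "'h::complex_hilbert set \<Rightarrow> ('h \<Rightarrow> 'k::complex_hilbert) \<Rightarrow> 'k \<Rightarrow> 'h" where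
  "adj_on S U = (THE V. \<forall>y. V y \<in> S \<and> (\<forall>x\<in>S. cinner (U x) y = cinner x (V y)))"

text \<open>
  Isometries \<open>U\<close> from \<open>S\<close> to \<open>'k\<close>, where \<open>dim S\<close> may exceed the dimension of \<open>'k\<close>. In that case
  no map from \<open>S\<close> to \<open>'k\<close> preserves norms, and \<open>U\<close> is called an isometry if it is the adjoint
  of a norm-preserving map, i.e. if it satisfies \<open>U U\<^sup>\<dagger> = 1\<close>. If \<open>'k\<close> is finite-dimensional
  and \<open>dim S\<close> is at most the dimension of \<open>'k\<close>, the condition says that \<open>U\<close> preserves norms.
\<close>

definition isometry_on ::
    "'h::complex_hilbert set \<Rightarrow> ('h \<Rightarrow> 'k::complex_hilbert) \<Rightarrow> bool" where
  "isometry_on S U \<longleftrightarrow>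
     bounded_clinear_on S U \<and>
     ((\<forall>x\<in>S. norm (U x) = norm x) \<or> (\<forall>y. norm (adj_on S U y) = norm y))"


section \<open>Tensor products\<close>

definition tensor_space ::
    "'h::complex_hilbert set \<Rightarrow> 'k::complex_hilbert set \<Rightarrow> ('h \<Rightarrow> 'k \<Rightarrow> 't::complex_hilbert) \<Rightarrow> 't set"
  where "tensor_space S1 S2 tens = closure (cspan {tens x y | x y. x \<in> S1 \<and> y \<in> S2})"

text \<open>
  \<open>tens\<close> makes \<open>tensor_space S1 S2 tens\<close> a Hilbert space tensor product of \<open>S1\<close> and \<open>S2\<close>;
  the tensor product is determined by this up to a unique unitary map.
\<close>

definition hilbert_tensor ::
    "'h::complex_hilbert set \<Rightarrow> 'k::complex_hilbert set \<Rightarrow> ('h \<Rightarrow> 'k \<Rightarrow> 't::complex_hilbert) \<Rightarrow> bool"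
  where "hilbert_tensor S1 S2 tens \<longleftrightarrow>
     (\<forall>y\<in>S2. clinear_on S1 (\<lambda>x. tens x y)) \<and> (\<forall>x\<in>S1. clinear_on S2 (tens x)) \<and>
     (\<forall>x\<in>S1. \<forall>x'\<in>S1. \<forall>y\<in>S2. \<forall>y'\<in>S2.
        cinner (tens x y) (tens x' y') = cinner x x' * cinner y y')"

text \<open>The operator \<open>A \<otimes> B\<close>. Its values on the tensor product are determined, by density.\<close>

definition tensor_op ::
    "'h::complex_hilbert set \<Rightarrow> 'k::complex_hilbert set \<Rightarrow> ('h \<Rightarrow> 'k \<Rightarrow> 't::complex_hilbert) \<Rightarrow>
     ('h \<Rightarrow> 'h) \<Rightarrow> ('k \<Rightarrow> 'k) \<Rightarrow> 't \<Rightarrow> 't"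
  where "tensor_op S1 S2 tens A B =
     (SOME C. bounded_clinear_on (tensor_space S1 S2 tens) C \<and>
              (\<forall>x\<in>S1. \<forall>y\<in>S2. C (tens x y) = tens (A x) (B y)))"


section \<open>States and devices\<close>

record ('h, 'k, 't) scenario =
  space1 :: "'h set"
  space2 :: "'k set"
  tens :: "'h \<Rightarrow> 'k \<Rightarrow> 't"
  state :: "'t"
  obs_X1 :: "'h \<Rightarrow> 'h"
  obs_Z1 :: "'h \<Rightarrow> 'h"
  obs_A0 :: "'h \<Rightarrow> 'h"
  obs_A1 :: "'h \<Rightarrow> 'h"
  obs_X2 :: "'k \<Rightarrow> 'k"
  obs_Z2 :: "'k \<Rightarrow> 'k"

definition valid_scenario ::
    "('h::complex_hilbert, 'k::complex_hilbert, 't::complex_hilbert) scenario \<Rightarrow> bool" where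
  "valid_scenario E \<longleftrightarrow>
     hilbert_space_on (space1 E) \<and> hilbert_space_on (space2 E) \<and>
     hilbert_tensor (space1 E) (space2 E) (tens E) \<and>
     state E \<in> tensor_space (space1 E) (space2 E) (tens E) \<and> norm (state E) = 1 \<and>
     pm1_observable (space1 E) (obs_X1 E) \<and> pm1_observable (space1 E) (obs_Z1 E) \<and>
     pm1_observable (space1 E) (obs_A0 E) \<and> pm1_observable (space1 E) (obs_A1 E) \<and>
     pm1_observable (space2 E) (obs_X2 E) \<and> pm1_observable (space2 E) (obs_Z2 E)"

type_synonym qubit = "complex ^ 2"

definition ket :: "2 \<Rightarrow> qubit" where
  "ket k = axis k 1"

definition ket_plus :: qubit where
  "ket_plus = (1 / sqrt 2) *\<^sub>R (ket 0 + ket 1)"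

definition ket_minus :: qubit where
  "ket_minus = (1 / sqrt 2) *\<^sub>R (ket 0 - ket 1)"

definition ketbra :: "'h::complex_hilbert \<Rightarrow> 'h \<Rightarrow> 'h \<Rightarrow> 'h" where
  "ketbra u v x = cinner v x *\<^sub>C u"

definition ideal_X :: "qubit \<Rightarrow> qubit" where
  "ideal_X x = ketbra (ket 1) (ket 0) x + ketbra (ket 0) (ket 1) x"

definition ideal_Z :: "qubit \<Rightarrow> qubit" where
  "ideal_Z x = ketbra (ket 0) (ket 0) x - ketbra (ket 1) (ket 1) x"

definition ideal_A0 :: "qubit \<Rightarrow> qubit" where
  "ideal_A0 x = (1 / sqrt 2) *\<^sub>R (ideal_X x + ideal_Z x)"

definition ideal_A1 :: "qubit \<Rightarrow> qubit" where
  "ideal_A1 x = (1 / sqrt 2) *\<^sub>R (ideal_X x - ideal_Z x)"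

definition qubit_tensor :: "qubit \<Rightarrow> qubit \<Rightarrow> qubit ^ 2" where
  "qubit_tensor x y = (\<chi> i j. x $ i * y $ j)"

definition ideal_scenario :: "(qubit, qubit, qubit ^ 2) scenario" where
  "ideal_scenario =
    \<lparr> space1 = UNIV, space2 = UNIV, tens = qubit_tensor,
      state = (1 / sqrt 2) *\<^sub>R
        (qubit_tensor (ket 0) ket_plus + qubit_tensor (ket 1) ket_minus),
      obs_X1 = ideal_X, obs_Z1 = ideal_Z, obs_A0 = ideal_A0, obs_A1 = ideal_A1,
      obs_X2 = ideal_X, obs_Z2 = ideal_Z \<rparr>"


section \<open>The test\<close>

text \<open>
  The joint law of the two outcomes when \<open>A\<close> and \<open>B\<close> are measured projectively on the two
  halves of one copy of the state (Born rule).
\<close>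

definition born_pmf ::
    "('h::complex_hilbert, 'k::complex_hilbert, 't::complex_hilbert) scenario \<Rightarrow>
     ('h \<Rightarrow> 'h) \<times> ('k \<Rightarrow> 'k) \<Rightarrow> (real \<times> real) pmf" where
  "born_pmf E AB = embed_pmf (\<lambda>(a, b).
     if a \<in> {1, -1} \<and> b \<in> {1, -1}
     then (norm (tensor_op (space1 E) (space2 E) (tens E)
                  (spectral_proj a (fst AB)) (spectral_proj b (snd AB)) (state E)))\<^sup>2
     else 0)"

text \<open>The observables measured in group \<open>k\<close>, for \<open>k\<close> from \<open>1\<close> to \<open>8\<close>.\<close>

definition group_obs :: "('h, 'k, 't) scenario \<Rightarrow> nat \<Rightarrow> ('h \<Rightarrow> 'h) \<times> ('k \<Rightarrow> 'k)" where
  "group_obs E k =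
     [(obs_X1 E, obs_Z2 E), (obs_Z1 E, obs_X2 E),
      (obs_A0 E, obs_Z2 E), (obs_A0 E, obs_X2 E),
      (obs_A1 E, obs_Z2 E), (obs_A1 E, obs_X2 E),
      (obs_X1 E, obs_X2 E), (obs_Z1 E, obs_Z2 E)] ! (k - 1)"

text \<open>Divisions of the \<open>8 * m\<close> copies into \<open>8\<close> groups of size \<open>m\<close>: copy \<open>i\<close> is in group \<open>g i\<close>.\<close>

definition divisions :: "nat \<Rightarrow> (nat \<Rightarrow> nat) set" where
  "divisions m =
     {g \<in> {..<8 * m} \<rightarrow>\<^sub>E {1..8}. \<forall>k\<in>{1..8}. card {i \<in> {..<8 * m}. g i = k} = m}"

text \<open>
  The law of the random division together with the pairs of outcomes of all copies, the copies
  being independent given the division.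
\<close>

definition test_pmf ::
    "('h::complex_hilbert, 'k::complex_hilbert, 't::complex_hilbert) scenario \<Rightarrow> nat \<Rightarrow>
     ((nat \<Rightarrow> nat) \<times> (nat \<Rightarrow> real \<times> real)) pmf" where
  "test_pmf E m =
     bind_pmf (pmf_of_set (divisions m))
       (\<lambda>g. map_pmf (Pair g)
          (Pi_pmf {..<8 * m} (0, 0) (\<lambda>i. born_pmf E (group_obs E (g i)))))"

definition Av :: "nat \<Rightarrow> (nat \<Rightarrow> nat) \<Rightarrow> (nat \<Rightarrow> real \<times> real) \<Rightarrow> nat \<Rightarrow> real" where
  "Av m g r k = (\<Sum>i | i < 8 * m \<and> g i = k. fst (r i) * snd (r i)) / real m"

definition passes ::
    "nat \<Rightarrow> real \<Rightarrow> (nat \<Rightarrow> nat) \<times> (nat \<Rightarrow> real \<times> real) \<Rightarrow> bool" where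
  "passes m c1 = (\<lambda>(g, r).
     Av m g r 1 = 1 \<and> Av m g r 2 = 1 \<and>
     Av m g r 3 + Av m g r 4 \<ge> sqrt 2 - c1 / sqrt (real m) \<and>
     Av m g r 5 - Av m g r 6 \<ge> sqrt 2 - c1 / sqrt (real m) \<and>
     \<bar>Av m g r 7 + Av m g r 8\<bar> \<le> c1 / sqrt (real m))"

definition pass_prob ::
    "('h::complex_hilbert, 'k::complex_hilbert, 't::complex_hilbert) scenario \<Rightarrow> nat \<Rightarrow> real \<Rightarrow> real"
  where "pass_prob E m c1 = measure_pmf.prob (test_pmf E m) {w. passes m c1 w}"

text \<open>
  Once the test is passed, the property \<open>S\<close> of the state and devices is guaranteed with
  significance level \<open>\<alpha>\<close>.
\<close>

definition guaranteed ::
    "real \<Rightarrow> nat \<Rightarrow> real \<Rightarrow>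
     (('h::complex_hilbert, 'k::complex_hilbert, 't::complex_hilbert) scenario \<Rightarrow> bool) \<Rightarrow> bool" where
  "guaranteed \<alpha> m c1 S \<longleftrightarrow> (\<forall>E. valid_scenario E \<and> \<not> S E \<longrightarrow> pass_prob E m c1 \<le> \<alpha>)"

end

(*
  Self-testing. Passing the test with probability above alpha forces, by Chebyshev's inequality,
  <X1 Z2> and <Z1 X2> to be 1 - O(1/m), and the other correlations to be ideal up to O(1/sqrt m).
  Hence X1 and Z1 act on the state like Z2 and X2 up to O(m^(-1/2)), and A(0)1, A(1)1 act like
  (X1 + Z1)/sqrt 2, (X1 - Z1)/sqrt 2 up to O(m^(-1/4)). As A(0)1 squares to the identity,
  X1 and Z1 nearly anticommute on the state. These are bounds on norms of the form |(W (x) 1) Phi|,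
  so a single vector of the first space satisfies all of them; taking it in an eigenspace of Z1,
  it spans together with its image under X1 an approximate qubit, and the isometry reads off the
  two coordinates. For small m, where the bounds are void, any isometry will do.
*)

theory Submission
  imports Defs
begin

text \<open>Chebyshev's inequality serves only the conditions that tolerate an error. The first two
  demand the product 1 on every copy, an event of probability \<open>((1 + r) / 2) ^ m\<close> for
  correlation \<open>r\<close>; this is the origin of the rate 1/m. The deficit of a correlation
  controls a squared distance between vectors, so a deficit of order 1/sqrt m costs a square root,
  which fixes the exponent of the theorem. Groups 7 and 8 make Z2 Phi and X2 Phi nearly orthogonal;
  without them the length of Z2 Phi + X2 Phi, and so its distance from A(0)1 Phi, would be unknown.
  The obstacle is that all bounds concern one vector of a tensor product, possibly of infinite
  dimension. No Schmidt decomposition is used: finite sums of product vectors with orthogonal second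
  factors are dense, and on them the squared norm of W (x) 1 splits into squared norms of W on the
  first factors. One vector serves all bounds because the sum of all squared errors is compared with
  the squared norm of the projected state, which therefore has to be bounded below.\<close>

section \<open>Complex inner products\<close>

lemma cinner_add_left: "cinner (x + y) z = cinner x z + cinner y z"
  by (metis cinner_add_right cinner_commute complex_cnj_add)

lemma cinner_scaleC_left: "cinner (a *\<^sub>C x) y = cnj a * cinner x y"
  by (metis cinner_commute cinner_scaleC_right complex_cnj_mult)

lemma cinner_scaleR_right: "cinner x (r *\<^sub>R y) = of_real r * cinner x y"
  by (simp add: scaleR_scaleC cinner_scaleC_right)

lemma cinner_scaleR_left: "cinner (r *\<^sub>R x) y = of_real r * cinner x y"
  by (simp add: scaleR_scaleC cinner_scaleC_left)

lemma cinner_minus_right: "cinner x (- y) = - cinner x y"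
  using cinner_scaleR_right[of x "-1" y] by simp

lemma cinner_minus_left: "cinner (- x) y = - cinner x y"
  using cinner_scaleR_left[of "-1" x y] by simp

lemma cinner_diff_right: "cinner x (y - z) = cinner x y - cinner x z"
  using cinner_add_right[of x y "- z"] by (simp add: cinner_minus_right)

lemma cinner_diff_left: "cinner (x - y) z = cinner x z - cinner y z"
  using cinner_add_left[of x "- y" z] by (simp add: cinner_minus_left)

lemma cinner_zero_right [simp]: "cinner x 0 = 0"
  using cinner_scaleR_right[of x 0 0] by simp

lemma cinner_zero_left [simp]: "cinner 0 x = 0"
  using cinner_scaleR_left[of 0 0 x] by simp

lemma scaleC_zero_left [simp]: "0 *\<^sub>C x = (0 :: 'a::complex_hilbert)"
  by (rule complex_space.scale_zero_left)

lemma scaleC_zero_right [simp]: "a *\<^sub>C 0 = (0 :: 'a::complex_hilbert)"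
  by (rule complex_space.scale_zero_right)

lemma scaleC_one [simp]: "1 *\<^sub>C x = (x :: 'a::complex_hilbert)"
  by (rule complex_space.scale_one)

lemma cinner_sum_right: "cinner x (sum f A) = (\<Sum>i\<in>A. cinner x (f i))"
  by (induction A rule: infinite_finite_induct) (auto simp: cinner_add_right)

lemmas cinner_simps = cinner_add_left cinner_add_right cinner_diff_left cinner_diff_right
  cinner_scaleC_left cinner_scaleC_right cinner_scaleR_left cinner_scaleR_right
  cinner_minus_left cinner_minus_right

lemma Re_cinner_commute: "Re (cinner x y) = Re (cinner y x)"
  by (metis cinner_commute cnj.sel(1))

lemma Re_cinner_self: "Re (cinner x x) = (norm x)\<^sup>2"
  by (metis norm_eq_sqrt_cinner norm_ge_zero real_sqrt_ge_0_iff real_sqrt_pow2)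

lemma cinner_self: "cinner x x = of_real ((norm x)\<^sup>2)"
proof -
  have "Im (cinner x x) = 0"
    by (metis cinner_commute cnj.sel(2) neg_equal_zero)
  then show ?thesis
    by (simp add: complex_eq_iff Re_cinner_self del: of_real_power)
qed

lemma norm_add_square:
  "(norm (x + y))\<^sup>2 = (norm x)\<^sup>2 + (norm y)\<^sup>2 + 2 * Re (cinner x (y :: 'a::complex_hilbert))"
  using Re_cinner_commute[of y x] by (simp add: Re_cinner_self[symmetric] cinner_simps)

lemma norm_diff_square:
  "(norm (x - y))\<^sup>2 = (norm x)\<^sup>2 + (norm y)\<^sup>2 - 2 * Re (cinner x (y :: 'a::complex_hilbert))"
  using Re_cinner_commute[of y x] by (simp add: Re_cinner_self[symmetric] cinner_simps)

lemma norm_scaleC: "norm (a *\<^sub>C x) = cmod a * norm (x :: 'a::complex_hilbert)"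
proof -
  have "cinner (a *\<^sub>C x) (a *\<^sub>C x) = (a * cnj a) * cinner x x"
    by (simp add: cinner_scaleC_left cinner_scaleC_right)
  also have "a * cnj a = of_real ((cmod a)\<^sup>2)"
    by (rule complex_norm_square[symmetric])
  finally have "complex_of_real ((norm (a *\<^sub>C x))\<^sup>2) = of_real ((cmod a * norm x)\<^sup>2)"
    by (simp add: cinner_self power_mult_distrib)
  then have "(norm (a *\<^sub>C x))\<^sup>2 = (cmod a * norm x)\<^sup>2"
    by (simp only: of_real_eq_iff)
  then show ?thesis
    by simp
qed

text \<open>The class provides a norm, so Cauchy-Schwarz is read off from the triangle inequality
  instead of preceding it.\<close>

lemma Re_cinner_le: "Re (cinner x y) \<le> norm x * norm y"
proof -
  have "(norm (x + y))\<^sup>2 \<le> (norm x + norm y)\<^sup>2"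
    by (intro power_mono norm_triangle_ineq) simp
  then show ?thesis
    by (simp add: norm_add_square power2_sum)
qed

lemma abs_Re_cinner_le: "\<bar>Re (cinner x y)\<bar> \<le> norm x * norm y"
  using Re_cinner_le[of x y] Re_cinner_le[of "- x" y] by (simp add: cinner_minus_left)

lemma norm_cinner_le: "cmod (cinner x y) \<le> norm x * norm (y :: 'a::complex_hilbert)"
proof (cases "cinner x y = 0")
  case False
  \<comment> \<open>The phase \<open>a\<close> turns the inner product into its modulus, which
    reduces the claim to real parts.\<close>
  define a where "a = cnj (cinner x y) / cmod (cinner x y)"
  have a: "cmod a = 1"
    using False by (simp add: a_def norm_divide)
  have "cinner x (a *\<^sub>C y) = cmod (cinner x y)"
    using False complex_norm_square[of "cinner x y"]
    by (simp add: a_def cinner_simps field_simps power2_eq_square)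
  then have "cmod (cinner x y) = Re (cinner x (a *\<^sub>C y))"
    by simp
  also have "\<dots> \<le> norm x * norm y"
    using Re_cinner_le[of x "a *\<^sub>C y"] a by (simp add: norm_scaleC)
  finally show ?thesis .
qed simp

lemma cinner_eq_iff_Re:
  assumes "Re z = Re w" "Re (\<i> * z) = Re (\<i> * w)"
  shows "z = w"
  using assms by (simp add: complex_eq_iff)

text \<open>Polarization: norms of sums determine the real part, and the real part at
  \<open>\<i> *\<^sub>C y\<close> determines the imaginary part.\<close>

lemma isometric_cinner:
  assumes "clinear_on S f" "csubspace S" and iso: "\<And>x. x \<in> S \<Longrightarrow> norm (f x) = norm x"
    and "x \<in> S" "y \<in> S"
  shows "cinner (f x) (f y) = cinner x y"
proof -
  have Re: "Re (cinner (f x) (f y)) = Re (cinner x y)" if "x \<in> S" "y \<in> S" for x y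
  proof -
    have "x + y \<in> S"
      using that assms(2) by (rule complex_space.subspace_add[rotated])
    from iso[OF this] have "(norm (f x + f y))\<^sup>2 = (norm (x + y))\<^sup>2"
      using that assms(1) by (simp add: clinear_on_def)
    then show ?thesis
      using iso that by (simp add: norm_add_square)
  qed
  have iy: "\<i> *\<^sub>C y \<in> S"
    using assms(2,5) by (rule complex_space.subspace_scale)
  show ?thesis
    using Re[OF assms(4,5)] Re[OF assms(4) iy] assms(1,5)
    by (intro cinner_eq_iff_Re) (simp_all add: clinear_on_def cinner_simps)
qed

section \<open>Maps that are linear on a subspace, and closures of subspaces\<close>

lemma clinear_on_add: "clinear_on S f \<Longrightarrow> x \<in> S \<Longrightarrow> y \<in> S \<Longrightarrow> f (x + y) = f x + f y"
  by (simp add: clinear_on_def)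

lemma clinear_on_scaleC: "clinear_on S f \<Longrightarrow> x \<in> S \<Longrightarrow> f (a *\<^sub>C x) = a *\<^sub>C f x"
  by (simp add: clinear_on_def)

lemma clinear_on_scaleR: "clinear_on S f \<Longrightarrow> x \<in> S \<Longrightarrow> f (r *\<^sub>R x) = r *\<^sub>R f x"
  by (simp add: scaleR_scaleC clinear_on_scaleC)

lemma clinear_on_diff:
  assumes "clinear_on S f" "csubspace S" "x \<in> S" "y \<in> S"
  shows "f (x - y) = f x - f y"
proof -
  have "(- 1) *\<^sub>C y = - y"
    using complex_space.scale_minus_left[of 1 y] by simp
  moreover have "(- 1) *\<^sub>C f y = - f y"
    using complex_space.scale_minus_left[of 1 "f y"] by simp
  moreover have "(-1) *\<^sub>C y \<in> S"
    using assms complex_space.subspace_scale by blast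
  ultimately show ?thesis
    using clinear_on_add[OF assms(1), of x "- y"] clinear_on_scaleC[OF assms(1), of y "-1"] assms
    by simp
qed

lemma clinear_on_zero: "clinear_on S f \<Longrightarrow> csubspace S \<Longrightarrow> f 0 = 0"
  using clinear_on_scaleC[of S f 0 0] complex_space.subspace_0 by auto

lemma clinear_on_sum:
  assumes "clinear_on S f" "csubspace S" "\<And>i. i \<in> A \<Longrightarrow> x i \<in> S"
  shows "f (sum x A) = (\<Sum>i\<in>A. f (x i))"
  using assms(3)
proof (induction A rule: infinite_finite_induct)
  case (insert i A)
  then have "sum x A \<in> S"
    using assms(2) by (intro complex_space.subspace_sum) auto
  then show ?case
    using insert clinear_on_add[OF assms(1)] by simp
qed (use clinear_on_zero[OF assms(1,2)] in auto)

lemma csubspace_scaleR: "csubspace S \<Longrightarrow> x \<in> S \<Longrightarrow> r *\<^sub>R x \<in> S"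
  by (simp add: scaleR_scaleC complex_space.subspace_scale)

lemma tendsto_scaleC:
  fixes f :: "'i \<Rightarrow> 'a::complex_hilbert"
  assumes "(f \<longlongrightarrow> x) F"
  shows "((\<lambda>n. c *\<^sub>C f n) \<longlongrightarrow> c *\<^sub>C x) F"
proof -
  have "bounded_linear ((*\<^sub>C) c :: 'a \<Rightarrow> 'a)"
    by (rule bounded_linear_intro[where K = "cmod c"])
      (simp_all add: scaleC_add_right scaleR_scaleC scaleC_scaleC norm_scaleC mult.commute)
  then show ?thesis
    using assms by (rule bounded_linear.tendsto)
qed

lemma csubspace_closure:
  assumes "csubspace S"
  shows "csubspace (closure S)"
proof (rule complex_space.subspaceI)
  show "0 \<in> closure S"
    using assms closure_subset complex_space.subspace_0 by blast
next
  fix x y assume "x \<in> closure S" "y \<in> closure S"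
  then obtain f g where "\<And>n. f n \<in> S" "f \<longlonglongrightarrow> x" "\<And>n. g n \<in> S" "g \<longlonglongrightarrow> y"
    unfolding closure_sequential by blast
  then show "x + y \<in> closure S"
    unfolding closure_sequential
    by (intro exI[of _ "\<lambda>n. f n + g n"] conjI tendsto_add allI complex_space.subspace_add[OF assms])
next
  fix c x assume "x \<in> closure S"
  then obtain f where f: "\<And>n. f n \<in> S" "f \<longlonglongrightarrow> x"
    unfolding closure_sequential by blast
  have "(\<lambda>n. c *\<^sub>C f n) \<longlonglongrightarrow> c *\<^sub>C x"
    by (rule tendsto_scaleC[OF f(2)])
  then show "c *\<^sub>C x \<in> closure S"
    unfolding closure_sequential
    by (intro exI[of _ "\<lambda>n. c *\<^sub>C f n"] conjI allI complex_space.subspace_scale[OF assms] f(1))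
qed

section \<open>Isometric extensions\<close>

interpretation complex_space_pair: vector_space_pair
  "scaleC :: complex \<Rightarrow> 'a \<Rightarrow> 'a::complex_hilbert" "scaleC :: complex \<Rightarrow> 'b \<Rightarrow> 'b::complex_hilbert"
  by unfold_locales

text \<open>Equal Gram matrices force every linear relation among the \<open>u i\<close> to hold
  among the \<open>v i\<close>, so that a linear map is well defined. It is built on a maximal
  independent subset of the \<open>u i\<close>; that it also sends the remaining \<open>u j\<close>
  to \<open>v j\<close> follows because \<open>f (u j) - v j\<close> has norm zero.\<close>

lemma isometric_extension_span:
  fixes u :: "'i \<Rightarrow> 'a::complex_hilbert" and v :: "'i \<Rightarrow> 'b::complex_hilbert"
  assumes gram: "\<And>i j. i \<in> I \<Longrightarrow> j \<in> I \<Longrightarrow> cinner (u i) (u j) = cinner (v i) (v j)"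
  obtains f where "\<And>x y. f (x + y) = f x + f y" "\<And>a x. f (a *\<^sub>C x) = a *\<^sub>C f x"
    "\<And>x. x \<in> cspan (u ` I) \<Longrightarrow> norm (f x) = norm x" "\<And>i. i \<in> I \<Longrightarrow> f (u i) = v i"
proof -
  obtain B where B: "B \<subseteq> u ` I" "complex_space.independent B" "u ` I \<subseteq> cspan B"
    using complex_space.maximal_independent_subset by blast
  have "\<exists>i\<in>I. u i = b" if "b \<in> B" for b
    using that B(1) by auto
  then obtain i where i: "\<And>b. b \<in> B \<Longrightarrow> i b \<in> I" "\<And>b. b \<in> B \<Longrightarrow> u (i b) = b"
    by metis
  obtain f where f: "Vector_Spaces.linear scaleC scaleC f" "\<And>b. b \<in> B \<Longrightarrow> f b = v (i b)"
    using complex_space_pair.linear_independent_extend[OF B(2), of "\<lambda>b. v (i b)"] by blast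
  interpret f: Vector_Spaces.linear scaleC scaleC f
    by (rule f)
  \<comment> \<open>Serves both span inductions below: \<open>z\<close> is \<open>v j\<close> in the
    first and \<open>f y\<close> in the second.\<close>
  have subspaceI: "csubspace {x. cinner z (f x) = cinner w x}" for z w
    by (rule complex_space.subspaceI) (simp_all add: cinner_simps f.add f.scale f.zero)
  have 1: "cinner (v j) (f y) = cinner (u j) y" if "y \<in> cspan B" "j \<in> I" for y j
    using that(1)
  proof (induction rule: complex_space.span_induct)
    case base
    show ?case by (rule subspaceI)
  next
    case (step b)
    then show ?case
      using gram[OF that(2) i(1)[OF step]] i(2)[OF step] f(2)[OF step] by simp
  qed
  have 2: "cinner (f y) (f x) = cinner y x" if "x \<in> cspan B" "y \<in> cspan B" for x y
    using that(1)
  proof (induction rule: complex_space.span_induct)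
    case base
    show ?case by (rule subspaceI)
  next
    case (step b)
    show ?case
      using 1[OF that(2) i(1)[OF step]] i(2)[OF step] f(2)[OF step] by (metis cinner_commute)
  qed
  have span: "cspan (u ` I) = cspan B"
    using B by (metis complex_space.span_eq complex_space.span_superset subset_trans)
  show ?thesis
  proof
    show "f (x + y) = f x + f y" for x y
      by (rule f.add)
    show "f (a *\<^sub>C x) = a *\<^sub>C f x" for a x
      by (rule f.scale)
    show "norm (f x) = norm x" if "x \<in> cspan (u ` I)" for x
      using 2[of x x] that by (simp add: span norm_eq_sqrt_cinner)
    show "f (u j) = v j" if "j \<in> I" for j
    proof -
      have uj: "u j \<in> cspan B"
        using that B(3) by auto
      have "cinner (f (u j)) (v j) = cinner (u j) (u j)"
        using 1[OF uj that] by (metis cinner_commute)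
      then have "cinner (f (u j) - v j) (f (u j) - v j) = 0"
        using 1[OF uj that] 2[OF uj uj] gram[OF that that] by (simp add: cinner_simps)
      then show ?thesis
        by (simp add: cinner_self)
    qed
  qed
qed

text \<open>An isometry of the span is uniformly continuous, so completeness extends it to the
  closure. The last conclusion locates the range; through it the tensor product of two observables
  maps the tensor product space into itself.\<close>

lemma isometric_extension:
  fixes u :: "'i \<Rightarrow> 'a::complex_hilbert" and v :: "'i \<Rightarrow> 'b::complex_hilbert"
  assumes gram: "\<And>i j. i \<in> I \<Longrightarrow> j \<in> I \<Longrightarrow> cinner (u i) (u j) = cinner (v i) (v j)"
  defines "T \<equiv> closure (cspan (u ` I))"
  obtains F where "clinear_on T F" "\<And>x. x \<in> T \<Longrightarrow> norm (F x) = norm x"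
    "\<And>i. i \<in> I \<Longrightarrow> F (u i) = v i" "F ` T \<subseteq> closure (cspan (v ` I))"
proof -
  obtain f where f: "\<And>x y. f (x + y) = f x + f y" "\<And>a x. f (a *\<^sub>C x) = a *\<^sub>C f x"
    "\<And>x. x \<in> cspan (u ` I) \<Longrightarrow> norm (f x) = norm x" "\<And>i. i \<in> I \<Longrightarrow> f (u i) = v i"
    by (rule isometric_extension_span[OF gram]) auto
  let ?M = "cspan (u ` I)"
  have diff: "f (x - y) = f x - f y" for x y
    by (metis f(1) add_diff_cancel diff_add_cancel)
  have "dist (f x) (f y) = dist x y" if "x \<in> ?M" "y \<in> ?M" for x y
    using f(3)[OF complex_space.span_diff[OF that]] by (simp add: dist_norm diff)
  then have "uniformly_continuous_on ?M f"
    unfolding uniformly_continuous_on_def by metis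
  then obtain F where F: "uniformly_continuous_on T F" "\<And>x. x \<in> ?M \<Longrightarrow> f x = F x"
    unfolding T_def by (rule uniformly_continuous_on_extension_on_closure) blast
  have M_T: "?M \<subseteq> T"
    by (simp add: T_def closure_subset)
  have T: "csubspace T"
    unfolding T_def by (rule csubspace_closure) simp
  have lim: "(\<lambda>n. f (s n)) \<longlonglongrightarrow> F x" if "\<And>n. s n \<in> ?M" "s \<longlonglongrightarrow> x" for s x
  proof -
    have "x \<in> T"
      using that unfolding T_def closure_sequential by blast
    then have "(\<lambda>n. F (s n)) \<longlonglongrightarrow> F x"
      using uniformly_continuous_imp_continuous[OF F(1)] that M_T
      unfolding continuous_on_sequentially comp_def by blast
    then show ?thesis
      using F(2) that by simp
  qed
  have seq: "\<exists>s. (\<forall>n. s n \<in> ?M) \<and> s \<longlonglongrightarrow> x" if "x \<in> T" for x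
    using that unfolding T_def closure_sequential .
  show ?thesis
  proof
    show "clinear_on T F"
      unfolding clinear_on_def
    proof (intro conjI ballI allI)
      fix x y assume "x \<in> T" "y \<in> T"
      with seq obtain s t where s: "\<And>n. s n \<in> ?M" "s \<longlonglongrightarrow> x" and t: "\<And>n. t n \<in> ?M" "t \<longlonglongrightarrow> y"
        by metis
      have "(\<lambda>n. f (s n + t n)) \<longlonglongrightarrow> F (x + y)"
        by (intro lim tendsto_add s t complex_space.span_add)
      moreover have "(\<lambda>n. f (s n + t n)) \<longlonglongrightarrow> F x + F y"
        unfolding f by (intro tendsto_add lim s t)
      ultimately show "F (x + y) = F x + F y"
        by (rule LIMSEQ_unique)
    next
      fix a x assume "x \<in> T"
      with seq obtain s where s: "\<And>n. s n \<in> ?M" "s \<longlonglongrightarrow> x"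
        by metis
      have "(\<lambda>n. f (a *\<^sub>C s n)) \<longlonglongrightarrow> F (a *\<^sub>C x)"
        by (intro lim tendsto_scaleC s complex_space.span_scale)
      moreover have "(\<lambda>n. f (a *\<^sub>C s n)) \<longlonglongrightarrow> a *\<^sub>C F x"
        unfolding f by (intro tendsto_scaleC lim s)
      ultimately show "F (a *\<^sub>C x) = a *\<^sub>C F x"
        by (rule LIMSEQ_unique)
    qed
    show "norm (F x) = norm x" if "x \<in> T" for x
    proof -
      from seq[OF that] obtain s where s: "\<And>n. s n \<in> ?M" "s \<longlonglongrightarrow> x"
        by metis
      have "(\<lambda>n. norm (f (s n))) \<longlonglongrightarrow> norm (F x)"
        by (intro tendsto_norm lim s)
      moreover have "(\<lambda>n. norm (f (s n))) \<longlonglongrightarrow> norm x"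
        using tendsto_norm[OF s(2)] f(3)[OF s(1)] by simp
      ultimately show ?thesis
        by (rule LIMSEQ_unique)
    qed
    show "F (u i) = v i" if "i \<in> I" for i
      using F(2)[of "u i"] f(4)[OF that] that by (simp add: complex_space.span_base)
    have fv: "f y \<in> cspan (v ` I)" if "y \<in> ?M" for y
      using that
    proof (induction rule: complex_space.span_induct)
      case base
      have "f 0 = 0"
        using f(2)[of 0 0] by simp
      then show ?case
        by (intro complex_space.subspaceI)
          (auto simp: f complex_space.span_add complex_space.span_scale complex_space.span_zero)
    next
      case (step b)
      then show ?case
        using f(4) by (auto intro: complex_space.span_base)
    qed
    show "F ` T \<subseteq> closure (cspan (v ` I))"
    proof
      fix z assume "z \<in> F ` T"
      then obtain x where x: "x \<in> T" "z = F x"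
        by blast
      from seq[OF x(1)] obtain s where s: "\<And>n. s n \<in> ?M" "s \<longlonglongrightarrow> x"
        by metis
      show "z \<in> closure (cspan (v ` I))"
        unfolding closure_sequential x(2)
        by (intro exI[of _ "\<lambda>n. f (s n)"] conjI allI lim[OF s] fv s(1))
    qed
  qed
qed

section \<open>Observables and tensor products\<close>

lemma pm1_observableD:
  assumes "pm1_observable S A" "x \<in> S"
  shows pm1_observable_mem: "A x \<in> S" and pm1_observable_involution: "A (A x) = x"
  using assms by (auto simp: pm1_observable_def)

lemma pm1_observable_clinear: "pm1_observable S A \<Longrightarrow> clinear_on S A"
  by (simp add: pm1_observable_def)

lemma pm1_observable_adjoint:
  "pm1_observable S A \<Longrightarrow> x \<in> S \<Longrightarrow> y \<in> S \<Longrightarrow> cinner (A x) y = cinner x (A y)"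
  by (simp add: pm1_observable_def)

lemma pm1_observable_cinner:
  "pm1_observable S A \<Longrightarrow> x \<in> S \<Longrightarrow> y \<in> S \<Longrightarrow> cinner (A x) (A y) = cinner x y"
  by (simp add: pm1_observable_adjoint pm1_observableD)

lemma pm1_observable_norm: "pm1_observable S A \<Longrightarrow> x \<in> S \<Longrightarrow> norm (A x) = norm x"
  by (simp add: norm_eq_sqrt_cinner pm1_observable_cinner)

lemma pm1_observable_id: "pm1_observable S id"
  by (simp add: pm1_observable_def clinear_on_def)

lemma bounded_clinear_on_bound: "bounded_clinear_on T f \<Longrightarrow> \<exists>K. \<forall>x\<in>T. norm (f x) \<le> K * norm x"
  by (simp add: bounded_clinear_on_def)

lemma bounded_clinear_onI:
  "clinear_on T f \<Longrightarrow> (\<And>x. x \<in> T \<Longrightarrow> norm (f x) \<le> K * norm x) \<Longrightarrow> bounded_clinear_on T f"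
  unfolding bounded_clinear_on_def by blast

lemma bounded_clinear_on_tendsto:
  assumes "bounded_clinear_on T f" "csubspace T" "\<And>n. s n \<in> T" "x \<in> T" "s \<longlonglongrightarrow> x"
  shows "(\<lambda>n. f (s n)) \<longlonglongrightarrow> f x"
proof -
  obtain K where lin: "clinear_on T f" and K: "\<And>x. x \<in> T \<Longrightarrow> norm (f x) \<le> K * norm x"
    using assms(1) by (auto simp: bounded_clinear_on_def)
  have "norm (f (s n) - f x) \<le> norm (s n - x) * K" for n
  proof -
    have "s n - x \<in> T"
      by (rule complex_space.subspace_diff[OF assms(2,3,4)])
    from K[OF this] show ?thesis
      using clinear_on_diff[OF lin assms(2,3,4)] by (simp add: mult.commute)
  qed
  then have "\<forall>\<^sub>F n in sequentially. norm (f (s n) - f x) \<le> norm (s n - x) * K"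
    by simp
  moreover have "(\<lambda>n. norm (s n - x) * K) \<longlonglongrightarrow> 0"
    by (rule tendsto_mult_left_zero[OF tendsto_norm_zero[OF LIM_zero[OF assms(5)]]])
  ultimately have "(\<lambda>n. f (s n) - f x) \<longlonglongrightarrow> 0"
    by (rule Lim_null_comparison)
  then show ?thesis
    by (rule LIM_zero_cancel)
qed

section \<open>Operators on a tensor product\<close>

locale tensor_product =
  fixes S1 :: "'h::complex_hilbert set" and S2 :: "'k::complex_hilbert set"
    and tens :: "'h \<Rightarrow> 'k \<Rightarrow> 't::complex_hilbert"
  assumes S1: "csubspace S1" and S2: "csubspace S2" and tensor: "hilbert_tensor S1 S2 tens"
begin

text \<open>The algebraic tensor product. Claims about \<open>T\<close> are proved here first and
  carried over by density.\<close>

definition "alg = cspan {tens x y | x y. x \<in> S1 \<and> y \<in> S2}"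

definition "T = tensor_space S1 S2 tens"

lemma T_closure: "T = closure alg"
  by (simp add: T_def alg_def tensor_space_def)

lemma csubspace_alg: "csubspace alg"
  by (simp add: alg_def)

lemma csubspace_T: "csubspace T"
  unfolding T_closure by (rule csubspace_closure[OF csubspace_alg])

lemma alg_T: "x \<in> alg \<Longrightarrow> x \<in> T"
  using closure_subset unfolding T_closure by blast

lemma tens_alg: "x \<in> S1 \<Longrightarrow> y \<in> S2 \<Longrightarrow> tens x y \<in> alg"
  unfolding alg_def by (rule complex_space.span_base) blast

lemma tens_T: "x \<in> S1 \<Longrightarrow> y \<in> S2 \<Longrightarrow> tens x y \<in> T"
  by (intro alg_T tens_alg)

lemma clinear_on_tens_left: "y \<in> S2 \<Longrightarrow> clinear_on S1 (\<lambda>x. tens x y)"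
  and clinear_on_tens_right: "x \<in> S1 \<Longrightarrow> clinear_on S2 (tens x)"
  and cinner_tens: "x \<in> S1 \<Longrightarrow> x' \<in> S1 \<Longrightarrow> y \<in> S2 \<Longrightarrow> y' \<in> S2 \<Longrightarrow>
     cinner (tens x y) (tens x' y') = cinner x x' * cinner y y'"
  using tensor by (auto simp: hilbert_tensor_def)

lemma norm_tens:
  assumes "x \<in> S1" "y \<in> S2"
  shows "norm (tens x y) = norm x * norm y"
proof -
  have "complex_of_real ((norm (tens x y))\<^sup>2) = of_real ((norm x * norm y)\<^sup>2)"
    using cinner_tens[OF assms(1,1,2,2)] by (simp add: cinner_self power_mult_distrib)
  then have "(norm (tens x y))\<^sup>2 = (norm x * norm y)\<^sup>2"
    by (simp only: of_real_eq_iff)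
  then show ?thesis
    by simp
qed

lemma T_approx: "x \<in> T \<Longrightarrow> \<exists>s. (\<forall>n. s n \<in> alg) \<and> s \<longlonglongrightarrow> x"
  unfolding T_closure closure_sequential .

text \<open>A relation rather than a function: \<open>tensor_op\<close> is a choice, so the
  calculations use any \<open>F\<close> that acts as \<open>A\<close> tensor \<open>B\<close>, and
  \<open>tensor_op_eq\<close> returns to the chosen operator. Invariance of the three spaces is
  included so that the relation is closed under composition.\<close>

definition is_tensor_op :: "('h \<Rightarrow> 'h) \<Rightarrow> ('k \<Rightarrow> 'k) \<Rightarrow> ('t \<Rightarrow> 't) \<Rightarrow> bool" where
  "is_tensor_op A B F \<longleftrightarrow> A ` S1 \<subseteq> S1 \<and> B ` S2 \<subseteq> S2 \<and> F ` T \<subseteq> T \<and> bounded_clinear_on T F \<and>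
     (\<forall>x\<in>S1. \<forall>y\<in>S2. F (tens x y) = tens (A x) (B y))"

lemma bounded_clinear_on_eq:
  assumes F: "bounded_clinear_on T F" and G: "bounded_clinear_on T G"
    and eq: "\<And>x y. x \<in> S1 \<Longrightarrow> y \<in> S2 \<Longrightarrow> F (tens x y) = G (tens x y)" and v: "v \<in> T"
  shows "F v = G v"
proof -
  have lin: "clinear_on T F" "clinear_on T G"
    using F G by (auto simp: bounded_clinear_on_def)
  have alg: "F w = G w" if "w \<in> alg" for w
  proof -
    \<comment> \<open>Membership is carried through the induction because additivity of
      \<open>F\<close> and \<open>G\<close> is known only on \<open>T\<close>.\<close>
    have "w \<in> alg \<and> F w = G w"
      using that unfolding alg_def
    proof (induction rule: complex_space.span_induct_alt)
      case base
      show ?case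
        using lin[THEN clinear_on_zero, OF csubspace_T] by (simp add: complex_space.span_zero)
    next
      case (step c x y)
      then obtain x1 y1 where x: "x = tens x1 y1" "x1 \<in> S1" "y1 \<in> S2"
        by blast
      have xT: "x \<in> T" and yT: "y \<in> T"
        using x step alg_T tens_T by (auto simp: alg_def)
      have cxT: "c *\<^sub>C x \<in> T"
        by (rule complex_space.subspace_scale[OF csubspace_T xT])
      have "F x = G x"
        using eq x by blast
      then have "F (c *\<^sub>C x + y) = G (c *\<^sub>C x + y)"
        using step lin[THEN clinear_on_add, OF cxT yT] lin[THEN clinear_on_scaleC, OF xT] by simp
      moreover have "c *\<^sub>C x \<in> alg"
        unfolding x(1) by (intro complex_space.subspace_scale[OF csubspace_alg] tens_alg x)
      ultimately show ?case
        using step complex_space.subspace_add[OF csubspace_alg] by (simp add: alg_def)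
    qed
    then show ?thesis ..
  qed
  obtain s where s: "\<And>n. s n \<in> alg" "s \<longlonglongrightarrow> v"
    using T_approx[OF v] by blast
  have "(\<lambda>n. F (s n)) \<longlonglongrightarrow> F v" "(\<lambda>n. F (s n)) \<longlonglongrightarrow> G v"
    using bounded_clinear_on_tendsto[OF F csubspace_T alg_T[OF s(1)] v s(2)]
      bounded_clinear_on_tendsto[OF G csubspace_T alg_T[OF s(1)] v s(2)] alg[OF s(1)]
    by simp_all
  then show ?thesis
    by (rule LIMSEQ_unique)
qed

lemma is_tensor_op_unique:
  "is_tensor_op A B F \<Longrightarrow> is_tensor_op A B G \<Longrightarrow> v \<in> T \<Longrightarrow> F v = G v"
  by (rule bounded_clinear_on_eq) (auto simp: is_tensor_op_def)

text \<open>\<open>F\<close> witnesses that the choice has a solution, and uniqueness by density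
  makes it immaterial which solution is chosen.\<close>

lemma tensor_op_eq:
  assumes "is_tensor_op A B F" "v \<in> T"
  shows "tensor_op S1 S2 tens A B v = F v"
proof -
  let ?P = "\<lambda>C. bounded_clinear_on T C \<and> (\<forall>x\<in>S1. \<forall>y\<in>S2. C (tens x y) = tens (A x) (B y))"
  have "?P F"
    using assms by (simp add: is_tensor_op_def)
  then have "?P (SOME C. ?P C)"
    by (rule someI[of ?P])
  then have "?P (tensor_op S1 S2 tens A B)"
    by (simp add: tensor_op_def T_def)
  then show ?thesis
    by (rule_tac bounded_clinear_on_eq) (use assms in \<open>auto simp: is_tensor_op_def\<close>)
qed

lemma is_tensor_opD:
  assumes "is_tensor_op A B F"
  shows "x \<in> S1 \<Longrightarrow> A x \<in> S1" "y \<in> S2 \<Longrightarrow> B y \<in> S2" "v \<in> T \<Longrightarrow> F v \<in> T"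
    "bounded_clinear_on T F" "clinear_on T F"
    "x \<in> S1 \<Longrightarrow> y \<in> S2 \<Longrightarrow> F (tens x y) = tens (A x) (B y)"
  using assms by (auto simp: is_tensor_op_def bounded_clinear_on_def)

lemma is_tensor_opI:
  assumes "\<And>x. x \<in> S1 \<Longrightarrow> A x \<in> S1" "\<And>y. y \<in> S2 \<Longrightarrow> B y \<in> S2" "\<And>v. v \<in> T \<Longrightarrow> F v \<in> T"
    "bounded_clinear_on T F" "\<And>x y. x \<in> S1 \<Longrightarrow> y \<in> S2 \<Longrightarrow> F (tens x y) = tens (A x) (B y)"
  shows "is_tensor_op A B F"
  using assms by (simp add: is_tensor_op_def image_subset_iff)

lemma is_tensor_op_id: "is_tensor_op id id id"
  by (auto simp: is_tensor_op_def bounded_clinear_on_def clinear_on_def intro: exI[of _ 1])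

lemma is_tensor_op_comp:
  assumes F: "is_tensor_op A B F" and G: "is_tensor_op A' B' G"
  shows "is_tensor_op (\<lambda>x. A (A' x)) (\<lambda>x. B (B' x)) (\<lambda>x. F (G x))"
proof -
  obtain K L where K: "\<And>v. v \<in> T \<Longrightarrow> norm (F v) \<le> K * norm v"
    and L: "\<And>v. v \<in> T \<Longrightarrow> norm (G v) \<le> L * norm v"
    using bounded_clinear_on_bound[OF is_tensor_opD(4)[OF F]]
      bounded_clinear_on_bound[OF is_tensor_opD(4)[OF G]] by blast
  \<comment> \<open>The bounding constants are arbitrary reals, possibly negative if
    \<open>T\<close> is trivial; hence the absolute value.\<close>
  have "norm (F (G v)) \<le> (\<bar>K\<bar> * L) * norm v" if "v \<in> T" for v
  proof -
    have "norm (F (G v)) \<le> K * norm (G v)"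
      using K is_tensor_opD(3)[OF G that] .
    also have "\<dots> \<le> \<bar>K\<bar> * norm (G v)"
      by (simp add: mult_right_mono)
    also have "\<dots> \<le> \<bar>K\<bar> * (L * norm v)"
      using L[OF that] by (simp add: mult_left_mono)
    finally show ?thesis
      by (simp add: mult.assoc)
  qed
  moreover have "clinear_on T (\<lambda>x. F (G x))"
    using is_tensor_opD(5)[OF F] is_tensor_opD(3,5)[OF G] by (simp add: clinear_on_def)
  ultimately show ?thesis
    by (intro is_tensor_opI bounded_clinear_onI) (simp_all add: is_tensor_opD[OF F] is_tensor_opD[OF G])
qed

lemma is_tensor_op_scaleR_left:
  assumes F: "is_tensor_op A B F"
  shows "is_tensor_op (\<lambda>x. r *\<^sub>R A x) B (\<lambda>x. r *\<^sub>R F x)"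
proof -
  obtain K where K: "\<And>v. v \<in> T \<Longrightarrow> norm (F v) \<le> K * norm v"
    using bounded_clinear_on_bound[OF is_tensor_opD(4)[OF F]] by blast
  have "norm (r *\<^sub>R F v) \<le> (\<bar>r\<bar> * K) * norm v" if "v \<in> T" for v
    using mult_left_mono[OF K[OF that], of "\<bar>r\<bar>"] by (simp add: mult.assoc)
  moreover have "clinear_on T (\<lambda>x. r *\<^sub>R F x)"
    using is_tensor_opD(5)[OF F]
    by (simp add: clinear_on_def scaleR_scaleC scaleC_add_right scaleC_scaleC mult.commute)
  ultimately show ?thesis
    by (intro is_tensor_opI bounded_clinear_onI) (simp_all add: is_tensor_opD[OF F]
        csubspace_scaleR[OF csubspace_T] csubspace_scaleR[OF S1]
        clinear_on_scaleR[OF clinear_on_tens_left])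
qed

lemma is_tensor_op_scaleR_right:
  assumes F: "is_tensor_op A B F"
  shows "is_tensor_op A (\<lambda>x. r *\<^sub>R B x) (\<lambda>x. r *\<^sub>R F x)"
proof -
  have "bounded_clinear_on T (\<lambda>x. r *\<^sub>R F x)"
    using is_tensor_op_scaleR_left[OF F] by (rule is_tensor_opD)
  then show ?thesis
    by (intro is_tensor_opI) (simp_all add: is_tensor_opD[OF F]
        csubspace_scaleR[OF csubspace_T] csubspace_scaleR[OF S2]
        clinear_on_scaleR[OF clinear_on_tens_right])
qed

lemma bounded_clinear_on_add:
  assumes F: "bounded_clinear_on T F" and G: "bounded_clinear_on T G"
  shows "bounded_clinear_on T (\<lambda>x. F x + G x)"
proof -
  obtain K L where K: "\<And>v. v \<in> T \<Longrightarrow> norm (F v) \<le> K * norm v"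
    and L: "\<And>v. v \<in> T \<Longrightarrow> norm (G v) \<le> L * norm v"
    using bounded_clinear_on_bound[OF F] bounded_clinear_on_bound[OF G] by blast
  have "norm (F v + G v) \<le> (K + L) * norm v" if "v \<in> T" for v
    using norm_triangle_ineq[of "F v" "G v"] K[OF that] L[OF that] by (simp add: distrib_right)
  moreover have "clinear_on T (\<lambda>x. F x + G x)"
    using F G by (simp add: bounded_clinear_on_def clinear_on_def scaleC_add_right)
  ultimately show ?thesis
    by (intro bounded_clinear_onI) simp_all
qed

lemma is_tensor_op_add_left:
  assumes F: "is_tensor_op A B F" and G: "is_tensor_op A' B G"
  shows "is_tensor_op (\<lambda>x. A x + A' x) B (\<lambda>x. F x + G x)"
  by (intro is_tensor_opI bounded_clinear_on_add) (simp_all add: is_tensor_opD[OF F]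
      is_tensor_opD[OF G] complex_space.subspace_add[OF csubspace_T]
      complex_space.subspace_add[OF S1] clinear_on_add[OF clinear_on_tens_left])

lemma is_tensor_op_add_right:
  assumes F: "is_tensor_op A B F" and G: "is_tensor_op A B' G"
  shows "is_tensor_op A (\<lambda>x. B x + B' x) (\<lambda>x. F x + G x)"
  by (intro is_tensor_opI bounded_clinear_on_add) (simp_all add: is_tensor_opD[OF F]
      is_tensor_opD[OF G] complex_space.subspace_add[OF csubspace_T]
      complex_space.subspace_add[OF S2] clinear_on_add[OF clinear_on_tens_right])

lemma is_tensor_op_left_spectral_proj:
  assumes "is_tensor_op A id F"
  shows "is_tensor_op (spectral_proj a A) id (spectral_proj a F)"
  using is_tensor_op_scaleR_left[OF is_tensor_op_add_left[OF is_tensor_op_id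
        is_tensor_op_scaleR_left[OF assms, of a]], of "1/2"]
  by (simp add: spectral_proj_def[abs_def])

lemma is_tensor_op_spectral_proj:
  assumes A: "is_tensor_op A id F" and B: "is_tensor_op id B G"
  shows "is_tensor_op (spectral_proj a A) (spectral_proj b B)
    (\<lambda>v. spectral_proj a F (spectral_proj b G v))"
proof -
  have "is_tensor_op id (spectral_proj b B) (spectral_proj b G)"
    using is_tensor_op_scaleR_right[OF is_tensor_op_add_right[OF is_tensor_op_id
          is_tensor_op_scaleR_right[OF B, of b]], of "1/2"]
    by (simp add: spectral_proj_def[abs_def])
  from is_tensor_op_comp[OF is_tensor_op_left_spectral_proj[OF A] this] show ?thesis
    by simp
qed

text \<open>Self-adjoint involutions preserve inner products, so the vectors
  \<open>tens (A x) (B y)\<close> have the same Gram matrix as the \<open>tens x y\<close>. This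
  yields the operator on all of \<open>T\<close> without estimating norms of sums of product
  vectors. Being isometric and its own inverse, it is self-adjoint.\<close>

lemma pm1_observable_tensor:
  assumes A: "pm1_observable S1 A" and B: "pm1_observable S2 B"
  obtains F where "pm1_observable T F" "is_tensor_op A B F"
proof -
  let ?u = "\<lambda>(x, y). tens x y" and ?v = "\<lambda>(x, y). tens (A x) (B y)"
  have span: "closure (cspan (?u ` (S1 \<times> S2))) = T"
    unfolding T_closure alg_def by (intro arg_cong[of _ _ closure] arg_cong[of _ _ cspan]) auto
  have sub: "?v ` (S1 \<times> S2) \<subseteq> ?u ` (S1 \<times> S2)"
    using pm1_observable_mem[OF A] pm1_observable_mem[OF B] by fastforce
  have gram: "cinner (?u i) (?u j) = cinner (?v i) (?v j)"
    if "i \<in> S1 \<times> S2" "j \<in> S1 \<times> S2" for i j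
    using that A B by (auto simp: cinner_tens pm1_observable_cinner pm1_observable_mem)
  obtain F where F: "clinear_on T F" "\<And>x. x \<in> T \<Longrightarrow> norm (F x) = norm x"
    "\<And>i. i \<in> S1 \<times> S2 \<Longrightarrow> F (?u i) = ?v i" "F ` T \<subseteq> closure (cspan (?v ` (S1 \<times> S2)))"
    by (rule isometric_extension[of "S1 \<times> S2" ?u ?v, OF gram]) (auto simp: span)
  have "closure (cspan (?v ` (S1 \<times> S2))) \<subseteq> T"
    unfolding span[symmetric] by (intro closure_mono complex_space.span_mono sub)
  then have FT: "F ` T \<subseteq> T"
    using F(4) by blast
  have bdd: "bounded_clinear_on T F"
    unfolding bounded_clinear_on_def using F(1,2) by (metis mult_1 order_refl)
  have op: "is_tensor_op A B F"
    unfolding is_tensor_op_def using F(3) FT bdd pm1_observable_mem[OF A] pm1_observable_mem[OF B]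
    by auto
  have inv: "F (F v) = v" if "v \<in> T" for v
  proof (rule is_tensor_op_unique[OF _ _ that])
    show "is_tensor_op (\<lambda>x. A (A x)) (\<lambda>x. B (B x)) (\<lambda>x. F (F x))"
      by (rule is_tensor_op_comp[OF op op])
    show "is_tensor_op (\<lambda>x. A (A x)) (\<lambda>x. B (B x)) (\<lambda>x. x)"
      using is_tensor_op_id pm1_observable_involution[OF A] pm1_observable_involution[OF B]
      by (simp add: is_tensor_op_def id_def)
  qed
  have "cinner (F v) w = cinner v (F w)" if "v \<in> T" "w \<in> T" for v w
    using isometric_cinner[OF F(1) csubspace_T F(2) that(1), of "F w"] inv[OF that(2)] FT that
    by auto
  then have "pm1_observable T F"
    using F(1) FT inv by (simp add: pm1_observable_def)
  then show ?thesis
    using op that by blast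
qed

text \<open>Gram-Schmidt on the second factors: the components of a new \<open>y0\<close> along the
  old \<open>y i\<close> are absorbed into the first factors \<open>x i\<close>, and only the
  orthogonal remainder is appended. The vectors are not normalised and may be zero.\<close>

lemma orthogonal_decomposition:
  assumes "v \<in> alg"
  shows "\<exists>n x y. (\<forall>i<n. x i \<in> S1) \<and> (\<forall>i<n. y i \<in> S2) \<and>
    (\<forall>i<n. \<forall>j<n. i \<noteq> j \<longrightarrow> cinner (y i) (y j) = 0) \<and> v = (\<Sum>i<n::nat. tens (x i) (y i))"
  using assms unfolding alg_def
proof (induction rule: complex_space.span_induct_alt)
  case base
  show ?case
    by (intro exI[of _ 0]) simp
next
  case (step c t v)
  then obtain x0' y0 where t: "t = tens x0' y0" "x0' \<in> S1" and y0: "y0 \<in> S2"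
    by blast
  define x0 where "x0 = c *\<^sub>C x0'"
  have x0: "x0 \<in> S1" and ct: "c *\<^sub>C t = tens x0 y0"
    using t y0 clinear_on_scaleC[OF clinear_on_tens_left] complex_space.subspace_scale[OF S1]
    by (simp_all add: x0_def)
  obtain n x y where x: "\<And>i. i < n \<Longrightarrow> x i \<in> S1" and y: "\<And>i. i < n \<Longrightarrow> y i \<in> S2"
    and orth: "\<And>i j. i < n \<Longrightarrow> j < n \<Longrightarrow> i \<noteq> j \<Longrightarrow> cinner (y i) (y j) = 0"
    and v: "v = (\<Sum>i<n::nat. tens (x i) (y i))"
    using step by blast
  \<comment> \<open>If \<open>y i = 0\<close>, division by zero gives the coefficient 0, which is
    the right one, so zero vectors may stay in the list.\<close>
  define a where "a i = cinner (y i) y0 / cinner (y i) (y i)" for i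
  define yp where "yp = y0 - (\<Sum>i<n. a i *\<^sub>C y i)"
  have ay: "a i *\<^sub>C y i \<in> S2" if "i < n" for i
    using y[OF that] by (rule complex_space.subspace_scale[OF S2])
  have say: "(\<Sum>i<n. a i *\<^sub>C y i) \<in> S2"
    using ay by (intro complex_space.subspace_sum[OF S2]) auto
  have yp: "yp \<in> S2"
    unfolding yp_def using y0 say by (rule complex_space.subspace_diff[OF S2])
  have yp_orth: "cinner (y j) yp = 0" if "j < n" for j
  proof -
    have "(\<Sum>i<n. a i * cinner (y j) (y i)) = (\<Sum>i<n. if i = j then a j * cinner (y j) (y j) else 0)"
      using orth that by (intro sum.cong) auto
    also have "\<dots> = cinner (y j) y0"
      using that by (cases "y j = 0") (auto simp: a_def cinner_self)
    finally show ?thesis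
      by (simp add: yp_def cinner_simps cinner_sum_right)
  qed
  have yp_orth': "cinner yp (y j) = 0" if "j < n" for j
    using yp_orth[OF that] by (metis cinner_commute complex_cnj_zero)
  let ?x = "\<lambda>i. if i < n then x i + a i *\<^sub>C x0 else x0" and ?y = "\<lambda>i. if i < n then y i else yp"
  have ax0: "a i *\<^sub>C x0 \<in> S1" for i
    using x0 by (rule complex_space.subspace_scale[OF S1])
  have "(\<Sum>i<Suc n. tens (?x i) (?y i)) = (\<Sum>i<n. tens (x i + a i *\<^sub>C x0) (y i)) + tens x0 yp"
    by (simp add: lessThan_Suc)
  also have "(\<Sum>i<n. tens (x i + a i *\<^sub>C x0) (y i)) = v + (\<Sum>i<n. tens x0 (a i *\<^sub>C y i))"
    unfolding v sum.distrib[symmetric]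
  proof (rule sum.cong)
    fix i assume "i \<in> {..<n}"
    then have i: "i < n" by simp
    show "tens (x i + a i *\<^sub>C x0) (y i) = tens (x i) (y i) + tens x0 (a i *\<^sub>C y i)"
      using clinear_on_add[OF clinear_on_tens_left[OF y[OF i]] x[OF i] ax0]
        clinear_on_scaleC[OF clinear_on_tens_left[OF y[OF i]] x0]
        clinear_on_scaleC[OF clinear_on_tens_right[OF x0] y[OF i]] by simp
  qed simp
  also have "(\<Sum>i<n. tens x0 (a i *\<^sub>C y i)) = tens x0 (\<Sum>i<n. a i *\<^sub>C y i)"
    using ay by (intro clinear_on_sum[symmetric, OF clinear_on_tens_right S2] x0) auto
  also have "tens x0 yp = tens x0 y0 - tens x0 (\<Sum>i<n. a i *\<^sub>C y i)"
    unfolding yp_def using say y0 x0 by (intro clinear_on_diff[OF clinear_on_tens_right S2])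
  finally have "(\<Sum>i<Suc n. tens (?x i) (?y i)) = c *\<^sub>C t + v"
    by (simp add: ct)
  then show ?case
    using x y x0 yp orth yp_orth yp_orth' ax0 complex_space.subspace_add[OF S1]
    by (intro exI[of _ "Suc n"] exI[of _ ?x] exI[of _ ?y]) (auto simp: less_Suc_eq)
qed

lemma norm_sum_orthogonal:
  assumes "finite A" "\<And>i j. i \<in> A \<Longrightarrow> j \<in> A \<Longrightarrow> i \<noteq> j \<Longrightarrow> cinner (f i) (f j) = 0"
  shows "(norm (sum f A))\<^sup>2 = (\<Sum>i\<in>A. (norm (f i))\<^sup>2)"
  using assms
proof (induction A rule: finite_induct)
  case (insert i A)
  then have "cinner (f i) (sum f A) = 0"
    by (auto simp: cinner_sum_right intro!: sum.neutral)
  then show ?case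
    using insert by (simp add: norm_add_square)
qed simp

text \<open>
  On an algebraic tensor whose second factors are orthogonal, both sides decouple into the
  inequality for the first factors; the general case follows by density.
\<close>

lemma tensor_norm_inequality:
  assumes V: "is_tensor_op V id V'" and W: "\<And>k. k \<in> K \<Longrightarrow> is_tensor_op (W k) id (W' k)"
    and le: "\<And>x. x \<in> S1 \<Longrightarrow> c * (norm (V x))\<^sup>2 \<le> (\<Sum>k\<in>K. (norm (W k x))\<^sup>2)"
    and v: "v \<in> T"
  shows "c * (norm (V' v))\<^sup>2 \<le> (\<Sum>k\<in>K. (norm (W' k v))\<^sup>2)"
proof -
  have alg: "c * (norm (V' v))\<^sup>2 \<le> (\<Sum>k\<in>K. (norm (W' k v))\<^sup>2)" if v: "v \<in> alg" for v
  proof -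
    obtain n x y where x: "\<And>i. i < n \<Longrightarrow> x i \<in> S1" and y: "\<And>i. i < n \<Longrightarrow> y i \<in> S2"
      and orth: "\<And>i j. i < n \<Longrightarrow> j < n \<Longrightarrow> i \<noteq> j \<Longrightarrow> cinner (y i) (y j) = 0"
      and v: "v = (\<Sum>i<n::nat. tens (x i) (y i))"
      using orthogonal_decomposition[OF v] by blast
    have *: "(norm (F v))\<^sup>2 = (\<Sum>i<n. (norm (A (x i)))\<^sup>2 * (norm (y i))\<^sup>2)"
      if "is_tensor_op A id F" for A F
    proof -
      have "F v = (\<Sum>i<n. F (tens (x i) (y i)))"
        unfolding v using x y
        by (intro clinear_on_sum[OF is_tensor_opD(5)[OF that] csubspace_T] tens_T) auto
      also have "\<dots> = (\<Sum>i<n. tens (A (x i)) (y i))"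
        using x y is_tensor_opD(6)[OF that] by simp
      also have "(norm \<dots>)\<^sup>2 = (\<Sum>i<n. (norm (tens (A (x i)) (y i)))\<^sup>2)"
        using x y orth is_tensor_opD(1)[OF that]
        by (intro norm_sum_orthogonal) (auto simp: cinner_tens)
      finally show ?thesis
        using x y is_tensor_opD(1)[OF that] by (simp add: norm_tens power_mult_distrib)
    qed
    have "c * (norm (V' v))\<^sup>2 = (\<Sum>i<n. (c * (norm (V (x i)))\<^sup>2) * (norm (y i))\<^sup>2)"
      by (simp add: *[OF V] sum_distrib_left mult.assoc)
    also have "\<dots> \<le> (\<Sum>i<n. (\<Sum>k\<in>K. (norm (W k (x i)))\<^sup>2) * (norm (y i))\<^sup>2)"
      using x by (intro sum_mono mult_right_mono le) auto
    also have "\<dots> = (\<Sum>k\<in>K. \<Sum>i<n. (norm (W k (x i)))\<^sup>2 * (norm (y i))\<^sup>2)"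
      unfolding sum_distrib_right by (rule sum.swap)
    also have "\<dots> = (\<Sum>k\<in>K. (norm (W' k v))\<^sup>2)"
      by (intro sum.cong refl *[OF W, symmetric])
    finally show ?thesis .
  qed
  obtain s where s: "\<And>n. s n \<in> alg" "s \<longlonglongrightarrow> v"
    using T_approx[OF v] by blast
  note lim = bounded_clinear_on_tendsto[OF _ csubspace_T alg_T[OF s(1)] v s(2)]
  have "(\<lambda>n. c * (norm (V' (s n)))\<^sup>2) \<longlonglongrightarrow> c * (norm (V' v))\<^sup>2"
    by (intro tendsto_intros lim is_tensor_opD(4)[OF V])
  moreover have "(\<lambda>n. \<Sum>k\<in>K. (norm (W' k (s n)))\<^sup>2) \<longlonglongrightarrow> (\<Sum>k\<in>K. (norm (W' k v))\<^sup>2)"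
    by (intro tendsto_intros lim is_tensor_opD(4)[OF W])
  ultimately show ?thesis
    using alg[OF s(1)] by (intro LIMSEQ_le) auto
qed

end

section \<open>Independent outcomes\<close>

lemma expectation_pmf_mono:
  fixes f g :: "'a \<Rightarrow> real"
  assumes "finite (set_pmf M)" "\<And>x. x \<in> set_pmf M \<Longrightarrow> f x \<le> g x"
  shows "measure_pmf.expectation M f \<le> measure_pmf.expectation M g"
  using assms by (intro integral_mono_AE integrable_measure_pmf_finite) (auto simp: AE_measure_pmf_iff)

text \<open>Markov's inequality for a function dominating an indicator. It is applied to a square,
  for Chebyshev's inequality, and to a product over the copies, for the conditions that allow no
  error.\<close>

lemma prob_le_expectation:
  assumes "finite (set_pmf M)" "\<And>x. x \<in> set_pmf M \<Longrightarrow> x \<in> E \<Longrightarrow> 1 \<le> f x"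
    "\<And>x. x \<in> set_pmf M \<Longrightarrow> 0 \<le> f x"
  shows "measure_pmf.prob M E \<le> measure_pmf.expectation M f"
proof -
  have "measure_pmf.prob M E = measure_pmf.expectation M (indicator E)"
    by simp
  also have "\<dots> \<le> measure_pmf.expectation M f"
    using assms by (intro expectation_pmf_mono) (auto simp: indicator_def)
  finally show ?thesis .
qed

lemma finite_set_Pi_pmf:
  "finite A \<Longrightarrow> (\<And>i. i \<in> A \<Longrightarrow> finite (set_pmf (p i))) \<Longrightarrow> finite (set_pmf (Pi_pmf A d p))"
  by (simp add: set_Pi_pmf finite_PiE_dflt)

text \<open>Additivity of the variance. Splitting off one coordinate leaves a cross term that
  factors by independence, and the factor of the new coordinate has mean zero.\<close>

lemma expectation_sum_square_Pi_pmf: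
  fixes h :: "'i \<Rightarrow> 'b \<Rightarrow> real"
  assumes "finite A" and fin: "\<And>i. i \<in> A \<Longrightarrow> finite (set_pmf (p i))"
    and mean: "\<And>i. i \<in> A \<Longrightarrow> measure_pmf.expectation (p i) (h i) = 0"
  shows "measure_pmf.expectation (Pi_pmf A d p) (\<lambda>x. (\<Sum>i\<in>A. h i (x i))\<^sup>2) =
    (\<Sum>i\<in>A. measure_pmf.expectation (p i) (\<lambda>y. (h i y)\<^sup>2))"
  using assms
proof (induction A rule: finite_induct)
  case (insert i A)
  let ?Q = "Pi_pmf A d p"
  define s where "s x = (\<Sum>j\<in>A. h j (x j))" for x
  have finQ: "finite (set_pmf ?Q)"
    using insert by (intro finite_set_Pi_pmf) auto
  note int = integrable_measure_pmf_finite[OF finQ]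
  have fini: "finite (set_pmf (p i))"
    using insert by simp
  note inti = integrable_measure_pmf_finite[OF fini]
  have s_upd: "(\<Sum>j\<in>insert i A. h j ((x(i := y)) j)) = h i y + s x" for x y
  proof -
    have "(\<Sum>j\<in>A. h j ((x(i := y)) j)) = s x"
      unfolding s_def using insert by (intro sum.cong) auto
    then show ?thesis
      using insert by simp
  qed
  let ?F = "\<lambda>x. (\<Sum>j\<in>insert i A. h j (x j))\<^sup>2"
  have inner: "measure_pmf.expectation (do {f \<leftarrow> ?Q; return_pmf (f(i := y))}) ?F =
      (h i y)\<^sup>2 + 2 * h i y * measure_pmf.expectation ?Q s + measure_pmf.expectation ?Q (\<lambda>x. (s x)\<^sup>2)" for y
  proof -
    have "measure_pmf.expectation (do {f \<leftarrow> ?Q; return_pmf (f(i := y))}) ?F =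
        measure_pmf.expectation ?Q (\<lambda>x. (h i y + s x)\<^sup>2)"
      by (simp add: map_pmf_def[symmetric] s_upd del: fun_upd_apply)
    also have "\<dots> = measure_pmf.expectation ?Q (\<lambda>x. (h i y)\<^sup>2 + 2 * h i y * s x + (s x)\<^sup>2)"
      by (simp add: power2_sum algebra_simps)
    finally show ?thesis
      by (simp add: int)
  qed
  have "measure_pmf.expectation (Pi_pmf (insert i A) d p) ?F =
      (\<Sum>y\<in>set_pmf (p i). pmf (p i) y *\<^sub>R
        measure_pmf.expectation (do {f \<leftarrow> ?Q; return_pmf (f(i := y))}) ?F)"
    unfolding Pi_pmf_insert'[OF insert(1,2)]
    using finQ fini by (intro pmf_expectation_bind) (auto simp: map_pmf_def[symmetric])
  also have "\<dots> = measure_pmf.expectation (p i) (\<lambda>y. (h i y)\<^sup>2 +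
      2 * h i y * measure_pmf.expectation ?Q s + measure_pmf.expectation ?Q (\<lambda>x. (s x)\<^sup>2))"
    unfolding inner by (rule integral_measure_pmf[symmetric]) (use fini in auto)
  also have "\<dots> = measure_pmf.expectation (p i) (\<lambda>y. (h i y)\<^sup>2) + measure_pmf.expectation ?Q (\<lambda>x. (s x)\<^sup>2)"
    using insert.prems(2)[of i] by (simp add: inti)
  also have "measure_pmf.expectation ?Q (\<lambda>x. (s x)\<^sup>2) =
      (\<Sum>i\<in>A. measure_pmf.expectation (p i) (\<lambda>y. (h i y)\<^sup>2))"
    unfolding s_def using insert by (intro insert.IH) auto
  finally show ?case
    using insert by simp
qed simp

definition pm1_pmf :: "(real \<times> real) pmf \<Rightarrow> bool" where
  "pm1_pmf p \<longleftrightarrow> set_pmf p \<subseteq> {1, -1} \<times> {1, -1}"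

definition correlation :: "(real \<times> real) pmf \<Rightarrow> real" where
  "correlation p = measure_pmf.expectation p (\<lambda>z. fst z * snd z)"

lemma pm1_pmfD:
  assumes "pm1_pmf p" "z \<in> set_pmf p"
  shows "fst z * snd z = 1 \<or> fst z * snd z = -1"
  using assms by (force simp: pm1_pmf_def)

lemma pm1_pmf_finite: "pm1_pmf p \<Longrightarrow> finite (set_pmf p)"
  unfolding pm1_pmf_def by (rule finite_subset) auto

text \<open>The product of the outcomes squares to 1, so its variance is 1 minus the square of its
  mean.\<close>

lemma correlation_variance:
  assumes "pm1_pmf p"
  shows "measure_pmf.expectation p (\<lambda>z. (fst z * snd z - correlation p)\<^sup>2) \<le> 1"
proof -
  note int = integrable_measure_pmf_finite[OF pm1_pmf_finite[OF assms]]
  let ?r = "correlation p"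
  have "measure_pmf.expectation p (\<lambda>z. (fst z * snd z - ?r)\<^sup>2) \<le>
      measure_pmf.expectation p (\<lambda>z. (1 + ?r\<^sup>2) - 2 * ?r * (fst z * snd z))"
  proof (rule expectation_pmf_mono)
    show "finite (set_pmf p)"
      by (rule pm1_pmf_finite[OF assms])
    fix z assume "z \<in> set_pmf p"
    then have "(fst z * snd z)\<^sup>2 = 1"
      using pm1_pmfD[OF assms] by fastforce
    then show "(fst z * snd z - ?r)\<^sup>2 \<le> (1 + ?r\<^sup>2) - 2 * ?r * (fst z * snd z)"
      by (simp add: power2_diff)
  qed
  also have "\<dots> = 1 + ?r\<^sup>2 - 2 * ?r * ?r"
    by (simp add: int correlation_def[symmetric])
  also have "\<dots> \<le> 1"
    by (simp add: power2_eq_square)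
  finally show ?thesis .
qed

section \<open>The statistics of the test\<close>

lemma divisionsD:
  assumes "g \<in> divisions m" "k \<in> {1..8}"
  shows "card {i. i < 8 * m \<and> g i = k} = m"
  using assms by (simp add: divisions_def Collect_conj_eq lessThan_def)

lemma divisions_range: "g \<in> divisions m \<Longrightarrow> i < 8 * m \<Longrightarrow> g i \<in> {1..8}"
  by (auto simp: divisions_def)

lemma finite_divisions: "finite (divisions m)"
proof (rule finite_subset)
  show "divisions m \<subseteq> {..<8 * m} \<rightarrow>\<^sub>E {1..8}"
    by (auto simp: divisions_def)
qed (auto intro: finite_PiE)

text \<open>Needed for \<open>pmf_of_set\<close> to be the uniform law. The witness takes
  consecutive blocks of length \<open>m\<close>, shifted by one because the groups are numbered from
  1.\<close>

lemma divisions_nonempty: "divisions m \<noteq> {}"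
proof -
  define g where "g = restrict (\<lambda>i. i div m + 1) {..<8 * m}"
  have "g i \<in> {1..8}" if "i < 8 * m" for i
  proof -
    have "i div m < 8"
      using that by (simp add: less_mult_imp_div_less)
    then show ?thesis
      using that by (simp add: g_def)
  qed
  moreover have "card {i \<in> {..<8 * m}. g i = k} = m" if k: "k \<in> {1..8}" for k
  proof (cases "m = 0")
    case False
    have "{i \<in> {..<8 * m}. g i = k} = {(k - 1) * m..<(k - 1) * m + m}"
    proof (intro set_eqI)
      fix i
      have iff: "i div m + 1 = k \<longleftrightarrow> (k - 1) * m \<le> i \<and> i < (k - 1) * m + m"
      proof -
        have "i div m + 1 = k \<longleftrightarrow> i div m = k - 1"
          using k by auto
        also have "\<dots> \<longleftrightarrow> (k - 1) * m \<le> i \<and> i < Suc (k - 1) * m"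
          using False by (metis div_nat_eqI dividend_less_times_div div_times_less_eq_dividend
              mult.commute mult_Suc_right add.commute neq0_conv)
        finally show ?thesis
          by (simp add: add.commute)
      qed
      have le: "(k - 1) * m + m \<le> 8 * m"
      proof -
        have "(k - 1) * m + m = k * m"
          using k by (cases k) auto
        then show ?thesis
          using k by simp
      qed
      have "i \<in> {i \<in> {..<8 * m}. g i = k} \<longleftrightarrow> i < 8 * m \<and> i div m + 1 = k"
        by (auto simp: g_def)
      also have "\<dots> \<longleftrightarrow> (k - 1) * m \<le> i \<and> i < (k - 1) * m + m"
        using iff le by linarith
      finally show "i \<in> {i \<in> {..<8 * m}. g i = k} \<longleftrightarrow> i \<in> {(k - 1) * m..<(k - 1) * m + m}"
        by simp
    qed
    then show ?thesis
      by simp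
  qed simp
  ultimately have "g \<in> divisions m"
    by (auto simp: divisions_def g_def)
  then show ?thesis
    by blast
qed

text \<open>Chebyshev's inequality for a fixed division. Two groups are treated at once because the
  test bounds sums and differences of two averages; the sign is \<open>s\<close>. Each of the
  \<open>2 * m\<close> copies involved contributes variance at most 1.\<close>

lemma Av_deviation_prob:
  assumes g: "g \<in> divisions m" and m: "0 < m"
    and p: "\<And>k. k \<in> {1..8} \<Longrightarrow> pm1_pmf (p k)"
    and k: "k \<in> {1..8}" and l: "l \<in> {1..8}" and kl: "k \<noteq> l" and s: "\<bar>s\<bar> = (1::real)" and t: "0 < t"
  shows "measure_pmf.prob (Pi_pmf {..<8 * m} (0, 0) (\<lambda>i. p (g i)))
    {r. t \<le> \<bar>(Av m g r k + s * Av m g r l) - (correlation (p k) + s * correlation (p l))\<bar>}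
    \<le> 2 / (m * t\<^sup>2)"
proof -
  let ?Q = "Pi_pmf {..<8 * m} (0, 0) (\<lambda>i. p (g i))"
  \<comment> \<open>Copies outside the two groups get weight 0, so the statistic is a sum over all
    copies and no marginal law of the product has to be taken.\<close>
  define h where "h i z = (if g i = k then 1 else if g i = l then s else 0) *
      (fst z * snd z - correlation (p (g i)))" for i and z :: "real \<times> real"
  have pg: "pm1_pmf (p (g i))" if "i < 8 * m" for i
    using p divisions_range[OF g that] .
  note int = integrable_measure_pmf_finite[OF pm1_pmf_finite[OF pg]]
  have finQ: "finite (set_pmf ?Q)"
    using pm1_pmf_finite[OF pg] by (intro finite_set_Pi_pmf) auto
  have mean: "measure_pmf.expectation (p (g i)) (h i) = 0" if "i < 8 * m" for i
    by (simp add: h_def[abs_def] int[OF that] correlation_def)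
  have var: "measure_pmf.expectation (p (g i)) (\<lambda>z. (h i z)\<^sup>2) \<le>
      (if g i = k then 1 else 0) + (if g i = l then 1 else 0)" if "i < 8 * m" for i
  proof -
    have "s\<^sup>2 = 1"
      using s by (metis one_power2 power2_abs)
    then show ?thesis
      using correlation_variance[OF pg[OF that]] kl by (auto simp: h_def power_mult_distrib)
  qed
  have split: "(\<Sum>i<8 * m. if g i = j then f i else 0) = (\<Sum>i | i < 8 * m \<and> g i = j. f i)"
    for j and f :: "nat \<Rightarrow> real"
    by (simp add: sum.inter_filter[symmetric] lessThan_def)
  have *: "(\<Sum>i | i < 8 * m \<and> g i = j. fst (r i) * snd (r i) - correlation (p (g i))) =
      m * (Av m g r j - correlation (p j))" if "j \<in> {1..8}" for j r
  proof -
    have "(\<Sum>i | i < 8 * m \<and> g i = j. fst (r i) * snd (r i) - correlation (p (g i))) =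
        (\<Sum>i | i < 8 * m \<and> g i = j. fst (r i) * snd (r i) - correlation (p j))"
      by (intro sum.cong) auto
    then show ?thesis
      using m divisionsD[OF g that] by (simp add: sum_subtractf Av_def right_diff_distrib)
  qed
  have sum_h: "(\<Sum>i<8 * m. h i (r i)) =
      m * ((Av m g r k + s * Av m g r l) - (correlation (p k) + s * correlation (p l)))" for r
  proof -
    have "(\<Sum>i<8 * m. h i (r i)) =
        (\<Sum>i<8 * m. (if g i = k then fst (r i) * snd (r i) - correlation (p (g i)) else 0) +
          s * (if g i = l then fst (r i) * snd (r i) - correlation (p (g i)) else 0))"
      using kl by (intro sum.cong) (auto simp: h_def)
    also have "\<dots> = m * (Av m g r k - correlation (p k)) + s * (m * (Av m g r l - correlation (p l)))"
      by (simp only: sum.distrib sum_distrib_left[symmetric] split *[OF k] *[OF l])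
    finally show ?thesis
      by (simp add: algebra_simps)
  qed
  have "measure_pmf.prob ?Q
      {r. t \<le> \<bar>(Av m g r k + s * Av m g r l) - (correlation (p k) + s * correlation (p l))\<bar>}
      \<le> measure_pmf.expectation ?Q (\<lambda>r. (\<Sum>i<8 * m. h i (r i))\<^sup>2 / (m * t)\<^sup>2)"
  proof (rule prob_le_expectation[OF finQ])
    fix r assume "r \<in> {r. t \<le> \<bar>(Av m g r k + s * Av m g r l) - (correlation (p k) + s * correlation (p l))\<bar>}"
    then have "m * t \<le> \<bar>\<Sum>i<8 * m. h i (r i)\<bar>"
      unfolding sum_h by (simp add: abs_mult mult_left_mono)
    then have "(m * t)\<^sup>2 \<le> (\<Sum>i<8 * m. h i (r i))\<^sup>2"
      using t by (metis abs_le_square_iff abs_of_nonneg less_imp_le mult_nonneg_nonneg of_nat_0_le_iff)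
    then show "1 \<le> (\<Sum>i<8 * m. h i (r i))\<^sup>2 / (m * t)\<^sup>2"
      using m t by simp
  qed simp
  also have "\<dots> = measure_pmf.expectation ?Q (\<lambda>r. (\<Sum>i<8 * m. h i (r i))\<^sup>2) / (m * t)\<^sup>2"
    by simp
  also have "measure_pmf.expectation ?Q (\<lambda>r. (\<Sum>i<8 * m. h i (r i))\<^sup>2) =
      (\<Sum>i<8 * m. measure_pmf.expectation (p (g i)) (\<lambda>z. (h i z)\<^sup>2))"
    using pm1_pmf_finite[OF pg] mean by (intro expectation_sum_square_Pi_pmf) auto
  also have "\<dots> / (m * t)\<^sup>2 \<le>
      (\<Sum>i<8 * m. (if g i = k then 1 else 0) + (if g i = l then 1 else 0)) / (m * t)\<^sup>2"
    by (intro divide_right_mono sum_mono var) auto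
  also have "(\<Sum>i<8 * m. (if g i = k then 1 else 0) + (if g i = l then 1 else 0)) = 2 * real m"
    unfolding sum.distrib split using divisionsD[OF g k] divisionsD[OF g l] by simp
  also have "2 * real m / (m * t)\<^sup>2 = 2 / (m * t\<^sup>2)"
    using m t by (simp add: power2_eq_square field_simps)
  finally show ?thesis
    by simp
qed

text \<open>The differences from 1 are non-negative and sum to zero. Exact equality in the test thus
  becomes a condition on every single copy.\<close>

lemma Av_eq_1_iff:
  assumes g: "g \<in> divisions m" and m: "0 < m" and k: "k \<in> {1..8}"
    and le: "\<And>i. i < 8 * m \<Longrightarrow> g i = k \<Longrightarrow> fst (r i) * snd (r i) \<le> 1"
  shows "Av m g r k = 1 \<longleftrightarrow> (\<forall>i<8 * m. g i = k \<longrightarrow> fst (r i) * snd (r i) = 1)"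
proof -
  let ?G = "{i. i < 8 * m \<and> g i = k}"
  have "Av m g r k = 1 \<longleftrightarrow> (\<Sum>i\<in>?G. fst (r i) * snd (r i)) = m"
    using m by (auto simp: Av_def field_simps)
  also have "\<dots> \<longleftrightarrow> (\<Sum>i\<in>?G. 1 - fst (r i) * snd (r i)) = 0"
    using divisionsD[OF g k] by (simp add: sum_subtractf) (rule eq_commute)
  also have "\<dots> \<longleftrightarrow> (\<forall>i\<in>?G. 1 - fst (r i) * snd (r i) = 0)"
    using le by (intro sum_nonneg_eq_0_iff) auto
  finally show ?thesis
    by auto
qed

text \<open>All \<open>m\<close> products must be 1, which has probability
  \<open>((1 + r) / 2) ^ m\<close> for correlation \<open>r\<close>; then
  \<open>1 + x \<le> exp x\<close>. Exceeding a fixed probability therefore bounds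
  \<open>1 - r\<close> by a multiple of 1/m.\<close>

lemma Av_eq_1_prob:
  assumes g: "g \<in> divisions m" and m: "0 < m"
    and p: "\<And>k. k \<in> {1..8} \<Longrightarrow> pm1_pmf (p k)" and k: "k \<in> {1..8}"
  shows "measure_pmf.prob (Pi_pmf {..<8 * m} (0, 0) (\<lambda>i. p (g i))) {r. Av m g r k = 1}
    \<le> exp (- (m * (1 - correlation (p k)) / 2))"
proof -
  let ?Q = "Pi_pmf {..<8 * m} (0, 0) (\<lambda>i. p (g i))"
  \<comment> \<open>On the values 1 and -1 of the product this is the indicator of success, written
    affinely so that its mean is \<open>(1 + r) / 2\<close> for correlation
    \<open>r\<close>.\<close>
  define f where "f i z = (if g i = k then (1 + fst z * snd z) / 2 else 1)" for i and z :: "real \<times> real"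
  have pg: "pm1_pmf (p (g i))" if "i < 8 * m" for i
    using p divisions_range[OF g that] .
  note int = integrable_measure_pmf_finite[OF pm1_pmf_finite[OF pg]]
  have finQ: "finite (set_pmf ?Q)"
    using pm1_pmf_finite[OF pg] by (intro finite_set_Pi_pmf) auto
  have supp: "fst (r i) * snd (r i) = 1 \<or> fst (r i) * snd (r i) = -1"
    if "r \<in> set_pmf ?Q" "i < 8 * m" for r i
  proof -
    have "r i \<in> set_pmf (p (g i))"
      using that by (auto simp: set_Pi_pmf PiE_dflt_def)
    then show ?thesis
      using pm1_pmfD[OF pg[OF that(2)]] by blast
  qed
  have f_nonneg: "0 \<le> f i z" if "i < 8 * m" "z \<in> set_pmf (p (g i))" for i z
    using pm1_pmfD[OF pg[OF that(1)] that(2)] by (auto simp: f_def)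
  have "measure_pmf.prob ?Q {r. Av m g r k = 1} \<le> measure_pmf.expectation ?Q (\<lambda>r. \<Prod>i<8 * m. f i (r i))"
  proof (rule prob_le_expectation[OF finQ])
    fix r assume r: "r \<in> set_pmf ?Q" "r \<in> {r. Av m g r k = 1}"
    have "\<forall>i<8 * m. g i = k \<longrightarrow> fst (r i) * snd (r i) = 1"
      using r supp[OF r(1)] by (subst Av_eq_1_iff[OF g m k, symmetric]) fastforce+
    then have "(\<Prod>i<8 * m. f i (r i)) = 1"
      by (intro prod.neutral) (auto simp: f_def)
    then show "1 \<le> (\<Prod>i<8 * m. f i (r i))"
      by simp
  next
    fix r assume r: "r \<in> set_pmf ?Q"
    show "0 \<le> (\<Prod>i<8 * m. f i (r i))"
      using supp[OF r] by (intro prod_nonneg) (fastforce simp: f_def)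
  qed
  also have "\<dots> = (\<Prod>i<8 * m. measure_pmf.expectation (p (g i)) (f i))"
    using int f_nonneg by (intro expectation_prod_Pi_pmf) auto
  also have "\<dots> = (\<Prod>i<8 * m. if g i = k then (1 + correlation (p k)) / 2 else 1)"
    by (intro prod.cong) (auto simp: f_def[abs_def] int correlation_def add_divide_distrib)
  also have "\<dots> = (\<Prod>i | i < 8 * m \<and> g i = k. (1 + correlation (p k)) / 2)"
    by (simp add: prod.inter_filter[symmetric] lessThan_def)
  also have "\<dots> = ((1 + correlation (p k)) / 2) ^ m"
    using divisionsD[OF g k] by simp
  also have "\<dots> \<le> exp (- ((1 - correlation (p k)) / 2)) ^ m"
  proof (rule power_mono)
    show "(1 + correlation (p k)) / 2 \<le> exp (- ((1 - correlation (p k)) / 2))"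
      using exp_ge_add_one_self[of "- ((1 - correlation (p k)) / 2)"] by (simp add: field_simps)
    have "measure_pmf.expectation (p k) (\<lambda>_. -1) \<le> correlation (p k)"
      unfolding correlation_def using pm1_pmfD[OF p[OF k]] pm1_pmf_finite[OF p[OF k]]
      by (intro expectation_pmf_mono) fastforce+
    then show "0 \<le> (1 + correlation (p k)) / 2"
      by simp
  qed
  also have "\<dots> = exp (- (m * (1 - correlation (p k)) / 2))"
    by (simp add: exp_of_nat_mult[symmetric])
  finally show ?thesis .
qed

lemma correlation_eq_1:
  assumes "pm1_pmf p" "correlation p = 1" "z \<in> set_pmf p"
  shows "fst z * snd z = 1"
proof -
  note fin = pm1_pmf_finite[OF assms(1)]
  have "measure_pmf.expectation p (\<lambda>z. 1 - fst z * snd z) = 0"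
    using assms(2) by (simp add: integrable_measure_pmf_finite[OF fin] correlation_def)
  then have "AE z in p. 1 - fst z * snd z = 0"
    using pm1_pmfD[OF assms(1)]
    by (subst (asm) integral_nonneg_eq_0_iff_AE)
      (fastforce intro!: integrable_measure_pmf_finite[OF fin] simp: AE_measure_pmf_iff)+
  then show ?thesis
    using assms(3) by (simp add: AE_measure_pmf_iff)
qed

section \<open>The probability of passing\<close>

text \<open>Conditioning on the division. With the extended non-negative integral, monotonicity
  suffices in what follows and no integrability has to be checked.\<close>

lemma pass_prob_eq:
  "emeasure (test_pmf E m) {w. passes m c w} =
    (\<integral>\<^sup>+g. emeasure (Pi_pmf {..<8 * m} (0, 0) (\<lambda>i. born_pmf E (group_obs E (g i))))
      {r. passes m c (g, r)} \<partial>pmf_of_set (divisions m))"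
  by (simp add: test_pmf_def vimage_def)

lemma pass_prob_ge:
  assumes "\<And>g. g \<in> divisions m \<Longrightarrow> x \<le> measure_pmf.prob
    (Pi_pmf {..<8 * m} (0, 0) (\<lambda>i. born_pmf E (group_obs E (g i)))) {r. passes m c (g, r)}"
  shows "x \<le> pass_prob E m c"
proof -
  have "ennreal x = (\<integral>\<^sup>+g. ennreal x \<partial>pmf_of_set (divisions m))"
    by simp
  also have "\<dots> \<le> emeasure (test_pmf E m) {w. passes m c w}"
    unfolding pass_prob_eq using assms finite_divisions divisions_nonempty
    by (intro nn_integral_mono_AE)
      (auto simp: AE_measure_pmf_iff measure_pmf.emeasure_eq_measure intro: ennreal_leI)
  finally show ?thesis
    by (simp add: pass_prob_def measure_pmf.emeasure_eq_measure)
qed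

text \<open>A mean exceeds \<open>x\<close> only if some value does, so one fixed division suffices
  for all the estimates.\<close>

lemma pass_prob_greaterD:
  assumes "x < pass_prob E m c" "0 \<le> x"
  obtains g where "g \<in> divisions m" "x < measure_pmf.prob
    (Pi_pmf {..<8 * m} (0, 0) (\<lambda>i. born_pmf E (group_obs E (g i)))) {r. passes m c (g, r)}"
proof (rule ccontr)
  assume "\<not> thesis"
  with that have le: "measure_pmf.prob (Pi_pmf {..<8 * m} (0, 0)
      (\<lambda>i. born_pmf E (group_obs E (g i)))) {r. passes m c (g, r)} \<le> x" if "g \<in> divisions m" for g
    using not_less that by blast
  have "emeasure (test_pmf E m) {w. passes m c w} \<le> (\<integral>\<^sup>+g. ennreal x \<partial>pmf_of_set (divisions m))"
    unfolding pass_prob_eq using le finite_divisions divisions_nonempty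
    by (intro nn_integral_mono_AE)
      (auto simp: AE_measure_pmf_iff measure_pmf.emeasure_eq_measure intro: ennreal_leI)
  then have "pass_prob E m c \<le> x"
    using assms(2) by (simp add: pass_prob_def measure_pmf.emeasure_eq_measure)
  then show False
    using assms(1) by simp
qed

section \<open>Passing the test in terms of the eight correlations\<close>

context
  fixes E :: "('h::complex_hilbert, 'k::complex_hilbert, 't::complex_hilbert) scenario"
    and m :: nat and r :: "nat \<Rightarrow> real"
  assumes pm1: "\<And>k. k \<in> {1..8} \<Longrightarrow> pm1_pmf (born_pmf E (group_obs E k))"
    and r: "\<And>k. k \<in> {1..8} \<Longrightarrow> correlation (born_pmf E (group_obs E k)) = r k"
    and m: "0 < m"
begin

text \<open>The first two conditions hold almost surely, as correlation 1 is extremal. Each of the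
  other three fails only inside a Chebyshev event of probability at most
  \<open>2 / c\<^sup>2\<close>, and a union bound adds these up.\<close>

lemma pass_prob_ideal:
  assumes c: "0 < c" and r1: "r 1 = 1" and r2: "r 2 = 1" and r34: "r 3 + r 4 = sqrt 2"
    and r56: "r 5 - r 6 = sqrt 2" and r78: "r 7 + r 8 = 0"
  shows "1 - 6 / c\<^sup>2 \<le> pass_prob E m c"
proof (rule pass_prob_ge)
  fix g assume g: "g \<in> divisions m"
  let ?Q = "Pi_pmf {..<8 * m} (0, 0) (\<lambda>i. born_pmf E (group_obs E (g i)))"
  let ?t = "c / sqrt m"
  have t: "0 < ?t" and mt: "m * ?t\<^sup>2 = c\<^sup>2"
    using c m by (simp_all add: power_divide)
  define bad where "bad k l s = {x. ?t \<le> \<bar>(Av m g x k + s * Av m g x l) - (r k + s * r l)\<bar>}" for k l and s :: real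
  have bad: "measure_pmf.prob ?Q (bad k l s) \<le> 2 / c\<^sup>2"
    if "k \<in> {1..8}" "l \<in> {1..8}" "k \<noteq> l" "\<bar>s\<bar> = 1" for k l s
    using Av_deviation_prob[where p = "\<lambda>k. born_pmf E (group_obs E k)", OF g m pm1 that t] r[OF that(1)] r[OF that(2)] unfolding bad_def mt by simp
  have Av1: "Av m g x k = 1" if x: "x \<in> set_pmf ?Q" and k: "k \<in> {1, 2}" for x k
  proof -
    have "fst (x i) * snd (x i) = 1" if "i < 8 * m" "g i = k" for i
    proof (rule correlation_eq_1)
      show "x i \<in> set_pmf (born_pmf E (group_obs E (g i)))"
        using x that by (auto simp: set_Pi_pmf PiE_dflt_def)
      show "pm1_pmf (born_pmf E (group_obs E (g i)))"
        using pm1 divisions_range[OF g that(1)] by blast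
      show "correlation (born_pmf E (group_obs E (g i))) = 1"
        using r[of k] k r1 r2 that by auto
    qed
    then show ?thesis
      using k by (subst Av_eq_1_iff[OF g m]) auto
  qed
  let ?B = "bad 3 4 1 \<union> (bad 5 6 (- 1) \<union> bad 7 8 1)"
  have "measure_pmf.prob ?Q ?B \<le> 2 / c\<^sup>2 + (2 / c\<^sup>2 + 2 / c\<^sup>2)"
    using bad[of 3 4 1] bad[of 5 6 "-1"] bad[of 7 8 1]
      measure_Un_le[of "bad 3 4 1" ?Q "bad 5 6 (- 1) \<union> bad 7 8 1"]
      measure_Un_le[of "bad 5 6 (- 1)" ?Q "bad 7 8 1"] by simp
  moreover have "1 - measure_pmf.prob ?Q ?B = measure_pmf.prob ?Q (- ?B)"
    using measure_pmf.prob_compl[of ?B ?Q] by (simp add: Compl_eq_Diff_UNIV)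
  moreover have "measure_pmf.prob ?Q (- ?B) \<le> measure_pmf.prob ?Q {x. passes m c (g, x)}"
  proof (rule measure_pmf.finite_measure_mono_AE)
    show "AE x in ?Q. x \<in> - ?B \<longrightarrow> x \<in> {x. passes m c (g, x)}"
      unfolding AE_measure_pmf_iff
    proof (intro ballI impI)
      fix x assume x: "x \<in> set_pmf ?Q" "x \<in> - ?B"
      show "x \<in> {x. passes m c (g, x)}"
        using Av1[OF x(1)] x(2) r34 r56 r78 by (auto simp: passes_def bad_def not_le)
    qed
  qed simp
  ultimately show "1 - 6 / c\<^sup>2 \<le> measure_pmf.prob ?Q {x. passes m c (g, x)}"
    by simp
qed

lemma pass_prob_bounds:
  assumes pass: "\<alpha> < pass_prob E m c" and \<alpha>: "0 < \<alpha>"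
  defines "t \<equiv> (c + sqrt (2 / \<alpha>)) / sqrt m"
  shows "1 - r 1 \<le> 2 * ln (1 / \<alpha>) / m" "1 - r 2 \<le> 2 * ln (1 / \<alpha>) / m"
    "sqrt 2 - t \<le> r 3 + r 4" "sqrt 2 - t \<le> r 5 - r 6" "\<bar>r 7 + r 8\<bar> \<le> t"
proof -
  obtain g where g: "g \<in> divisions m" and P: "\<alpha> < measure_pmf.prob
    (Pi_pmf {..<8 * m} (0, 0) (\<lambda>i. born_pmf E (group_obs E (g i)))) {r. passes m c (g, r)}"
    using pass_prob_greaterD[OF pass] \<alpha> by (metis less_imp_le)
  let ?Q = "Pi_pmf {..<8 * m} (0, 0) (\<lambda>i. born_pmf E (group_obs E (g i)))"
  have imp: "\<alpha> < measure_pmf.prob ?Q X" if "\<And>x. passes m c (g, x) \<Longrightarrow> x \<in> X" for X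
    using P measure_pmf.finite_measure_mono[of "{x. passes m c (g, x)}" X ?Q] that by fastforce
  have one: "1 - r k \<le> 2 * ln (1 / \<alpha>) / m" if k: "k \<in> {1, 2}" for k
  proof -
    have "\<alpha> < measure_pmf.prob ?Q {x. Av m g x k = 1}"
      using k by (intro imp) (auto simp: passes_def)
    also have "\<dots> \<le> exp (- (m * (1 - r k) / 2))"
      using Av_eq_1_prob[where p = "\<lambda>k. born_pmf E (group_obs E k)", OF g m pm1, of k] r[of k] k by auto
    finally have "ln \<alpha> < - (m * (1 - r k) / 2)"
      using \<alpha> by (metis exp_gt_zero ln_exp ln_less_cancel_iff)
    then show ?thesis
      using m \<alpha> by (simp add: ln_div field_simps)
  qed
  \<comment> \<open>With this value the Chebyshev bound for a deviation of
    \<open>\<kappa> / sqrt m\<close> is exactly \<open>\<alpha>\<close>.\<close>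
  define \<kappa> where "\<kappa> = sqrt (2 / \<alpha>)"
  have \<kappa>: "0 < \<kappa>" "\<kappa>\<^sup>2 = 2 / \<alpha>"
    using \<alpha> by (simp_all add: \<kappa>_def)
  have t_eq: "t = c / sqrt m + \<kappa> / sqrt m"
    by (simp add: t_def \<kappa>_def add_divide_distrib)
  \<comment> \<open>If every passing outcome deviated this much, passing would have probability at
    most \<open>\<alpha>\<close>. So some passing outcome has averages close to the true
    correlations, and the acceptance conditions carry over to these.\<close>
  have dev: "\<not> (\<forall>x. passes m c (g, x) \<longrightarrow>
      \<kappa> / sqrt m \<le> \<bar>(Av m g x k + s * Av m g x l) - (r k + s * r l)\<bar>)"
    if "k \<in> {1..8}" "l \<in> {1..8}" "k \<noteq> l" "\<bar>s\<bar> = 1" for k l s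
  proof
    assume "\<forall>x. passes m c (g, x) \<longrightarrow> \<kappa> / sqrt m \<le> \<bar>(Av m g x k + s * Av m g x l) - (r k + s * r l)\<bar>"
    then have "\<alpha> < measure_pmf.prob ?Q
        {x. \<kappa> / sqrt m \<le> \<bar>(Av m g x k + s * Av m g x l) - (r k + s * r l)\<bar>}"
      by (intro imp) auto
    also have "\<dots> \<le> 2 / (m * (\<kappa> / sqrt m)\<^sup>2)"
      using Av_deviation_prob[where p = "\<lambda>k. born_pmf E (group_obs E k)", OF g m pm1 that, of "\<kappa> / sqrt m"] r[OF that(1)] r[OF that(2)] \<kappa> m by simp
    also have "\<dots> = \<alpha>"
      using m \<alpha> \<kappa> by (simp add: power_divide)
    finally show False
      by simp
  qed
  show "1 - r 1 \<le> 2 * ln (1 / \<alpha>) / m" "1 - r 2 \<le> 2 * ln (1 / \<alpha>) / m"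
    by (rule one; simp)+
  show "sqrt 2 - t \<le> r 3 + r 4"
    using dev[of 3 4 1] unfolding t_eq by (force simp: passes_def)
  show "sqrt 2 - t \<le> r 5 - r 6"
    using dev[of 5 6 "-1"] unfolding t_eq by (force simp: passes_def)
  show "\<bar>r 7 + r 8\<bar> \<le> t"
    using dev[of 7 8 1] unfolding t_eq by (force simp: passes_def)
qed

end

section \<open>The Born rule\<close>

lemma spectral_proj_mem:
  "pm1_observable S A \<Longrightarrow> csubspace S \<Longrightarrow> v \<in> S \<Longrightarrow> spectral_proj a A v \<in> S"
  unfolding spectral_proj_def
  using pm1_observable_mem[of S A v] csubspace_scaleR[of S] complex_space.subspace_add[of S]
  by metis

lemma norm_spectral_proj:
  assumes "pm1_observable S A" "v \<in> S" and a: "a\<^sup>2 = 1"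
  shows "(norm (spectral_proj a A v))\<^sup>2 = ((norm v)\<^sup>2 + a * Re (cinner v (A v))) / 2"
proof -
  have "(norm (spectral_proj a A v))\<^sup>2 = (1 / 2)\<^sup>2 * (norm (v + a *\<^sub>R A v))\<^sup>2"
    by (simp add: spectral_proj_def power_divide)
  also have "(norm (v + a *\<^sub>R A v))\<^sup>2 = (norm v)\<^sup>2 + (norm v)\<^sup>2 + 2 * (a * Re (cinner v (A v)))"
    using a by (simp add: norm_add_square power_mult_distrib pm1_observable_norm[OF assms(1,2)]
        cinner_scaleR_right)
  finally show ?thesis
    by (simp add: power_divide)
qed

context tensor_product
begin

text \<open>Both orders act as \<open>A\<close> tensor \<open>B\<close> on product vectors.\<close>

lemma tensor_op_commute:
  assumes F: "is_tensor_op A id F" and G: "is_tensor_op id B G" and v: "v \<in> T"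
  shows "F (G v) = G (F v)"
  using is_tensor_op_comp[OF F G] is_tensor_op_comp[OF G F] v
  by (intro is_tensor_op_unique) (simp_all add: id_def)

text \<open>Expanding the two projections gives the outcome pair \<open>a\<close>, \<open>b\<close>
  the probability \<open>(1 + a * f + b * g + a * b * c) / 4\<close>, where \<open>f\<close> and
  \<open>g\<close> are the marginal means. Weighting by \<open>a * b\<close> and summing leaves only
  \<open>c\<close>.\<close>

lemma born_pmf_correlation:
  fixes E :: "('h, 'k, 't) scenario"
  assumes E: "space1 E = S1" "space2 E = S2" "scenario.tens E = tens"
    and u: "state E \<in> T" "norm (state E) = 1"
    and A: "pm1_observable S1 A" and B: "pm1_observable S2 B"
    and H: "is_tensor_op A B H"
  shows "pm1_pmf (born_pmf E (A, B))"
    "correlation (born_pmf E (A, B)) = Re (cinner (state E) (H (state E)))"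
proof -
  obtain F where F: "pm1_observable T F" "is_tensor_op A id F"
    using pm1_observable_tensor[OF A pm1_observable_id] by blast
  obtain G where G: "pm1_observable T G" "is_tensor_op id B G"
    using pm1_observable_tensor[OF pm1_observable_id B] by blast
  have FG: "is_tensor_op A B (\<lambda>v. F (G v))"
    using is_tensor_op_comp[OF F(2) G(2)] by simp
  define u where "u = state E"
  have uT: "u \<in> T" and u1: "norm u = 1"
    using u by (simp_all add: u_def)
  have H_eq: "H u = F (G u)"
    by (rule is_tensor_op_unique[OF H FG uT])
  define f g c where "f = Re (cinner u (F u))" and "g = Re (cinner u (G u))"
    and "c = Re (cinner u (F (G u)))"
  have GuT: "G u \<in> T" and FuT: "F u \<in> T" and FGuT: "F (G u) \<in> T"
    using F G uT by (simp_all add: pm1_observable_mem)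
  have comm: "F (G u) = G (F u)"
    by (rule tensor_op_commute[OF F(2) G(2) uT])
  have GF: "Re (cinner (G u) (F u)) = c"
    using pm1_observable_adjoint[OF G(1) uT FuT] comm by (simp add: c_def)
  have GFG: "Re (cinner (G u) (F (G u))) = f"
    using pm1_observable_cinner[OF G(1) uT FuT] comm by (simp add: f_def)
  have prob: "(norm (spectral_proj a F (spectral_proj b G u)))\<^sup>2 = (1 + a * f + b * g + a * b * c) / 4"
    if a: "a\<^sup>2 = 1" and b: "b\<^sup>2 = 1" for a b
  proof -
    define w where "w = spectral_proj b G u"
    have wT: "w \<in> T"
      unfolding w_def by (rule spectral_proj_mem[OF G(1) csubspace_T uT])
    have w2: "(norm w)\<^sup>2 = (1 + b * g) / 2"
      unfolding w_def using norm_spectral_proj[OF G(1) uT b] u1 by (simp add: g_def)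
    have bGu: "b *\<^sub>R G u \<in> T"
      by (rule csubspace_scaleR[OF csubspace_T GuT])
    have ubGu: "u + b *\<^sub>R G u \<in> T"
      by (rule complex_space.subspace_add[OF csubspace_T uT bGu])
    have "F w = (1 / 2) *\<^sub>R (F u + b *\<^sub>R F (G u))"
      unfolding w_def spectral_proj_def
      using clinear_on_scaleR[OF pm1_observable_clinear[OF F(1)]]
        clinear_on_add[OF pm1_observable_clinear[OF F(1)] uT bGu] ubGu GuT by simp
    then have "Re (cinner w (F w)) = (f + b * c + b * c + b\<^sup>2 * f) / 4"
      by (simp add: w_def spectral_proj_def cinner_simps GF GFG f_def[symmetric] c_def[symmetric]
          power2_eq_square algebra_simps)
    then show ?thesis
      unfolding w_def[symmetric] norm_spectral_proj[OF F(1) wT a] w2 using b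
      by (simp add: algebra_simps)
  qed
  define P where "P = (\<lambda>(a, b). if a \<in> {1, -1} \<and> b \<in> {1, -1}
    then (1 + a * f + b * g + a * b * c) / 4 else (0 :: real))"
  have eq: "(if a \<in> {1, -1} \<and> b \<in> {1, -1}
      then (norm (tensor_op S1 S2 tens (spectral_proj a A) (spectral_proj b B) (state E)))\<^sup>2
      else 0) = P (a, b)" for a b
  proof (cases "a \<in> {1, -1} \<and> b \<in> {1, -1}")
    case True
    then have "a\<^sup>2 = 1" "b\<^sup>2 = 1"
      by auto
    moreover have "tensor_op S1 S2 tens (spectral_proj a A) (spectral_proj b B) (state E) =
        spectral_proj a F (spectral_proj b G (state E))"
      by (rule tensor_op_eq[OF is_tensor_op_spectral_proj[OF F(2) G(2)] u(1)])
    ultimately show ?thesis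
      using prob[of a b] True by (simp add: u_def P_def)
  next
    case False
    then show ?thesis
      unfolding P_def by (simp only: prod.case if_False)
  qed
  have born: "born_pmf E (A, B) = embed_pmf P"
    unfolding born_pmf_def E fst_conv snd_conv eq by simp
  have nonneg: "0 \<le> P z" for z
  proof (cases z)
    case (Pair a b)
    show ?thesis
      unfolding Pair eq[symmetric] by simp
  qed
  let ?A = "{(1, 1), (1, -1), (-1, 1), (-1, -1)} :: (real \<times> real) set"
  have P_out: "P z = 0" if "z \<notin> ?A" for z
    using that by (auto simp: P_def split: prod.splits)
  \<comment> \<open>\<open>embed_pmf\<close> has the prescribed masses only if these are
    non-negative with total 1.\<close>
  have "(\<integral>\<^sup>+z. ennreal (P z) \<partial>count_space UNIV) = (\<Sum>z\<in>?A. ennreal (P z))"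
    using P_out by (intro nn_integral_count_space') auto
  also have "\<dots> = ennreal (\<Sum>z\<in>?A. P z)"
    using nonneg by (intro sum_ennreal) auto
  also have "(\<Sum>z\<in>?A. P z) = 1"
    by (simp add: P_def field_simps)
  finally have total: "(\<integral>\<^sup>+z. ennreal (P z) \<partial>count_space UNIV) = 1"
    by simp
  have pmf: "pmf (born_pmf E (A, B)) z = P z" for z
    unfolding born by (rule pmf_embed_pmf[OF nonneg total])
  have set: "set_pmf (born_pmf E (A, B)) \<subseteq> ?A"
  proof
    fix z assume "z \<in> set_pmf (born_pmf E (A, B))"
    then have "P z \<noteq> 0"
      by (simp add: set_pmf_iff pmf)
    then show "z \<in> ?A"
      using P_out by blast
  qed
  then show "pm1_pmf (born_pmf E (A, B))"
    by (force simp: pm1_pmf_def)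
  have "correlation (born_pmf E (A, B)) = (\<Sum>z\<in>?A. (fst z * snd z) * P z)"
    unfolding correlation_def pmf[symmetric] using set by (intro integral_measure_pmf_real) auto
  also have "\<dots> = c"
    by (simp add: P_def field_simps)
  finally show "correlation (born_pmf E (A, B)) = Re (cinner (state E) (H (state E)))"
    by (simp add: c_def u_def H_eq[unfolded u_def])
qed

end

section \<open>Estimates for the state\<close>

definition anticommutator :: "('a \<Rightarrow> 'a) \<Rightarrow> ('a \<Rightarrow> 'a) \<Rightarrow> 'a \<Rightarrow> 'a::real_vector" where
  "anticommutator A B v = A (B v) + B (A v)"

text \<open>The error in taking \<open>A\<close> for \<open>(X + s Z) / sqrt 2\<close>;
  \<open>s\<close> is 1 for A(0) and -1 for A(1). Only sums and real multiples occur, so that the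
  closure rules for tensor operators apply directly.\<close>

definition defect :: "('a \<Rightarrow> 'a) \<Rightarrow> real \<Rightarrow> ('a \<Rightarrow> 'a) \<Rightarrow> ('a \<Rightarrow> 'a) \<Rightarrow> 'a \<Rightarrow> 'a::real_vector" where
  "defect A s X Z v = A v + (- 1 / sqrt 2) *\<^sub>R (X v + s *\<^sub>R Z v)"

text \<open>Used twice: for the first space and for the tensor product.\<close>

locale observables =
  fixes S :: "'a::complex_hilbert set"
  assumes S: "csubspace S"
begin

lemma mem_add: "x \<in> S \<Longrightarrow> y \<in> S \<Longrightarrow> x + y \<in> S"
  by (rule complex_space.subspace_add[OF S])

lemma mem_diff: "x \<in> S \<Longrightarrow> y \<in> S \<Longrightarrow> x - y \<in> S"
  by (rule complex_space.subspace_diff[OF S])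

lemma mem_scaleR: "x \<in> S \<Longrightarrow> r *\<^sub>R x \<in> S"
  by (rule csubspace_scaleR[OF S])

lemma mem_uminus: "x \<in> S \<Longrightarrow> - x \<in> S"
  by (rule complex_space.subspace_neg[OF S])

lemma obs_add: "pm1_observable S A \<Longrightarrow> x \<in> S \<Longrightarrow> y \<in> S \<Longrightarrow> A (x + y) = A x + A y"
  by (rule clinear_on_add[OF pm1_observable_clinear])

lemma obs_diff: "pm1_observable S A \<Longrightarrow> x \<in> S \<Longrightarrow> y \<in> S \<Longrightarrow> A (x - y) = A x - A y"
  by (rule clinear_on_diff[OF pm1_observable_clinear _ ]) (auto simp: S)

lemma obs_scaleR: "pm1_observable S A \<Longrightarrow> x \<in> S \<Longrightarrow> A (r *\<^sub>R x) = r *\<^sub>R A x"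
  by (rule clinear_on_scaleR[OF pm1_observable_clinear])

lemma obs_uminus: "pm1_observable S A \<Longrightarrow> x \<in> S \<Longrightarrow> A (- x) = - A x"
  using obs_scaleR[of A x "-1"] by simp

lemmas obs_norms = mem_add mem_diff mem_scaleR mem_uminus pm1_observable_mem[of S]
  pm1_observable_involution[of S] pm1_observable_norm[of S]

lemmas obs_simps = obs_norms obs_add obs_diff obs_scaleR obs_uminus

lemma defect_diff:
  assumes "pm1_observable S A" "pm1_observable S X" "pm1_observable S Z" "v \<in> S" "w \<in> S"
  shows "defect A s X Z (v - w) = defect A s X Z v - defect A s X Z w"
  using assms by (simp add: defect_def obs_simps algebra_simps)

lemma defect_add:
  assumes "pm1_observable S A" "pm1_observable S X" "pm1_observable S Z" "v \<in> S" "w \<in> S"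
  shows "defect A s X Z (v + w) = defect A s X Z v + defect A s X Z w"
  using assms by (simp add: defect_def obs_simps algebra_simps)

lemma defect_scaleR:
  assumes "pm1_observable S A" "pm1_observable S X" "pm1_observable S Z" "v \<in> S"
  shows "defect A s X Z (r *\<^sub>R v) = r *\<^sub>R defect A s X Z v"
  using assms by (simp add: defect_def obs_simps algebra_simps)

lemma defect_mem:
  assumes "pm1_observable S A" "pm1_observable S X" "pm1_observable S Z" "v \<in> S"
  shows "defect A s X Z v \<in> S"
  using assms by (simp add: defect_def obs_simps)

lemma norm_defect_le:
  assumes "pm1_observable S A" "pm1_observable S X" "pm1_observable S Z" "v \<in> S" "\<bar>s\<bar> = 1"
  shows "norm (defect A s X Z v) \<le> 3 * norm v"
proof -
  have "norm (X v + s *\<^sub>R Z v) \<le> 2 * norm v"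
    using norm_triangle_ineq[of "X v" "s *\<^sub>R Z v"] assms by (simp add: obs_simps)
  \<comment> \<open>The factor \<open>1 / sqrt 2\<close> is estimated by 1, so 3 stands for the
    sharper \<open>1 + sqrt 2\<close>.\<close>
  then have "norm ((- 1 / sqrt 2) *\<^sub>R (X v + s *\<^sub>R Z v)) \<le> 1 * (2 * norm v)"
    unfolding norm_scaleR by (intro mult_mono) auto
  then show ?thesis
    using norm_triangle_ineq[of "A v" "(- 1 / sqrt 2) *\<^sub>R (X v + s *\<^sub>R Z v)"] assms
    by (simp add: defect_def obs_simps)
qed

end

text \<open>The lower-case operators act on the whole tensor product, whose structure enters only
  through \<open>comm\<close>. The error \<open>e\<close> is a distance of vectors, of order 1/sqrt
  m in the application; \<open>e'\<close> is an error of correlations, of the same order.\<close>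

locale bipartite_observables = observables T for T :: "'t::complex_hilbert set" +
  fixes u :: 't and x1 z1 a0 a1 x2 z2 :: "'t \<Rightarrow> 't" and e e' :: real
  assumes u: "u \<in> T" "norm u = 1"
    and x1: "pm1_observable T x1" and z1: "pm1_observable T z1"
    and a0: "pm1_observable T a0" and a1: "pm1_observable T a1"
    and x2: "pm1_observable T x2" and z2: "pm1_observable T z2"
    and comm: "\<And>A B v. A \<in> {x1, z1, a0, a1} \<Longrightarrow> B \<in> {x2, z2} \<Longrightarrow> v \<in> T \<Longrightarrow> A (B v) = B (A v)"
    and xz: "norm (x1 u - z2 u) \<le> e" and zx: "norm (z1 u - x2 u) \<le> e"
    and a0_corr: "sqrt 2 - e' \<le> Re (cinner u (a0 (z2 u))) + Re (cinner u (a0 (x2 u)))"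
    and a1_corr: "sqrt 2 - e' \<le> Re (cinner u (a1 (z2 u))) - Re (cinner u (a1 (x2 u)))"
    and diag_corr: "\<bar>Re (cinner u (x1 (x2 u))) + Re (cinner u (z1 (z2 u)))\<bar> \<le> e'"
begin

lemmas obs = x1 z1 a0 a1 x2 z2

lemma e_nonneg: "0 \<le> e"
  using order_trans[OF norm_ge_zero xz] .

lemma e'_nonneg: "0 \<le> e'"
  using order_trans[OF abs_ge_zero diag_corr] .

text \<open>Bounds the distance from \<open>a0 u\<close> and \<open>a1 u\<close> to the normalised
  sum and difference of \<open>z2 u\<close> and \<open>x2 u\<close>. This square root is the source
  of the exponent 1/4.\<close>

definition "h = sqrt (2 * e' + e)"

lemma h_nonneg: "0 \<le> h"
  using e_nonneg e'_nonneg by (simp add: h_def)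

lemma h_square: "h\<^sup>2 = 2 * e' + e"
  using e_nonneg e'_nonneg by (simp add: h_def)

text \<open>Replacing \<open>x1 u\<close> by \<open>z2 u\<close> and \<open>z1 u\<close> by
  \<open>x2 u\<close> turns both correlations of groups 7 and 8 into this overlap.\<close>

lemma overlap_z2_x2: "\<bar>2 * Re (cinner (z2 u) (x2 u))\<bar> \<le> e' + 2 * e"
proof -
  have "\<bar>Re (cinner (x1 u - z2 u) (x2 u))\<bar> \<le> e" "\<bar>Re (cinner (z1 u - x2 u) (z2 u))\<bar> \<le> e"
    using abs_Re_cinner_le[of "x1 u - z2 u" "x2 u"] abs_Re_cinner_le[of "z1 u - x2 u" "z2 u"]
      xz zx u by (simp_all add: obs obs_norms)
  moreover have "cinner (x1 u) (x2 u) = cinner u (x1 (x2 u))" "cinner (z1 u) (z2 u) = cinner u (z1 (z2 u))"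
    using u by (simp_all add: obs obs_simps pm1_observable_adjoint[of T])
  ultimately show ?thesis
    using diag_corr Re_cinner_commute[of "x2 u" "z2 u"] by (simp add: cinner_simps)
qed

text \<open>\<open>A u\<close> is a unit vector, \<open>?w\<close> has length at most about
  \<open>sqrt 2\<close> by \<open>overlap_z2_x2\<close>, and their inner product nearly attains the
  Cauchy-Schwarz bound; so they are nearly parallel.\<close>

lemma norm_sum_sqrt2:
  assumes A: "pm1_observable T A" and s: "\<bar>s\<bar> = 1"
    and corr: "sqrt 2 - e' \<le> Re (cinner u (A (z2 u))) + s * Re (cinner u (A (x2 u)))"
  shows "norm (A u - (1 / sqrt 2) *\<^sub>R (z2 u + s *\<^sub>R x2 u)) \<le> h"
proof -
  let ?w = "z2 u + s *\<^sub>R x2 u"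
  have s2: "s\<^sup>2 = 1"
    using s by (metis one_power2 power2_abs)
  have "(norm ?w)\<^sup>2 = 2 + s * (2 * Re (cinner (z2 u) (x2 u)))"
    using u s s2 by (simp add: norm_add_square obs obs_simps cinner_simps power_mult_distrib)
  also have "\<dots> \<le> 2 + (e' + 2 * e)"
  proof -
    have "s = 1 \<or> s = - 1"
      using s by linarith
    then show ?thesis
      using overlap_z2_x2 by (elim disjE) auto
  qed
  finally have w: "(norm ?w)\<^sup>2 \<le> 2 + (e' + 2 * e)" .
  have "Re (cinner (A u) ?w) = Re (cinner u (A (z2 u))) + s * Re (cinner u (A (x2 u)))"
    using u by (simp add: A cinner_simps obs obs_simps pm1_observable_adjoint[OF A])
  then have c: "sqrt 2 - e' \<le> Re (cinner (A u) ?w)"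
    using corr by simp
  have "(norm (A u - (1 / sqrt 2) *\<^sub>R ?w))\<^sup>2 =
      1 + (norm ?w)\<^sup>2 / 2 - sqrt 2 * Re (cinner (A u) ?w)"
    using u A by (simp add: norm_diff_square obs_simps power_divide cinner_scaleR_right real_div_sqrt
        divide_simps) (simp add: algebra_simps)
  also have "\<dots> \<le> 1 + (2 + (e' + 2 * e)) / 2 - sqrt 2 * (sqrt 2 - e')"
    using w c by (intro diff_mono add_mono divide_right_mono mult_left_mono) auto
  also have "\<dots> = (1 / 2 + sqrt 2) * e' + e"
    by (simp add: algebra_simps)
  \<comment> \<open>The coefficient 2 in \<open>h\<close> is a round bound for
    \<open>1 / 2 + sqrt 2\<close>.\<close>
  also have "\<dots> \<le> 2 * e' + e"
  proof -
    have "sqrt 2 \<le> 3 / 2"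
      by (rule real_le_lsqrt) (simp_all add: power2_eq_square)
    then show ?thesis
      using e'_nonneg by (intro add_mono mult_right_mono) auto
  qed
  finally show ?thesis
    unfolding h_square[symmetric] using h_nonneg by (rule power2_le_imp_le)
qed

text \<open>Returning from \<open>z2 u\<close>, \<open>x2 u\<close> to \<open>x1 u\<close>,
  \<open>z1 u\<close> in \<open>norm_sum_sqrt2\<close> costs another \<open>2 * e\<close>.\<close>

lemma norm_defect_state:
  assumes A: "pm1_observable T A" and s: "\<bar>s\<bar> = 1"
    and corr: "sqrt 2 - e' \<le> Re (cinner u (A (z2 u))) + s * Re (cinner u (A (x2 u)))"
  shows "norm (defect A s x1 z1 u) \<le> h + 2 * e"
proof -
  have "defect A s x1 z1 u = (A u - (1 / sqrt 2) *\<^sub>R (z2 u + s *\<^sub>R x2 u)) -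
      (1 / sqrt 2) *\<^sub>R ((x1 u - z2 u) + s *\<^sub>R (z1 u - x2 u))"
    by (simp add: defect_def algebra_simps)
  moreover have "norm ((1 / sqrt 2) *\<^sub>R ((x1 u - z2 u) + s *\<^sub>R (z1 u - x2 u))) \<le> 1 * (e + e)"
    unfolding norm_scaleR
    using norm_triangle_ineq[of "x1 u - z2 u" "s *\<^sub>R (z1 u - x2 u)"] xz zx s
    by (intro mult_mono) auto
  ultimately show ?thesis
    using norm_sum_sqrt2[OF assms]
      norm_triangle_ineq4[of "A u - (1 / sqrt 2) *\<^sub>R (z2 u + s *\<^sub>R x2 u)"
        "(1 / sqrt 2) *\<^sub>R ((x1 u - z2 u) + s *\<^sub>R (z1 u - x2 u))"] by simp
qed

text \<open>
  On \<open>u\<close>, \<open>x1\<close> and \<open>z1\<close> may be replaced by \<open>z2\<close> and \<open>x2\<close>, which commute with the defect.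
\<close>

lemma norm_defect_imitate:
  assumes A: "A \<in> {a0, a1}" and s: "\<bar>s\<bar> = 1"
  shows "norm (defect A s x1 z1 (x1 u)) \<le> norm (defect A s x1 z1 u) + 3 * e"
    "norm (defect A s x1 z1 (z1 u)) \<le> norm (defect A s x1 z1 u) + 3 * e"
    "norm (defect A s x1 z1 (x1 (z1 u))) \<le> norm (defect A s x1 z1 u) + 6 * e"
proof -
  let ?d = "defect A s x1 z1"
  have Aobs: "pm1_observable T A"
    using A a0 a1 by blast
  have comm_d: "?d (B v) = B (?d v)" if "B \<in> {x2, z2}" "v \<in> T" for B v
  proof -
    have "pm1_observable T B"
      using that x2 z2 by blast
    moreover have "A (B v) = B (A v)" "x1 (B v) = B (x1 v)" "z1 (B v) = B (z1 v)"
      using A that by (auto intro!: comm)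
    ultimately show ?thesis
      using that(2) by (simp add: defect_def obs_simps Aobs x1 z1)
  qed
  \<comment> \<open>Origin of the cost \<open>3 * e\<close> per replacement: the defect is Lipschitz
    with constant 3.\<close>
  have le: "norm (?d v) \<le> norm (?d w) + 3 * norm (v - w)" if "v \<in> T" "w \<in> T" for v w
    using norm_defect_le[OF Aobs x1 z1 mem_diff[OF that] s]
      norm_triangle_ineq2[of "?d v" "?d w"] that
    by (simp add: defect_diff Aobs x1 z1)
  have dT: "?d v \<in> T" if "v \<in> T" for v
    using that by (simp add: defect_mem Aobs x1 z1)
  show 1: "norm (?d (x1 u)) \<le> norm (?d u) + 3 * e"
    using le[of "x1 u" "z2 u"] xz comm_d[of z2 u] u dT[of u] by (simp add: obs obs_simps)
  show "norm (?d (z1 u)) \<le> norm (?d u) + 3 * e"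
    using le[of "z1 u" "x2 u"] zx comm_d[of x2 u] u dT[of u] by (simp add: obs obs_simps)
  \<comment> \<open>Only the inner \<open>z1 u\<close> is replaced: \<open>x1 (x2 u)\<close> equals
    \<open>x2 (x1 u)\<close>, so the bound for \<open>x1 u\<close> applies.\<close>
  have eq: "x1 (z1 u) - x1 (x2 u) = x1 (z1 u - x2 u)"
    using u by (simp add: obs obs_simps)
  have "norm (x1 (z1 u) - x1 (x2 u)) \<le> e"
    unfolding eq using zx u by (simp add: obs obs_norms)
  moreover have "?d (x1 (x2 u)) = x2 (?d (x1 u))"
    using comm[of x1 x2 u] comm_d[of x2 "x1 u"] u by (simp add: obs obs_simps)
  ultimately show "norm (?d (x1 (z1 u))) \<le> norm (?d u) + 6 * e"
    using le[of "x1 (z1 u)" "x1 (x2 u)"] 1 u dT[of "x1 u"] by (simp add: obs obs_simps)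
qed

text \<open>
  Both sides of \<open>a0 (a0 u) = u\<close> are compared after replacing \<open>a0\<close> by \<open>(z2 + x2) / \<surd>2\<close> twice.
\<close>

lemma norm_anticommutator2: "norm (anticommutator x2 z2 u) \<le> 5 * h"
proof -
  let ?w = "z2 u + x2 u"
  define k where "k = a0 u - (1 / sqrt 2) *\<^sub>R ?w"
  have k: "norm k \<le> h"
    unfolding k_def using norm_sum_sqrt2[OF a0, of 1] a0_corr by simp
  have kT: "k \<in> T"
    using u by (simp add: k_def obs obs_simps)
  have a0u: "a0 u = (1 / sqrt 2) *\<^sub>R ?w + k"
    by (simp add: k_def)
  have "u = a0 (a0 u)"
    using u by (simp add: obs obs_simps)
  also have "\<dots> = a0 ((1 / sqrt 2) *\<^sub>R ?w + k)"
    using a0u by (rule arg_cong)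
  also have "\<dots> = (1 / sqrt 2) *\<^sub>R (z2 (a0 u) + x2 (a0 u)) + a0 k"
    using u kT comm[of a0 z2 u] comm[of a0 x2 u] by (simp add: obs obs_simps)
  \<comment> \<open>In the square of \<open>z2 + x2\<close> the squares contribute
    \<open>2 *\<^sub>R u\<close>; what remains is the anticommutator.\<close>
  also have "z2 (a0 u) + x2 (a0 u) = (1 / sqrt 2) *\<^sub>R (2 *\<^sub>R u + anticommutator x2 z2 u) + (z2 k + x2 k)"
    unfolding a0u using u kT
    by (simp add: obs obs_simps anticommutator_def algebra_simps scaleR_2)
  finally have "u = u + (1 / 2) *\<^sub>R anticommutator x2 z2 u + (1 / sqrt 2) *\<^sub>R (z2 k + x2 k) + a0 k"
    by (simp add: algebra_simps)
  then have "(1 / 2) *\<^sub>R anticommutator x2 z2 u = - ((1 / sqrt 2) *\<^sub>R (z2 k + x2 k) + a0 k)"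
    by (simp add: algebra_simps eq_neg_iff_add_eq_0)
  then have "norm ((1 / 2) *\<^sub>R anticommutator x2 z2 u) = norm ((1 / sqrt 2) *\<^sub>R (z2 k + x2 k) + a0 k)"
    by (simp only: norm_minus_cancel)
  also have "\<dots> \<le> 3 / 4 * (2 * norm k) + norm k"
  proof (rule order_trans[OF norm_triangle_ineq add_mono])
    \<comment> \<open>The bound 3/4 for \<open>1 / sqrt 2\<close> makes the final constant
      \<open>2 * (3 / 2 + 1) = 5\<close>.\<close>
    have "4 / 3 \<le> sqrt (2::real)"
      by (rule real_le_rsqrt) (simp add: power2_eq_square)
    then have "1 / sqrt 2 \<le> 3 / (4::real)"
      by (simp add: divide_le_eq)
    then show "norm ((1 / sqrt 2) *\<^sub>R (z2 k + x2 k)) \<le> 3 / 4 * (2 * norm k)"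
      unfolding norm_scaleR using norm_triangle_ineq[of "z2 k" "x2 k"] kT
      by (intro mult_mono) (auto simp: obs obs_simps)
  qed (use kT in \<open>simp add: obs obs_simps\<close>)
  finally show ?thesis
    using k by simp
qed

text \<open>Four replacements, each at cost \<open>e\<close>: \<open>x1 (z1 u)\<close> is close to
  \<open>x1 (x2 u) = x2 (x1 u)\<close> and this to \<open>x2 (z2 u)\<close>; likewise for the other
  product. Passing to the other side reverses the order of a product, which the anticommutator does
  not notice.\<close>

lemma norm_anticommutator1: "norm (anticommutator x1 z1 u) \<le> 5 * h + 4 * e"
proof -
  have "anticommutator x1 z1 u = anticommutator x2 z2 u +
      (x1 (z1 u - x2 u) + x2 (x1 u - z2 u) + z1 (x1 u - z2 u) + z2 (z1 u - x2 u))"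
    using u comm[of x1 x2 u] comm[of z1 z2 u] by (simp add: anticommutator_def obs obs_simps)
  also have "norm \<dots> \<le> 5 * h + (e + e + e + e)"
    using u xz zx norm_anticommutator2
    by (intro order_trans[OF norm_triangle_ineq] add_mono) (simp_all add: obs obs_norms)
  finally show ?thesis
    by simp
qed

text \<open>The bounds are transported to this component of \<open>u\<close> because the vector to
  be found in the first space must be an eigenvector of Z1.\<close>

definition "p = spectral_proj 1 z1 u"

lemma p_eq: "p = (1 / 2) *\<^sub>R (u + z1 u)"
  by (simp add: p_def spectral_proj_def)

text \<open>
  The expectation of \<open>z1\<close> nearly vanishes: conjugation by \<open>x1\<close> changes its sign, because \<open>x1\<close>
  and \<open>z1\<close> nearly anticommute, but conjugation by \<open>z2\<close> does not.
\<close>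

lemma norm_p_ge:
  assumes "5 * h + 8 * e \<le> 1"
  shows "1 / 4 \<le> (norm p)\<^sup>2"
proof -
  let ?\<zeta> = "Re (cinner u (z1 u))"
  have T: "x1 u \<in> T" "z1 u \<in> T" "z2 u \<in> T"
    using u by (simp_all add: obs obs_simps)
  have 1: "Re (cinner (x1 u) (z1 (x1 u))) = Re (cinner (x1 u) (anticommutator x1 z1 u)) - ?\<zeta>"
    using pm1_observable_cinner[OF x1 u(1) T(2)] by (simp add: anticommutator_def cinner_simps)
  have 2: "cinner (z2 u) (z1 (z2 u)) = cinner u (z1 u)"
    using pm1_observable_cinner[OF z2 u(1) T(2)] comm[of z1 z2 u] u by simp
  have 3: "z1 (x1 u - z2 u) = z1 (x1 u) - z1 (z2 u)"
    using T by (simp add: obs obs_simps)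
  have "\<bar>Re (cinner (x1 u - z2 u) (z1 (x1 u)))\<bar> \<le> e" "\<bar>Re (cinner (z2 u) (z1 (x1 u - z2 u)))\<bar> \<le> e"
    using abs_Re_cinner_le[of "x1 u - z2 u" "z1 (x1 u)"] abs_Re_cinner_le[of "z2 u" "z1 (x1 u - z2 u)"]
      xz T u by (simp_all add: obs obs_norms)
  then have "\<bar>Re (cinner (x1 u) (z1 (x1 u))) - ?\<zeta>\<bar> \<le> 2 * e"
    by (simp add: 3 cinner_simps 2)
  moreover have "\<bar>Re (cinner (x1 u) (anticommutator x1 z1 u))\<bar> \<le> 5 * h + 4 * e"
    using abs_Re_cinner_le[of "x1 u" "anticommutator x1 z1 u"] norm_anticommutator1 u
    by (simp add: obs obs_simps)
  \<comment> \<open>The two estimates give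
    \<open>2 * \<bar>?\<zeta>\<bar> \<le> 5 * h + 6 * e\<close>, which is at most 1.\<close>
  ultimately have "- 1 / 2 \<le> ?\<zeta>"
    using assms e_nonneg unfolding 1 by linarith
  then show ?thesis
    unfolding p_def using norm_spectral_proj[OF z1 u(1), of 1] u by simp
qed

text \<open>As \<open>z1\<close> squares to the identity, it commutes with the anticommutator, so
  the estimate at \<open>u\<close> also holds at \<open>z1 u\<close>.\<close>

lemma norm_anticommutator_p: "norm (anticommutator x1 z1 p) \<le> 5 * h + 8 * e"
proof -
  have "anticommutator x1 z1 p = (1 / 2) *\<^sub>R (anticommutator x1 z1 u + z1 (anticommutator x1 z1 u))"
    using u by (simp add: p_eq anticommutator_def obs obs_simps algebra_simps)
  also have "norm \<dots> \<le> 1 / 2 * (norm (anticommutator x1 z1 u) + norm (z1 (anticommutator x1 z1 u)))"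
    by (simp add: norm_triangle_ineq)
  also have "norm (z1 (anticommutator x1 z1 u)) = norm (anticommutator x1 z1 u)"
    by (rule pm1_observable_norm[OF z1]) (use u in \<open>simp add: anticommutator_def obs obs_norms\<close>)
  finally show ?thesis
    using norm_anticommutator1 e_nonneg by simp
qed

text \<open>The bounds are weakened to that of \<open>norm_anticommutator_p\<close>, so that one
  constant governs all five quantities at \<open>p\<close>.\<close>

lemma norm_defect_p:
  assumes A: "A \<in> {a0, a1}" and s: "\<bar>s\<bar> = 1"
    and corr: "sqrt 2 - e' \<le> Re (cinner u (A (z2 u))) + s * Re (cinner u (A (x2 u)))"
  shows "norm (defect A s x1 z1 p) \<le> 5 * h + 8 * e" "norm (defect A s x1 z1 (x1 p)) \<le> 5 * h + 8 * e"
proof -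
  let ?d = "defect A s x1 z1"
  have Aobs: "pm1_observable T A"
    using A a0 a1 by blast
  note d = norm_defect_state[OF Aobs s corr] norm_defect_imitate[OF A s]
  have "?d p = (1 / 2) *\<^sub>R (?d u + ?d (z1 u))"
    using u by (simp add: p_eq defect_scaleR defect_add Aobs obs obs_simps)
  also have "norm \<dots> \<le> 1 / 2 * (norm (?d u) + norm (?d (z1 u)))"
    by (simp add: norm_triangle_ineq)
  finally show "norm (?d p) \<le> 5 * h + 8 * e"
    using d h_nonneg e_nonneg by simp
  have "?d (x1 p) = (1 / 2) *\<^sub>R (?d (x1 u) + ?d (x1 (z1 u)))"
    using u by (simp add: p_eq defect_scaleR defect_add Aobs obs obs_simps)
  also have "norm \<dots> \<le> 1 / 2 * (norm (?d (x1 u)) + norm (?d (x1 (z1 u))))"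
    by (simp add: norm_triangle_ineq)
  finally show "norm (?d (x1 p)) \<le> 5 * h + 8 * e"
    using d h_nonneg e_nonneg by simp
qed

end

section \<open>Qubits in the first factor\<close>

context observables
begin

text \<open>The witness is the normalised component of \<open>X e0\<close> in the other eigenspace of \<open>Z\<close>.\<close>

lemma eigenvector_pair:
  assumes X: "pm1_observable S X" and Z: "pm1_observable S Z"
    and e0: "e0 \<in> S" "norm e0 = 1" "Z e0 = e0"
    and ac: "norm (anticommutator X Z e0) \<le> \<eta>" and \<eta>: "\<eta> \<le> 1"
  obtains e1 where "e1 \<in> S" "norm e1 = 1" "cinner e0 e1 = 0" "Z e1 = - e1"
    "norm (X e0 - e1) \<le> \<eta>" "norm (X e1 - e0) \<le> \<eta>"
proof -
  define f where "f = (1 / 2) *\<^sub>R (X e0 - Z (X e0))"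
  define e1 where "e1 = (1 / norm f) *\<^sub>R f"
  have fS: "f \<in> S" and Zf: "Z f = - f"
    using e0 by (simp_all add: f_def obs_simps X Z algebra_simps)
  have "X e0 - f = (1 / 2) *\<^sub>R anticommutator X Z e0"
    by (simp add: f_def anticommutator_def e0 algebra_simps flip: scaleR_add_left)
  then have Xf: "norm (X e0 - f) \<le> \<eta> / 2"
    using ac by simp
  have "\<bar>1 - norm f\<bar> \<le> \<eta> / 2"
    using Xf norm_triangle_ineq3[of "X e0" f] e0 by (simp add: obs_simps X)
  \<comment> \<open>As \<open>\<eta> \<le> 1\<close>, the norm of \<open>f\<close> is at least 1/2,
    so \<open>f\<close> can be normalised.\<close>
  then have f: "\<bar>1 - norm f\<bar> \<le> \<eta> / 2" "0 < norm f"
    using \<eta> by auto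
  have e1S: "e1 \<in> S" and Ze1: "Z e1 = - e1" and e1: "norm e1 = 1"
    using fS Zf f by (auto simp: e1_def obs_simps Z)
  have "f - e1 = (1 - 1 / norm f) *\<^sub>R f"
    by (simp add: e1_def algebra_simps)
  then have "norm (f - e1) = \<bar>1 - 1 / norm f\<bar> * norm f"
    by simp
  also have "\<dots> = \<bar>(1 - 1 / norm f) * norm f\<bar>"
    by (simp add: abs_mult)
  also have "(1 - 1 / norm f) * norm f = norm f - 1"
    using f by (simp add: field_simps)
  finally have "norm (f - e1) \<le> \<eta> / 2"
    using f by (simp add: abs_minus_commute)
  then have Xe0: "norm (X e0 - e1) \<le> \<eta>"
    using Xf norm_triangle_ineq[of "X e0 - f" "f - e1"] by simp
  have "X (X e0 - e1) = e0 - X e1"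
    using e0 e1S by (simp add: obs_simps X)
  then have "norm (X e1 - e0) = norm (X (X e0 - e1))"
    by (simp add: norm_minus_commute)
  then have Xe1: "norm (X e1 - e0) \<le> \<eta>"
    using Xe0 e0 e1S by (simp add: obs_norms X)
  have "cinner e0 e1 = - cinner e0 e1"
    using pm1_observable_adjoint[OF Z e0(1) e1S] by (simp add: e0(3) Ze1 cinner_minus_right)
  then have "cinner e0 e1 = 0"
    by simp
  then show ?thesis
    using that e1S e1 Ze1 Xe0 Xe1 by blast
qed

text \<open>The columns of \<open>(X + s Z) / sqrt 2\<close> in the basis \<open>e0\<close>,
  \<open>e1\<close>, up to errors. The defect at \<open>e1\<close> is obtained from the one at
  \<open>X e0\<close> at cost \<open>3 * \<eta>\<close>; replacing \<open>X e0\<close> by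
  \<open>e1\<close>, or \<open>X e1\<close> by \<open>e0\<close>, adds one more
  \<open>\<eta>\<close>.\<close>

lemma defect_pair:
  assumes A: "pm1_observable S A" and X: "pm1_observable S X" and Z: "pm1_observable S Z"
    and s: "\<bar>s\<bar> = 1" and e0: "e0 \<in> S" "Z e0 = e0" and e1: "e1 \<in> S" "Z e1 = - e1"
    and Xe0: "norm (X e0 - e1) \<le> \<eta>" and Xe1: "norm (X e1 - e0) \<le> \<eta>"
    and d0: "norm (defect A s X Z e0) \<le> \<eta>" and d1: "norm (defect A s X Z (X e0)) \<le> \<eta>"
  shows "norm (A e0 - ((s / sqrt 2) *\<^sub>R e0 + (1 / sqrt 2) *\<^sub>R e1)) \<le> 2 * \<eta>"
    "norm (A e1 - ((1 / sqrt 2) *\<^sub>R e0 + (- s / sqrt 2) *\<^sub>R e1)) \<le> 5 * \<eta>"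
proof -
  have scale: "norm ((1 / sqrt 2) *\<^sub>R v) \<le> norm v" for v :: 'a
    using mult_right_mono[of "1 / sqrt 2" 1 "norm v"] by simp
  have A_e0: "A e0 - ((s / sqrt 2) *\<^sub>R e0 + (1 / sqrt 2) *\<^sub>R e1) =
      defect A s X Z e0 + (1 / sqrt 2) *\<^sub>R (X e0 - e1)"
    by (simp add: defect_def e0 algebra_simps)
  show "norm (A e0 - ((s / sqrt 2) *\<^sub>R e0 + (1 / sqrt 2) *\<^sub>R e1)) \<le> 2 * \<eta>"
    unfolding A_e0 using norm_triangle_ineq[of "defect A s X Z e0" "(1 / sqrt 2) *\<^sub>R (X e0 - e1)"]
      scale[of "X e0 - e1"] Xe0 d0 by linarith
  have mem: "X e0 \<in> S" "X e0 - e1 \<in> S"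
    using e0 e1 by (simp_all add: obs_norms X)
  have "defect A s X Z e1 = defect A s X Z (X e0) - defect A s X Z (X e0 - e1)"
    using mem e1 by (simp add: defect_diff A X Z)
  then have d_e1: "norm (defect A s X Z e1) \<le> \<eta> + 3 * \<eta>"
    using norm_triangle_ineq4[of "defect A s X Z (X e0)" "defect A s X Z (X e0 - e1)"]
      norm_defect_le[OF A X Z mem(2) s] d1 Xe0 by simp
  have A_e1: "A e1 - ((1 / sqrt 2) *\<^sub>R e0 + (- s / sqrt 2) *\<^sub>R e1) =
      defect A s X Z e1 + (1 / sqrt 2) *\<^sub>R (X e1 - e0)"
    by (simp add: defect_def e1 algebra_simps)
  show "norm (A e1 - ((1 / sqrt 2) *\<^sub>R e0 + (- s / sqrt 2) *\<^sub>R e1)) \<le> 5 * \<eta>"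
    unfolding A_e1 using d_e1 norm_triangle_ineq[of "defect A s X Z e1" "(1 / sqrt 2) *\<^sub>R (X e1 - e0)"]
      scale[of "X e1 - e0"] Xe1 by linarith
qed

end

section \<open>Anticommutators and defects on the first factor\<close>

context tensor_product
begin

lemma is_tensor_op_anticommutator:
  assumes "is_tensor_op A id F" "is_tensor_op B id G"
  shows "is_tensor_op (anticommutator A B) id (anticommutator F G)"
proof -
  have "is_tensor_op (\<lambda>x. A (B x)) id (\<lambda>x. F (G x))" "is_tensor_op (\<lambda>x. B (A x)) id (\<lambda>x. G (F x))"
    using is_tensor_op_comp[OF assms] is_tensor_op_comp[OF assms(2,1)] by (simp_all add: id_def)
  then show ?thesis
    unfolding anticommutator_def[abs_def] by (rule is_tensor_op_add_left)
qed

lemma is_tensor_op_defect: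
  assumes "is_tensor_op A id F" "is_tensor_op X id x" "is_tensor_op Z id z"
  shows "is_tensor_op (defect A s X Z) id (defect F s x z)"
  unfolding defect_def[abs_def]
  by (rule is_tensor_op_add_left is_tensor_op_scaleR_left assms)+

lemma is_tensor_op_left_comp:
  assumes "is_tensor_op A id F" "is_tensor_op B id G"
  shows "is_tensor_op (\<lambda>v. A (B v)) id (\<lambda>v. F (G v))"
  using is_tensor_op_comp[OF assms] by (simp add: id_def)

end

section \<open>The correlations of a valid scenario\<close>

lemma valid_scenario_tensor_product:
  "valid_scenario E \<Longrightarrow> tensor_product (space1 E) (space2 E) (tens E)"
  by (simp add: valid_scenario_def tensor_product_def hilbert_space_on_def)

definition group_correlation ::
    "('h::complex_hilbert, 'k::complex_hilbert, 't::complex_hilbert) scenario \<Rightarrow> nat \<Rightarrow> real" where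
  "group_correlation E k = correlation (born_pmf E (group_obs E k))"

lemma group_obs_simps:
  "group_obs E 1 = (obs_X1 E, obs_Z2 E)" "group_obs E 2 = (obs_Z1 E, obs_X2 E)"
  "group_obs E 3 = (obs_A0 E, obs_Z2 E)" "group_obs E 4 = (obs_A0 E, obs_X2 E)"
  "group_obs E 5 = (obs_A1 E, obs_Z2 E)" "group_obs E 6 = (obs_A1 E, obs_X2 E)"
  "group_obs E 7 = (obs_X1 E, obs_X2 E)" "group_obs E 8 = (obs_Z1 E, obs_Z2 E)"
  by (simp_all add: group_obs_def)

lemma group_obs_pm1_observable:
  assumes "valid_scenario E" "k \<in> {1..8}"
  shows "pm1_observable (space1 E) (fst (group_obs E k))" "pm1_observable (space2 E) (snd (group_obs E k))"
proof -
  have "k = 1 \<or> k = 2 \<or> k = 3 \<or> k = 4 \<or> k = 5 \<or> k = 6 \<or> k = 7 \<or> k = 8"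
    using assms(2) by auto
  then show "pm1_observable (space1 E) (fst (group_obs E k))" "pm1_observable (space2 E) (snd (group_obs E k))"
    using assms(1) by (elim disjE; simp only: group_obs_simps fst_conv snd_conv valid_scenario_def)+
qed

lemma group_correlation_eq:
  assumes E: "valid_scenario E" and k: "k \<in> {1..8}"
  shows "pm1_pmf (born_pmf E (group_obs E k))"
    and "tensor_product.is_tensor_op (space1 E) (space2 E) (tens E)
      (fst (group_obs E k)) (snd (group_obs E k)) H \<Longrightarrow>
      group_correlation E k = Re (cinner (state E) (H (state E)))"
proof -
  interpret tensor_product "space1 E" "space2 E" "tens E"
    by (rule valid_scenario_tensor_product[OF E])
  have u: "state E \<in> T" "norm (state E) = 1"
    using E by (simp_all add: valid_scenario_def T_def)
  note obs = group_obs_pm1_observable[OF E k]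
  note * = born_pmf_correlation[OF refl refl refl u obs, unfolded prod.collapse]
  obtain H' where "is_tensor_op (fst (group_obs E k)) (snd (group_obs E k)) H'"
    using pm1_observable_tensor[OF obs] by blast
  then show "pm1_pmf (born_pmf E (group_obs E k))"
    by (rule *(1))
  show "group_correlation E k = Re (cinner (state E) (H (state E)))"
    if "is_tensor_op (fst (group_obs E k)) (snd (group_obs E k)) H"
    unfolding group_correlation_def by (rule *(2)[OF that])
qed

text \<open>
  If every vector of the first space violated one of the bounds, \<open>tensor_norm_inequality\<close> would
  transfer this to the state, contradicting the estimates of the previous section.
\<close>

lemma exists_approximate_qubit:
  fixes E :: "('h::complex_hilbert, 'k::complex_hilbert, 't::complex_hilbert) scenario"
  assumes E: "valid_scenario E" and e: "0 \<le> e"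
    and c1: "1 - group_correlation E 1 \<le> e\<^sup>2 / 2" and c2: "1 - group_correlation E 2 \<le> e\<^sup>2 / 2"
    and c34: "sqrt 2 - e' \<le> group_correlation E 3 + group_correlation E 4"
    and c56: "sqrt 2 - e' \<le> group_correlation E 5 - group_correlation E 6"
    and c78: "\<bar>group_correlation E 7 + group_correlation E 8\<bar> \<le> e'"
    and M: "5 * sqrt (2 * e' + e) + 8 * e \<le> M" "0 < M" "M \<le> 1"
  obtains e0 where "e0 \<in> space1 E" "norm e0 = 1" "obs_Z1 E e0 = e0"
    "norm (anticommutator (obs_X1 E) (obs_Z1 E) e0) \<le> 5 * M"
    "norm (defect (obs_A0 E) 1 (obs_X1 E) (obs_Z1 E) e0) \<le> 5 * M"
    "norm (defect (obs_A1 E) (- 1) (obs_X1 E) (obs_Z1 E) e0) \<le> 5 * M"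
    "norm (defect (obs_A0 E) 1 (obs_X1 E) (obs_Z1 E) (obs_X1 E e0)) \<le> 5 * M"
    "norm (defect (obs_A1 E) (- 1) (obs_X1 E) (obs_Z1 E) (obs_X1 E e0)) \<le> 5 * M"
proof -
  interpret tensor_product "space1 E" "space2 E" "tens E"
    by (rule valid_scenario_tensor_product[OF E])
  interpret S1: observables "space1 E"
    by unfold_locales (rule S1)
  let ?X = "obs_X1 E" and ?Z = "obs_Z1 E" and ?A0 = "obs_A0 E" and ?A1 = "obs_A1 E" and ?u = "state E"
  have X: "pm1_observable (space1 E) ?X" and Z: "pm1_observable (space1 E) ?Z"
    and A0: "pm1_observable (space1 E) ?A0" and A1: "pm1_observable (space1 E) ?A1"
    and X2: "pm1_observable (space2 E) (obs_X2 E)" and Z2: "pm1_observable (space2 E) (obs_Z2 E)"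
    and u: "?u \<in> T" "norm ?u = 1"
    using E by (simp_all add: valid_scenario_def T_def)
  obtain x1 where x1: "pm1_observable T x1" "is_tensor_op ?X id x1"
    using pm1_observable_tensor[OF X pm1_observable_id] by blast
  obtain z1 where z1: "pm1_observable T z1" "is_tensor_op ?Z id z1"
    using pm1_observable_tensor[OF Z pm1_observable_id] by blast
  obtain a0 where a0: "pm1_observable T a0" "is_tensor_op ?A0 id a0"
    using pm1_observable_tensor[OF A0 pm1_observable_id] by blast
  obtain a1 where a1: "pm1_observable T a1" "is_tensor_op ?A1 id a1"
    using pm1_observable_tensor[OF A1 pm1_observable_id] by blast
  obtain x2 where x2: "pm1_observable T x2" "is_tensor_op id (obs_X2 E) x2"
    using pm1_observable_tensor[OF pm1_observable_id X2] by blast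
  obtain z2 where z2: "pm1_observable T z2" "is_tensor_op id (obs_Z2 E) z2"
    using pm1_observable_tensor[OF pm1_observable_id Z2] by blast
  have corr: "group_correlation E k = Re (cinner ?u (F (G ?u)))"
    if "k \<in> {1..8}" "group_obs E k = (A, B)" "is_tensor_op A id F" "is_tensor_op id B G" for k A B F G
    using that(2) is_tensor_op_comp[OF that(3,4)]
    by (intro group_correlation_eq(2)[OF E that(1)]) simp
  \<comment> \<open>The squared distance of two unit vectors is twice the deficit of their inner
    product; hence the form \<open>e\<^sup>2 / 2\<close> of the hypotheses.\<close>
  have close: "norm (F ?u - G ?u) \<le> e"
    if "pm1_observable T F" "pm1_observable T G" "1 - Re (cinner ?u (F (G ?u))) \<le> e\<^sup>2 / 2" for F G
  proof -
    have "G ?u \<in> T"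
      using that(2) u(1) by (rule pm1_observable_mem)
    then have "(norm (F ?u - G ?u))\<^sup>2 = 2 - 2 * Re (cinner ?u (F (G ?u)))"
      using that(1,2) u
      by (simp add: norm_diff_square pm1_observable_norm[of T] pm1_observable_adjoint[of T])
    then have "(norm (F ?u - G ?u))\<^sup>2 \<le> e\<^sup>2"
      using that(3) by simp
    then show ?thesis
      using e by (rule power2_le_imp_le)
  qed
  note x1_op = x1(2) and z1_op = z1(2) and a0_op = a0(2) and a1_op = a1(2)
  interpret bipartite_observables T ?u x1 z1 a0 a1 x2 z2 e e'
  proof
    show "csubspace T" "?u \<in> T" "norm ?u = 1"
      by (fact csubspace_T u)+
    show "pm1_observable T x1" "pm1_observable T z1" "pm1_observable T a0" "pm1_observable T a1"
      "pm1_observable T x2" "pm1_observable T z2"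
      by (fact x1 z1 a0 a1 x2 z2)+
    show "A (B v) = B (A v)" if "A \<in> {x1, z1, a0, a1}" "B \<in> {x2, z2}" "v \<in> T" for A B v
    proof -
      obtain A' B' where "is_tensor_op A' id A" "is_tensor_op id B' B"
        using \<open>A \<in> _\<close> \<open>B \<in> _\<close> x1(2) z1(2) a0(2) a1(2) x2(2) z2(2) by blast
      then show ?thesis
        using that(3) by (rule tensor_op_commute)
    qed
    show "norm (x1 ?u - z2 ?u) \<le> e"
      using c1 corr[of 1, OF _ group_obs_simps(1) x1(2) z2(2)]
      by (intro close x1 z2) simp
    show "norm (z1 ?u - x2 ?u) \<le> e"
      using c2 corr[of 2, OF _ group_obs_simps(2) z1(2) x2(2)]
      by (intro close z1 x2) simp
    show "sqrt 2 - e' \<le> Re (cinner ?u (a0 (z2 ?u))) + Re (cinner ?u (a0 (x2 ?u)))"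
      using c34 corr[of 3, OF _ group_obs_simps(3) a0(2) z2(2)]
        corr[of 4, OF _ group_obs_simps(4) a0(2) x2(2)] by simp
    show "sqrt 2 - e' \<le> Re (cinner ?u (a1 (z2 ?u))) - Re (cinner ?u (a1 (x2 ?u)))"
      using c56 corr[of 5, OF _ group_obs_simps(5) a1(2) z2(2)]
        corr[of 6, OF _ group_obs_simps(6) a1(2) x2(2)] by simp
    show "\<bar>Re (cinner ?u (x1 (x2 ?u))) + Re (cinner ?u (z1 (z2 ?u)))\<bar> \<le> e'"
      using c78 corr[of 7, OF _ group_obs_simps(7) x1(2) x2(2)]
        corr[of 8, OF _ group_obs_simps(8) z1(2) z2(2)] by simp
  qed
  have hM: "5 * h + 8 * e \<le> M"
    using M(1) by (simp add: h_def)
  let ?P = "spectral_proj 1 ?Z"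
  \<comment> \<open>Every operator is preceded by the projection, so a vector \<open>x\<close>
    enters only through \<open>?P x\<close>, an eigenvector of \<open>?Z\<close>.\<close>
  let ?W = "[\<lambda>v. anticommutator ?X ?Z (?P v), \<lambda>v. defect ?A0 1 ?X ?Z (?P v),
    \<lambda>v. defect ?A1 (- 1) ?X ?Z (?P v), \<lambda>v. defect ?A0 1 ?X ?Z (?X (?P v)),
    \<lambda>v. defect ?A1 (- 1) ?X ?Z (?X (?P v))]"
  let ?w = "[\<lambda>v. anticommutator x1 z1 (spectral_proj 1 z1 v), \<lambda>v. defect a0 1 x1 z1 (spectral_proj 1 z1 v),
    \<lambda>v. defect a1 (- 1) x1 z1 (spectral_proj 1 z1 v), \<lambda>v. defect a0 1 x1 z1 (x1 (spectral_proj 1 z1 v)),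
    \<lambda>v. defect a1 (- 1) x1 z1 (x1 (spectral_proj 1 z1 v))]"
  have five: "k < 5 \<longleftrightarrow> k = 0 \<or> k = 1 \<or> k = 2 \<or> k = 3 \<or> k = (4::nat)" for k
    by auto
  have "is_tensor_op (?W ! k) id (?w ! k)" if "k \<in> {..<5}" for k
  proof -
    note * = is_tensor_op_left_comp[OF _ is_tensor_op_left_spectral_proj[OF z1_op]]
    note x = is_tensor_op_left_comp[OF x1_op is_tensor_op_left_spectral_proj[OF z1_op]]
    note d0 = is_tensor_op_defect[OF a0_op x1_op z1_op] and d1 = is_tensor_op_defect[OF a1_op x1_op z1_op]
    show ?thesis
      using that *[OF is_tensor_op_anticommutator[OF x1_op z1_op]] *[OF d0] *[OF d1]
        is_tensor_op_left_comp[OF d0 x] is_tensor_op_left_comp[OF d1 x]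
      unfolding lessThan_iff five by (elim disjE) simp_all
  qed
  note ineq = tensor_norm_inequality[OF is_tensor_op_left_spectral_proj[OF z1_op] this]
  \<comment> \<open>At the state the left side is at most \<open>5 * M\<^sup>2\<close>, while
    \<open>norm_p_ge\<close> bounds the squared norm of the projection below by 1/4; 25 is a square
    larger than 20.\<close>
  have "\<exists>x\<in>space1 E. (\<Sum>k<5. (norm ((?W ! k) x))\<^sup>2) < (25 * M\<^sup>2) * (norm (?P x))\<^sup>2"
  proof (rule ccontr)
    assume "\<not> ?thesis"
    then have "(25 * M\<^sup>2) * (norm (spectral_proj 1 z1 ?u))\<^sup>2 \<le> (\<Sum>k<5. (norm ((?w ! k) ?u))\<^sup>2)"
      by (intro ineq u) (auto simp: not_less)
    also have "\<dots> \<le> (\<Sum>k<5::nat. M\<^sup>2)"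
    proof (intro sum_mono power_mono)
      fix k :: nat assume "k \<in> {..<5}"
      then have k: "k = 0 \<or> k = 1 \<or> k = 2 \<or> k = 3 \<or> k = 4"
        by auto
      have a0_corr': "sqrt 2 - e' \<le> Re (cinner ?u (a0 (z2 ?u))) + 1 * Re (cinner ?u (a0 (x2 ?u)))"
        and a1_corr': "sqrt 2 - e' \<le> Re (cinner ?u (a1 (z2 ?u))) + (- 1) * Re (cinner ?u (a1 (x2 ?u)))"
        using a0_corr a1_corr by simp_all
      have d: "norm (defect a0 1 x1 z1 p) \<le> M" "norm (defect a0 1 x1 z1 (x1 p)) \<le> M"
        "norm (defect a1 (- 1) x1 z1 p) \<le> M" "norm (defect a1 (- 1) x1 z1 (x1 p)) \<le> M"
        "norm (anticommutator x1 z1 p) \<le> M"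
        using norm_defect_p[OF _ _ a0_corr'] norm_defect_p[OF _ _ a1_corr'] norm_anticommutator_p hM
        by (auto intro: order_trans)
      show "norm ((?w ! k) ?u) \<le> M"
        using k d by (elim disjE) (simp_all add: p_def)
    qed simp
    also have "\<dots> = 5 * M\<^sup>2"
      by simp
    finally have "25 * M\<^sup>2 * (norm p)\<^sup>2 \<le> 5 * M\<^sup>2"
      by (simp add: p_def)
    moreover have "25 * M\<^sup>2 * (1 / 4) \<le> 25 * M\<^sup>2 * (norm p)\<^sup>2"
      using hM M by (intro mult_left_mono norm_p_ge) auto
    ultimately show False
      using M(2) by simp
  qed
  then obtain x where x: "x \<in> space1 E"
    and sum_less: "(\<Sum>k<5. (norm ((?W ! k) x))\<^sup>2) < (25 * M\<^sup>2) * (norm (?P x))\<^sup>2" ..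
  have le: "norm ((?W ! k) x) \<le> 5 * M * norm (?P x)" if "k < 5" for k
  proof (rule power2_le_imp_le)
    have "(norm ((?W ! k) x))\<^sup>2 \<le> (\<Sum>k<5. (norm ((?W ! k) x))\<^sup>2)"
      using that by (intro member_le_sum) auto
    then show "(norm ((?W ! k) x))\<^sup>2 \<le> (5 * M * norm (?P x))\<^sup>2"
      using sum_less by (simp add: power_mult_distrib)
  qed (use M in simp)
  have "0 \<le> (\<Sum>k<5. (norm ((?W ! k) x))\<^sup>2)"
    by (intro sum_nonneg) simp
  \<comment> \<open>The strict inequality excludes \<open>?P x = 0\<close>, so \<open>?P x\<close>
    can be normalised.\<close>
  then have n: "0 < norm (?P x)"
    using sum_less by (cases "?P x = 0") auto
  define e0 where "e0 = (1 / norm (?P x)) *\<^sub>R ?P x"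
  have Px: "?P x \<in> space1 E"
    by (rule spectral_proj_mem[OF Z S1 x])
  have XPx: "?X (?P x) \<in> space1 E"
    using X Px by (rule pm1_observable_mem)
  have scaled: "norm ((1 / norm (?P x)) *\<^sub>R v) \<le> 5 * M" if "norm v \<le> 5 * M * norm (?P x)" for v :: 'h
    using that n by (simp add: divide_le_eq)
  show ?thesis
  proof
    show "e0 \<in> space1 E" "norm e0 = 1"
      using Px n by (simp_all add: e0_def S1.mem_scaleR)
    have "?Z (?P x) = ?P x"
      using x by (simp add: spectral_proj_def S1.obs_simps Z add.commute)
    then show "?Z e0 = e0"
      using Px by (simp add: e0_def S1.obs_simps Z)
    have "anticommutator ?X ?Z e0 = (1 / norm (?P x)) *\<^sub>R anticommutator ?X ?Z (?P x)"
      using Px by (simp add: e0_def anticommutator_def S1.obs_simps X Z scaleR_add_right)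
    then show "norm (anticommutator ?X ?Z e0) \<le> 5 * M"
      using scaled[OF le[of 0, simplified]] by simp
    have d: "defect A s ?X ?Z e0 = (1 / norm (?P x)) *\<^sub>R defect A s ?X ?Z (?P x)"
      "defect A s ?X ?Z (?X e0) = (1 / norm (?P x)) *\<^sub>R defect A s ?X ?Z (?X (?P x))"
      if "pm1_observable (space1 E) A" for A s
      using that Px XPx S1.defect_scaleR[OF that X Z] S1.obs_scaleR[OF X Px] by (simp_all add: e0_def)
    show "norm (defect ?A0 1 ?X ?Z e0) \<le> 5 * M" "norm (defect ?A0 1 ?X ?Z (?X e0)) \<le> 5 * M"
      unfolding d[OF A0] using le[of 1] le[of 3] by (auto intro!: scaled simp del: norm_scaleR)
    show "norm (defect ?A1 (- 1) ?X ?Z e0) \<le> 5 * M" "norm (defect ?A1 (- 1) ?X ?Z (?X e0)) \<le> 5 * M"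
      unfolding d[OF A1] using le[of 2] le[of 4] by (auto intro!: scaled simp del: norm_scaleR)
  qed
qed

section \<open>Compression to a qubit\<close>

lemma UNIV_2_eq: "(UNIV :: 2 set) = {0, 1}"
proof -
  \<comment> \<open>Numerals of type \<open>2\<close> are read modulo 2.\<close>
  have "(2 :: 2) = 0"
    by simp
  then show ?thesis
    using UNIV_2 by (metis insert_commute)
qed

lemma sum_UNIV_2: "sum f (UNIV :: 2 set) = f 0 + f 1"
  by (simp add: UNIV_2_eq)

lemma all_2_iff: "(\<forall>i :: 2. P i) \<longleftrightarrow> P 0 \<and> P 1"
  using UNIV_2_eq by (metis UNIV_I insertE singletonD)

lemma qubit_eq_iff: "v = w \<longleftrightarrow> v $ 0 = w $ 0 \<and> v $ 1 = w $ 1" for v w :: "'a ^ 2"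
  by (simp add: vec_eq_iff all_2_iff)

lemma norm_vec_2_square: "(norm v)\<^sup>2 = (norm (v $ 0))\<^sup>2 + (norm (v $ 1))\<^sup>2"
  for v :: "'a::real_normed_vector ^ 2"
  by (simp add: norm_vec_def L2_set_def sum_UNIV_2)

lemma norm_vec_2_le: "norm v \<le> norm (v $ 0) + norm (v $ 1)" for v :: "'a::real_normed_vector ^ 2"
  by (rule power2_le_imp_le) (simp_all add: norm_vec_2_square power2_sum)

lemma cinner_vec_2: "cinner v w = cinner (v $ 0) (w $ 0) + cinner (v $ 1) (w $ 1)"
  for v w :: "'a::complex_hilbert ^ 2"
  by (simp add: cinner_vec_def sum_UNIV_2)

definition coordinates :: "'a::complex_hilbert \<Rightarrow> 'a \<Rightarrow> 'a \<Rightarrow> qubit" where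
  "coordinates e0 e1 x = (\<chi> i. if i = 0 then cinner e0 x else cinner e1 x)"

definition combination :: "'a::complex_hilbert \<Rightarrow> 'a \<Rightarrow> qubit \<Rightarrow> 'a" where
  "combination e0 e1 v = (v $ 0) *\<^sub>C e0 + (v $ 1) *\<^sub>C e1"

lemma coordinates_nth [simp]:
  "coordinates e0 e1 x $ 0 = cinner e0 x" "coordinates e0 e1 x $ 1 = cinner e1 x"
  by (simp_all add: coordinates_def)

lemma cinner_coordinates: "cinner (coordinates e0 e1 x) v = cinner x (combination e0 e1 v)"
  by (simp add: cinner_vec_2 cinner_complex_def combination_def cinner_simps
      cinner_commute[symmetric] mult.commute)

text \<open>The factor 2 is generous, but it holds for every angle between \<open>e0\<close> and
  \<open>e1\<close>, and for \<open>e1 = 0\<close>.\<close>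

lemma norm_coordinates_le:
  assumes "norm e0 \<le> 1" "norm e1 \<le> 1"
  shows "norm (coordinates e0 e1 x) \<le> 2 * norm x"
proof -
  have "cmod (cinner e0 x) \<le> 1 * norm x" "cmod (cinner e1 x) \<le> 1 * norm x"
    using assms by (intro order_trans[OF norm_cinner_le] mult_right_mono; simp)+
  then show ?thesis
    using norm_vec_2_le[of "coordinates e0 e1 x"] by simp
qed

lemma norm_combination_le:
  assumes "norm e0 \<le> 1" "norm e1 \<le> 1"
  shows "norm (combination e0 e1 v) \<le> 2 * norm v"
proof -
  have "norm (combination e0 e1 v) \<le> cmod (v $ 0) * norm e0 + cmod (v $ 1) * norm e1"
    using norm_triangle_ineq[of "(v $ 0) *\<^sub>C e0" "(v $ 1) *\<^sub>C e1"]
    by (simp add: combination_def norm_scaleC)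
  also have "\<dots> \<le> norm v * 1 + norm v * 1"
    using assms by (intro add_mono mult_mono Finite_Cartesian_Product.norm_nth_le) auto
  finally show ?thesis
    by simp
qed

lemma adj_on_coordinates:
  assumes S: "csubspace S" and e0: "e0 \<in> S" and e1: "e1 \<in> S"
  shows "adj_on S (coordinates e0 e1) = combination e0 e1"
  unfolding adj_on_def
proof (rule the_equality)
  have mem: "combination e0 e1 v \<in> S" for v
    unfolding combination_def
    by (rule complex_space.subspace_add[OF S complex_space.subspace_scale[OF S e0]
          complex_space.subspace_scale[OF S e1]])
  show "\<forall>y. combination e0 e1 y \<in> S \<and>
      (\<forall>x\<in>S. cinner (coordinates e0 e1 x) y = cinner x (combination e0 e1 y))"
    using mem by (simp add: cinner_coordinates)
  fix V assume V: "\<forall>y. V y \<in> S \<and> (\<forall>x\<in>S. cinner (coordinates e0 e1 x) y = cinner x (V y))"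
  show "V = combination e0 e1"
  proof
    fix y
    let ?w = "V y - combination e0 e1 y"
    have "?w \<in> S"
      by (rule complex_space.subspace_diff[OF S]) (use V mem in auto)
    then have "cinner ?w ?w = 0"
      using V by (simp add: cinner_diff_right flip: cinner_coordinates)
    then show "V y = combination e0 e1 y"
      by (simp add: cinner_self)
  qed
qed

lemma bounded_clinear_on_coordinates:
  assumes "norm e0 \<le> 1" "norm e1 \<le> 1"
  shows "bounded_clinear_on S (coordinates e0 e1)"
proof (rule bounded_clinear_onI)
  show "clinear_on S (coordinates e0 e1)"
    by (simp add: clinear_on_def qubit_eq_iff cinner_simps scaleC_vec_def scaleC_complex_def)
  show "norm (coordinates e0 e1 x) \<le> 2 * norm x" for x
    by (rule norm_coordinates_le[OF assms])
qed

text \<open>\<open>S\<close> may have more than two dimensions, so it is the adjoint that is shown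
  to preserve norms.\<close>

lemma isometry_on_orthonormal:
  assumes S: "csubspace S" and e: "e0 \<in> S" "e1 \<in> S" "norm e0 = 1" "norm e1 = 1" "cinner e0 e1 = 0"
  shows "isometry_on S (coordinates e0 e1)"
proof -
  have "(norm (combination e0 e1 v))\<^sup>2 = (norm v)\<^sup>2" for v
    using e by (simp add: combination_def norm_add_square norm_scaleC cinner_simps norm_vec_2_square)
  then have "norm (combination e0 e1 v) = norm v" for v
    by (metis norm_ge_zero power2_eq_imp_eq)
  then show ?thesis
    using bounded_clinear_on_coordinates[of e0 e1 S] e
    by (simp add: isometry_on_def adj_on_coordinates[OF S e(1,2)])
qed

text \<open>For small \<open>m\<close>, where nothing is known about the devices. With two
  independent vectors Gram-Schmidt gives an orthonormal pair; otherwise \<open>S\<close> is a line,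
  and its coordinate alone preserves norms.\<close>

lemma exists_isometry:
  assumes S: "csubspace S" and "\<exists>x\<in>S. x \<noteq> 0"
  obtains e0 e1 where "e0 \<in> S" "e1 \<in> S" "norm e0 \<le> 1" "norm e1 \<le> 1" "isometry_on S (coordinates e0 e1)"
proof -
  obtain x0 where x0: "x0 \<in> S" "x0 \<noteq> 0"
    using assms(2) by blast
  define e0 where "e0 = (1 / norm x0) *\<^sub>R x0"
  have e0: "e0 \<in> S" "norm e0 = 1"
    using x0 by (simp_all add: e0_def csubspace_scaleR[OF S])
  define r where "r x = x - cinner e0 x *\<^sub>C e0" for x
  have r: "r x \<in> S" "cinner e0 (r x) = 0" if "x \<in> S" for x
    using e0 complex_space.subspace_diff[OF S that complex_space.subspace_scale[OF S e0(1)]]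
    by (simp_all add: r_def cinner_simps cinner_self)
  show ?thesis
  proof (cases "\<exists>x\<in>S. r x \<noteq> 0")
    case True
    then obtain x where x: "x \<in> S" "r x \<noteq> 0"
      by blast
    define e1 where "e1 = (1 / norm (r x)) *\<^sub>R r x"
    have e1: "e1 \<in> S" "norm e1 = 1" "cinner e0 e1 = 0"
      using x r[OF x(1)] by (simp_all add: e1_def csubspace_scaleR[OF S] cinner_simps)
    show ?thesis
      using that[of e0 e1] isometry_on_orthonormal[OF S e0(1) e1(1) e0(2) e1(2,3)] e0 e1 by simp
  next
    case False
    have "norm (coordinates e0 0 x) = norm x" if "x \<in> S" for x
    proof -
      have "x = cinner e0 x *\<^sub>C e0"
        using False that by (simp add: r_def)
      then have "norm x = cmod (cinner e0 x)"
        using e0 norm_scaleC[of "cinner e0 x" e0] by simp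
      moreover have "(norm (coordinates e0 0 x))\<^sup>2 = (cmod (cinner e0 x))\<^sup>2"
        by (simp add: norm_vec_2_square)
      ultimately show ?thesis
        by simp
    qed
    then have "isometry_on S (coordinates e0 0)"
      using bounded_clinear_on_coordinates[of e0 0 S] e0 by (simp add: isometry_on_def)
    then show ?thesis
      using that[of e0 0] e0 complex_space.subspace_0[OF S] by simp
  qed
qed

text \<open>\<open>I\<close> has the real columns \<open>(a, b)\<close> and \<open>(c, d)\<close>.
  The error at \<open>v\<close> consists of the coordinates of the two residuals weighted by the
  entries of \<open>v\<close>; the factor 2 is that of \<open>norm_coordinates_le\<close>.\<close>

lemma onorm_compression:
  fixes A :: "'a::complex_hilbert \<Rightarrow> 'a" and a b c d :: real
  assumes S: "csubspace S" and A: "clinear_on S A" and e: "e0 \<in> S" "e1 \<in> S"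
    and on: "norm e0 = 1" "norm e1 = 1" "cinner e0 e1 = 0"
    and k0: "norm (A e0 - (a *\<^sub>R e0 + b *\<^sub>R e1)) \<le> k0"
    and k1: "norm (A e1 - (c *\<^sub>R e0 + d *\<^sub>R e1)) \<le> k1"
    and I: "\<And>v. I v $ 0 = of_real a * v $ 0 + of_real c * v $ 1"
      "\<And>v. I v $ 1 = of_real b * v $ 0 + of_real d * v $ 1"
  shows "onorm (\<lambda>v. coordinates e0 e1 (A (adj_on S (coordinates e0 e1) v)) - I v) \<le> 2 * (k0 + k1)"
proof (rule onorm_le)
  fix v :: qubit
  let ?r0 = "A e0 - (a *\<^sub>R e0 + b *\<^sub>R e1)" and ?r1 = "A e1 - (c *\<^sub>R e0 + d *\<^sub>R e1)"
  have e10: "cinner e1 e0 = 0"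
    using on(3) by (metis cinner_commute complex_cnj_zero)
  have "A (combination e0 e1 v) = (v $ 0) *\<^sub>C A e0 + (v $ 1) *\<^sub>C A e1"
    unfolding combination_def
    using clinear_on_add[OF A complex_space.subspace_scale[OF S e(1)]
        complex_space.subspace_scale[OF S e(2)]] clinear_on_scaleC[OF A] e by simp
  then have "coordinates e0 e1 (A (combination e0 e1 v)) - I v =
      coordinates e0 e1 ((v $ 0) *\<^sub>C ?r0 + (v $ 1) *\<^sub>C ?r1)"
    using on e10 by (simp add: qubit_eq_iff I cinner_simps cinner_self algebra_simps)
  then have "norm (coordinates e0 e1 (A (combination e0 e1 v)) - I v) \<le>
      2 * norm ((v $ 0) *\<^sub>C ?r0 + (v $ 1) *\<^sub>C ?r1)"
    using on norm_coordinates_le[of e0 e1] by simp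
  also have "norm ((v $ 0) *\<^sub>C ?r0 + (v $ 1) *\<^sub>C ?r1) \<le> norm v * k0 + norm v * k1"
    unfolding norm_scaleC[symmetric]
    by (rule order_trans[OF norm_triangle_ineq])
      (auto simp: norm_scaleC intro!: add_mono mult_mono k0 k1 Finite_Cartesian_Product.norm_nth_le)
  finally show "norm (coordinates e0 e1 (A (adj_on S (coordinates e0 e1) v)) - I v)
      \<le> 2 * (k0 + k1) * norm v"
    by (simp add: adj_on_coordinates[OF S e] algebra_simps)
qed

text \<open>A factor 2 for each of \<open>coordinates\<close> and its adjoint, and 1 for the ideal
  operator: \<open>2 * 2 + 1\<close>.\<close>

lemma onorm_compression_le_5:
  assumes S: "csubspace S" and A: "pm1_observable S A" and e: "e0 \<in> S" "e1 \<in> S"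
    and le: "norm e0 \<le> 1" "norm e1 \<le> 1" and I: "\<And>v. norm (I v) = norm v"
  shows "onorm (\<lambda>v. coordinates e0 e1 (A (adj_on S (coordinates e0 e1) v)) - I v) \<le> 5"
proof (rule onorm_le)
  fix v :: qubit
  have mem: "combination e0 e1 v \<in> S"
    unfolding combination_def
    by (rule complex_space.subspace_add[OF S complex_space.subspace_scale[OF S e(1)]
          complex_space.subspace_scale[OF S e(2)]])
  have "norm (coordinates e0 e1 (A (combination e0 e1 v))) \<le> 2 * norm (A (combination e0 e1 v))"
    by (rule norm_coordinates_le[OF le])
  also have "norm (A (combination e0 e1 v)) = norm (combination e0 e1 v)"
    by (rule pm1_observable_norm[OF A mem])
  finally show "norm (coordinates e0 e1 (A (adj_on S (coordinates e0 e1) v)) - I v) \<le> 5 * norm v"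
    using norm_triangle_ineq4[of "coordinates e0 e1 (A (combination e0 e1 v))" "I v"]
      norm_combination_le[OF le, of v] I[of v]
    by (simp add: adj_on_coordinates[OF S e])
qed

section \<open>The ideal devices\<close>

lemma ket_nth [simp]: "ket 0 $ 0 = 1" "ket 0 $ 1 = 0" "ket 1 $ 0 = 0" "ket 1 $ 1 = 1"
  by (simp_all add: ket_def axis_def)

lemma ket_plus_nth [simp]: "ket_plus $ 0 = 1 / sqrt 2" "ket_plus $ 1 = 1 / sqrt 2"
  by (simp_all add: ket_plus_def scaleR_conv_of_real[where 'a = complex])

lemma ket_minus_nth [simp]: "ket_minus $ 0 = 1 / sqrt 2" "ket_minus $ 1 = - 1 / sqrt 2"
  by (simp_all add: ket_minus_def scaleR_conv_of_real[where 'a = complex])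

lemma ideal_X_nth [simp]: "ideal_X v $ 0 = v $ 1" "ideal_X v $ 1 = v $ 0"
  by (simp_all add: ideal_X_def ketbra_def cinner_vec_2 cinner_complex_def scaleC_vec_def
      scaleC_complex_def)

lemma ideal_Z_nth [simp]: "ideal_Z v $ 0 = v $ 0" "ideal_Z v $ 1 = - v $ 1"
  by (simp_all add: ideal_Z_def ketbra_def cinner_vec_2 cinner_complex_def scaleC_vec_def
      scaleC_complex_def)

lemma ideal_A0_nth [simp]:
  "ideal_A0 v $ 0 = (v $ 1 + v $ 0) / sqrt 2" "ideal_A0 v $ 1 = (v $ 0 - v $ 1) / sqrt 2"
  by (simp_all add: ideal_A0_def scaleR_conv_of_real[where 'a = complex])

lemma ideal_A1_nth [simp]:
  "ideal_A1 v $ 0 = (v $ 1 - v $ 0) / sqrt 2" "ideal_A1 v $ 1 = (v $ 0 + v $ 1) / sqrt 2"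
  by (simp_all add: ideal_A1_def scaleR_conv_of_real[where 'a = complex])

lemma sqrt2_mult_complex: "complex_of_real (sqrt 2) * complex_of_real (sqrt 2) = 2"
  by (simp flip: of_real_mult)

lemma pm1_observable_ideal:
  "pm1_observable UNIV ideal_X" "pm1_observable UNIV ideal_Z"
  "pm1_observable UNIV ideal_A0" "pm1_observable UNIV ideal_A1"
  by (simp_all add: pm1_observable_def clinear_on_def qubit_eq_iff cinner_vec_2 cinner_complex_def
      scaleC_vec_def scaleC_complex_def field_simps sqrt2_mult_complex)

lemma valid_ideal_scenario: "valid_scenario ideal_scenario"
proof -
  let ?S = "{qubit_tensor x y | x y. x \<in> UNIV \<and> y \<in> UNIV}"
  let ?u = "qubit_tensor (ket 0) ket_plus + qubit_tensor (ket 1) ket_minus"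
  have "?u \<in> cspan ?S"
    by (intro complex_space.span_add complex_space.span_base) auto
  then have "(1 / sqrt 2) *\<^sub>R ?u \<in> cspan ?S"
    unfolding scaleR_scaleC by (rule complex_space.span_scale)
  then have state: "(1 / sqrt 2) *\<^sub>R ?u \<in> tensor_space UNIV UNIV qubit_tensor"
    unfolding tensor_space_def using closure_subset by blast
  have "(norm ((1 / sqrt 2) *\<^sub>R ?u))\<^sup>2 = 1"
    by (simp add: norm_vec_2_square qubit_tensor_def norm_divide power_divide)
  then have norm: "norm ((1 / sqrt 2) *\<^sub>R ?u) = 1"
    by (metis norm_ge_zero one_power2 power2_eq_imp_eq zero_le_one)
  have "hilbert_tensor UNIV UNIV qubit_tensor"
    by (simp add: hilbert_tensor_def clinear_on_def qubit_eq_iff qubit_tensor_def cinner_vec_2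
        cinner_complex_def scaleC_vec_def scaleC_complex_def algebra_simps)
  then show ?thesis
    using state norm pm1_observable_ideal
    by (simp add: valid_scenario_def ideal_scenario_def hilbert_space_on_def del: norm_scaleR)
qed

text \<open>The ideal state combines two product vectors, on which a tensor operator is explicit;
  \<open>corr\<close> thus reduces each value to arithmetic with components.\<close>

lemma group_correlation_ideal:
  "group_correlation ideal_scenario 1 = 1" "group_correlation ideal_scenario 2 = 1"
  "group_correlation ideal_scenario 3 = 1 / sqrt 2" "group_correlation ideal_scenario 4 = 1 / sqrt 2"
  "group_correlation ideal_scenario 5 = 1 / sqrt 2" "group_correlation ideal_scenario 6 = - 1 / sqrt 2"
  "group_correlation ideal_scenario 7 = 0" "group_correlation ideal_scenario 8 = 0"
proof -
  let ?E = "ideal_scenario"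
  interpret tensor_product "space1 ?E" "space2 ?E" "tens ?E"
    by (rule valid_scenario_tensor_product[OF valid_ideal_scenario])
  interpret T: observables T
    by unfold_locales (rule csubspace_T)
  let ?v0 = "qubit_tensor (ket 0) ket_plus" and ?v1 = "qubit_tensor (ket 1) ket_minus"
  have corr: "group_correlation ?E k = Re (cinner (?v0 + ?v1)
      (qubit_tensor (A (ket 0)) (B ket_plus) + qubit_tensor (A (ket 1)) (B ket_minus))) / 2"
    if k: "k \<in> {1..8}" and AB: "group_obs ?E k = (A, B)" for k A B
  proof -
    note obs = group_obs_pm1_observable[OF valid_ideal_scenario k, unfolded AB fst_conv snd_conv]
    obtain H where H: "is_tensor_op A B H"
      using pm1_observable_tensor[OF obs] by blast
    have v: "?v0 \<in> T" "?v1 \<in> T"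
      using tens_T by (simp_all add: ideal_scenario_def)
    have Hv: "H ?v0 = qubit_tensor (A (ket 0)) (B ket_plus)" "H ?v1 = qubit_tensor (A (ket 1)) (B ket_minus)"
      using is_tensor_opD(6)[OF H] by (simp_all add: ideal_scenario_def)
    have "H ((1 / sqrt 2) *\<^sub>R (?v0 + ?v1)) = (1 / sqrt 2) *\<^sub>R (H ?v0 + H ?v1)"
      using clinear_on_scaleR[OF is_tensor_opD(5)[OF H] T.mem_add[OF v]]
        clinear_on_add[OF is_tensor_opD(5)[OF H] v] by simp
    moreover have "group_correlation ?E k = Re (cinner (state ?E) (H (state ?E)))"
      using H by (intro group_correlation_eq(2)[OF valid_ideal_scenario k]) (simp add: AB)
    ultimately show ?thesis
      by (simp add: ideal_scenario_def Hv cinner_scaleR_left cinner_scaleR_right)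
  qed
  note compute = cinner_vec_2 cinner_complex_def qubit_tensor_def ideal_scenario_def
  show "group_correlation ?E 1 = 1"
    by (subst corr[OF _ group_obs_simps(1)]) (simp_all add: compute)
  show "group_correlation ?E 2 = 1"
    by (subst corr[OF _ group_obs_simps(2)]) (simp_all add: compute)
  show "group_correlation ?E 3 = 1 / sqrt 2"
    by (subst corr[OF _ group_obs_simps(3)]) (simp_all add: compute)
  show "group_correlation ?E 4 = 1 / sqrt 2"
    by (subst corr[OF _ group_obs_simps(4)]) (simp_all add: compute)
  show "group_correlation ?E 5 = 1 / sqrt 2"
    by (subst corr[OF _ group_obs_simps(5)]) (simp_all add: compute)
  show "group_correlation ?E 6 = - 1 / sqrt 2"
    by (subst corr[OF _ group_obs_simps(6)]) (simp_all add: compute)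
  show "group_correlation ?E 7 = 0"
    by (subst corr[OF _ group_obs_simps(7)]) (simp_all add: compute)
  show "group_correlation ?E 8 = 0"
    by (subst corr[OF _ group_obs_simps(8)]) (simp_all add: compute)
qed

section \<open>Self-testing\<close>

text \<open>If \<open>5 * M > 1\<close>, the claimed bound exceeds 5 and
  \<open>onorm_compression_le_5\<close> meets it; otherwise \<open>5 * M\<close> can serve as the
  \<open>\<eta>\<close> of \<open>eigenvector_pair\<close>.\<close>

lemma exists_qubit_isometry:
  fixes E :: "('h::complex_hilbert, 'k::complex_hilbert, 't::complex_hilbert) scenario"
  assumes E: "valid_scenario E" and e: "0 \<le> e"
    and c1: "1 - group_correlation E 1 \<le> e\<^sup>2 / 2" and c2: "1 - group_correlation E 2 \<le> e\<^sup>2 / 2"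
    and c34: "sqrt 2 - e' \<le> group_correlation E 3 + group_correlation E 4"
    and c56: "sqrt 2 - e' \<le> group_correlation E 5 - group_correlation E 6"
    and c78: "\<bar>group_correlation E 7 + group_correlation E 8\<bar> \<le> e'"
    and M: "5 * sqrt (2 * e' + e) + 8 * e \<le> M" "0 < M"
  shows "\<exists>U :: 'h \<Rightarrow> qubit. isometry_on (space1 E) U \<and>
    onorm (\<lambda>v. U (obs_X1 E (adj_on (space1 E) U v)) - ideal_X v) \<le> 70 * M \<and>
    onorm (\<lambda>v. U (obs_Z1 E (adj_on (space1 E) U v)) - ideal_Z v) \<le> 70 * M \<and>
    onorm (\<lambda>v. U (obs_A0 E (adj_on (space1 E) U v)) - ideal_A0 v) \<le> 70 * M \<and>
    onorm (\<lambda>v. U (obs_A1 E (adj_on (space1 E) U v)) - ideal_A1 v) \<le> 70 * M"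
proof -
  interpret tensor_product "space1 E" "space2 E" "tens E"
    by (rule valid_scenario_tensor_product[OF E])
  interpret S1: observables "space1 E"
    by unfold_locales (rule S1)
  have X: "pm1_observable (space1 E) (obs_X1 E)" and Z: "pm1_observable (space1 E) (obs_Z1 E)"
    and A0: "pm1_observable (space1 E) (obs_A0 E)" and A1: "pm1_observable (space1 E) (obs_A1 E)"
    using E by (simp_all add: valid_scenario_def)
  show ?thesis
  proof (cases "5 * M \<le> 1")
    case True
    then have "M \<le> 1"
      using M(2) by simp
    then obtain e0 where e0: "e0 \<in> space1 E" "norm e0 = 1" "obs_Z1 E e0 = e0"
      and ac: "norm (anticommutator (obs_X1 E) (obs_Z1 E) e0) \<le> 5 * M"
      and d: "norm (defect (obs_A0 E) 1 (obs_X1 E) (obs_Z1 E) e0) \<le> 5 * M"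
        "norm (defect (obs_A1 E) (- 1) (obs_X1 E) (obs_Z1 E) e0) \<le> 5 * M"
        "norm (defect (obs_A0 E) 1 (obs_X1 E) (obs_Z1 E) (obs_X1 E e0)) \<le> 5 * M"
        "norm (defect (obs_A1 E) (- 1) (obs_X1 E) (obs_Z1 E) (obs_X1 E e0)) \<le> 5 * M"
      by (rule exists_approximate_qubit[OF E e c1 c2 c34 c56 c78 M])
    obtain e1 where e1: "e1 \<in> space1 E" "norm e1 = 1" "cinner e0 e1 = 0" "obs_Z1 E e1 = - e1"
      and Xe: "norm (obs_X1 E e0 - e1) \<le> 5 * M" "norm (obs_X1 E e1 - e0) \<le> 5 * M"
      by (rule S1.eigenvector_pair[OF X Z e0 ac True])
    note compression = onorm_compression[OF S1 pm1_observable_clinear e0(1) e1(1) e0(2) e1(2,3)]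
    note A0_pair = S1.defect_pair[OF A0 X Z _ e0(1,3) e1(1,4) Xe d(1,3)]
    note A1_pair = S1.defect_pair[OF A1 X Z _ e0(1,3) e1(1,4) Xe d(2,4)]
    let ?U = "coordinates e0 e1"
    have "onorm (\<lambda>v. ?U (obs_X1 E (adj_on (space1 E) ?U v)) - ideal_X v) \<le> 2 * (5 * M + 5 * M)"
      by (rule compression[OF X, of 0 1 _ 1 0]) (use Xe in simp_all)
    \<comment> \<open>No error here: \<open>e0\<close> and \<open>e1\<close> are exact
      eigenvectors.\<close>
    moreover have "onorm (\<lambda>v. ?U (obs_Z1 E (adj_on (space1 E) ?U v)) - ideal_Z v) \<le> 2 * (0 + 0)"
      by (rule compression[OF Z, of 1 0 _ 0 "- 1"]) (use e0 e1 in simp_all)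
    \<comment> \<open>The worst case and the origin of 70.\<close>
    moreover have "onorm (\<lambda>v. ?U (obs_A0 E (adj_on (space1 E) ?U v)) - ideal_A0 v) \<le>
        2 * (2 * (5 * M) + 5 * (5 * M))"
      by (rule compression[OF A0 A0_pair]) (simp_all add: add_divide_distrib diff_divide_distrib)
    moreover have "onorm (\<lambda>v. ?U (obs_A1 E (adj_on (space1 E) ?U v)) - ideal_A1 v) \<le>
        2 * (2 * (5 * M) + 5 * (5 * M))"
      by (rule compression[OF A1 A1_pair]) (simp_all add: add_divide_distrib diff_divide_distrib)
    ultimately show ?thesis
      using isometry_on_orthonormal[OF S1 e0(1) e1(1) e0(2) e1(2,3)] M(2)
      by (intro exI[of _ ?U]) (auto intro: order_trans)
  next
    case False
    \<comment> \<open>On the zero space the norm inequality holds even with an empty right side;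
      transferred to the state, it would make a unit vector vanish.\<close>
    have "\<exists>x\<in>space1 E. x \<noteq> 0"
    proof (rule ccontr)
      assume "\<not> ?thesis"
      then have "1 * (norm (id (state E)))\<^sup>2 \<le> (\<Sum>k\<in>{}. (norm (id (state E)))\<^sup>2)"
        using E
        by (intro tensor_norm_inequality[where W = "\<lambda>_. id", OF is_tensor_op_id])
          (auto simp: valid_scenario_def T_def)
      then show False
        using E by (simp add: valid_scenario_def)
    qed
    then obtain e0 e1 where e: "e0 \<in> space1 E" "e1 \<in> space1 E" "norm e0 \<le> 1" "norm e1 \<le> 1"
      and iso: "isometry_on (space1 E) (coordinates e0 e1)"
      by (rule exists_isometry[OF S1])
    have norm: "norm (I v) = norm v" if "pm1_observable UNIV I" for I :: "qubit \<Rightarrow> qubit" and v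
      using pm1_observable_norm[OF that] by simp
    have le: "onorm (\<lambda>v. coordinates e0 e1 (A (adj_on (space1 E) (coordinates e0 e1) v)) - I v) \<le> 70 * M"
      if "pm1_observable (space1 E) A" "pm1_observable UNIV I" for A I
      using onorm_compression_le_5[where I = I, OF S1 that(1) e norm[OF that(2)]] False by linarith
    show ?thesis
      by (intro exI[of _ "coordinates e0 e1"] conjI iso le X Z A0 A1 pm1_observable_ideal)
  qed
qed

theorem theorem1:
  fixes \<alpha> \<beta> :: real
  assumes "0 < \<alpha>" "\<alpha> < 1" "0 < \<beta>" "\<beta> < 1"
  shows "\<exists>c1 c2 :: real. 0 < c1 \<and> 0 < c2 \<and>
    (\<forall>m :: nat. 0 < m \<longrightarrow>
      \<beta> \<le> pass_prob ideal_scenario m c1 \<and>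
      (let \<delta> = c2 * real m powr (- 1 / 4) in
       guaranteed \<alpha> m c1
         (\<lambda>E :: ('h::complex_hilbert, 'k::complex_hilbert, 't::complex_hilbert) scenario.
           \<exists>U :: 'h \<Rightarrow> qubit. isometry_on (space1 E) U \<and>
             onorm (\<lambda>v. U (obs_X1 E (adj_on (space1 E) U v)) - ideal_X v) \<le> \<delta> \<and>
             onorm (\<lambda>v. U (obs_Z1 E (adj_on (space1 E) U v)) - ideal_Z v) \<le> \<delta> \<and>
             onorm (\<lambda>v. U (obs_A0 E (adj_on (space1 E) U v)) - ideal_A0 v) \<le> \<delta> \<and>
             onorm (\<lambda>v. U (obs_A1 E (adj_on (space1 E) U v)) - ideal_A1 v) \<le> \<delta>)))"
proof -
  \<comment> \<open>The three failure probabilities \<open>2 / c1\<^sup>2\<close> of the ideal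
    devices then add up to \<open>1 - \<beta>\<close>.\<close>
  define c1 where "c1 = sqrt (6 / (1 - \<beta>))"
  \<comment> \<open>\<open>k / sqrt m\<close> and \<open>s / sqrt m\<close> will be
    \<open>e'\<close> and \<open>e\<close>. Here \<open>k\<close> adds the statistical error to the
    tolerance of the test, and \<open>s\<close> makes \<open>e\<^sup>2 / 2\<close> equal to the
    bound \<open>2 * ln (1 / \<alpha>) / m\<close> of the first two groups.\<close>
  define k where "k = c1 + sqrt (2 / \<alpha>)"
  define s where "s = 2 * sqrt (ln (1 / \<alpha>))"
  \<comment> \<open>The value of \<open>5 * h + 8 * e\<close> at \<open>m = 1\<close>. For larger
    \<open>m\<close>, \<open>h\<close> decreases like \<open>m powr (- 1 / 4)\<close>, and
    \<open>e\<close> decreases faster.\<close>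
  define M0 where "M0 = 5 * sqrt (2 * k + s) + 8 * s"
  have c1: "0 < c1" "6 / c1\<^sup>2 = 1 - \<beta>"
    using assms by (simp_all add: c1_def)
  have k: "0 < k"
    using c1 assms by (simp add: k_def add_pos_pos)
  have s: "0 < s" "s\<^sup>2 = 4 * ln (1 / \<alpha>)"
    using assms by (simp_all add: s_def power_mult_distrib ln_div)
  have M0: "0 < M0"
    using k s by (simp add: M0_def add_pos_pos)
  have ideal: "\<beta> \<le> pass_prob ideal_scenario m c1" if m: "0 < m" for m
  proof -
    have "2 / sqrt 2 = sqrt 2"
      by (rule real_div_sqrt) simp
    then have "1 - 6 / c1\<^sup>2 \<le> pass_prob ideal_scenario m c1"
      using c1 group_correlation_eq(1)[OF valid_ideal_scenario] m
      by (intro pass_prob_ideal[where r = "group_correlation ideal_scenario"])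
        (simp_all add: group_correlation_ideal group_correlation_def[symmetric] del: One_nat_def)
    then show ?thesis
      using c1 by simp
  qed
  \<comment> \<open>The guarantee in contrapositive form: a passing probability above
    \<open>\<alpha>\<close> is what is known of the devices.\<close>
  have real: "\<exists>U :: 'h \<Rightarrow> qubit. isometry_on (space1 E) U \<and>
      onorm (\<lambda>v. U (obs_X1 E (adj_on (space1 E) U v)) - ideal_X v) \<le> 70 * M0 * real m powr (- 1 / 4) \<and>
      onorm (\<lambda>v. U (obs_Z1 E (adj_on (space1 E) U v)) - ideal_Z v) \<le> 70 * M0 * real m powr (- 1 / 4) \<and>
      onorm (\<lambda>v. U (obs_A0 E (adj_on (space1 E) U v)) - ideal_A0 v) \<le> 70 * M0 * real m powr (- 1 / 4) \<and>
      onorm (\<lambda>v. U (obs_A1 E (adj_on (space1 E) U v)) - ideal_A1 v) \<le> 70 * M0 * real m powr (- 1 / 4)"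
    if m: "0 < m" and E: "valid_scenario E" and pass: "\<alpha> < pass_prob E m c1"
    for m and E :: "('h, 'k, 't) scenario"
  proof -
    define q where "q = real m powr (- 1 / 4)"
    have q: "0 < q" "q \<le> 1"
      using m powr_mono[of "- 1 / 4" 0 "real m"] by (simp_all add: q_def)
    have q2: "q\<^sup>2 = 1 / sqrt m"
    proof -
      have "q\<^sup>2 = real m powr (- (1 / 2))"
        by (simp add: q_def power2_eq_square flip: powr_add)
      then show ?thesis
        using m by (simp add: powr_minus_divide powr_half_sqrt)
    qed
    have q4: "(q\<^sup>2)\<^sup>2 = 1 / m"
      using m by (simp add: q2 power_divide)
    have q2_le: "q\<^sup>2 \<le> q"
      using q by (simp add: power2_eq_square mult_left_le)
    note bounds = pass_prob_bounds[OF group_correlation_eq(1)[OF E]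
        group_correlation_def[symmetric] m pass assms(1), folded k_def]
    have "(s * q\<^sup>2)\<^sup>2 / 2 = 2 * ln (1 / \<alpha>) / m"
      unfolding power_mult_distrib s q4 by simp
    moreover have "k / sqrt m = k * q\<^sup>2"
      by (simp add: q2)
    moreover have "5 * sqrt (2 * (k * q\<^sup>2) + s * q\<^sup>2) + 8 * (s * q\<^sup>2) \<le> M0 * q"
    proof -
      have "sqrt (2 * (k * q\<^sup>2) + s * q\<^sup>2) = sqrt ((2 * k + s) * q\<^sup>2)"
        by (simp add: algebra_simps)
      also have "\<dots> = sqrt (2 * k + s) * q"
        using q by (simp add: real_sqrt_mult)
      finally show ?thesis
        using mult_left_mono[OF q2_le, of s] s by (simp add: M0_def algebra_simps)
    qed
    moreover have "0 < M0 * q" "0 \<le> s * q\<^sup>2"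
      using M0 q s by simp_all
    ultimately show ?thesis
      using exists_qubit_isometry[OF E, of "s * q\<^sup>2" "k * q\<^sup>2" "M0 * q"] bounds
      by (simp add: q_def mult.assoc)
  qed
  show ?thesis
  proof (rule exI[of _ c1], rule exI[of _ "70 * M0"], intro conjI allI impI)
    fix m :: nat assume m: "0 < m"
    show "\<beta> \<le> pass_prob ideal_scenario m c1"
      by (rule ideal[OF m])
    show "let \<delta> = 70 * M0 * real m powr (- 1 / 4) in
       guaranteed \<alpha> m c1
         (\<lambda>E :: ('h, 'k, 't) scenario.
           \<exists>U :: 'h \<Rightarrow> qubit. isometry_on (space1 E) U \<and>
             onorm (\<lambda>v. U (obs_X1 E (adj_on (space1 E) U v)) - ideal_X v) \<le> \<delta> \<and>
             onorm (\<lambda>v. U (obs_Z1 E (adj_on (space1 E) U v)) - ideal_Z v) \<le> \<delta> \<and>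
             onorm (\<lambda>v. U (obs_A0 E (adj_on (space1 E) U v)) - ideal_A0 v) \<le> \<delta> \<and>
             onorm (\<lambda>v. U (obs_A1 E (adj_on (space1 E) U v)) - ideal_A1 v) \<le> \<delta>)"
      unfolding guaranteed_def Let_def using real[OF m] not_le by blast
  qed (use c1 M0 in simp_all)
qed

end
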